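(* Let $2\le p\le\infty$ and let $q$ be its conjugate index, $\frac1p+\frac1q=1$. Let $\sigma$ be an operator-valued symbol on $P\times\widehat P$, i.e. $\sigma(b,a,\vartheta,\pi_i^j)\in B(L^2(C_i^j))$ for all $(b,a,\vartheta)\in P$ and $i,j=1,2$, such that $D_i^j\sigma(b,a,\vartheta,\pi_i^j)\in S_q(C_i^j)$ for all $(b,a,\vartheta)\in P$ and $i,j=1,2$. Suppose that for $i,j=1,2$ the function $G_i^j:P\to\mathbb C$, $$G_i^j(b,a,\vartheta)=\Delta(b,a,\vartheta)^{-1/2}\,\|D_i^j\sigma(b,a,\vartheta,\pi_i^j)\|_{S_q(C_i^j)},$$ belongs to $L^p(P)$. Then $T_\sigma:L^2(P)\to L^p(P)$ is a bounded operator and $$\|T_\sigma\|_{B(L^2(P),L^p(P))}\le \|G_1^1\|_{L^p(P)}+\|G_2^1\|_{L^p(P)}+\|G_1^2\|_{L^p(P)}+\|G_2^2\|_{L^p(P)}.$$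
   Context: The affine Poincar\'e group is $P=\{(b,a,\vartheta):b\in\mathbb R^2,\ a>0,\ \vartheta\in\mathbb R\}$ with product $(b,a,\vartheta)*(b',a',\vartheta')=(b+a\Lambda_\vartheta b',\,aa',\,\vartheta+\vartheta')$, where $\Lambda_\vartheta=\begin{pmatrix}\cosh\vartheta&\sinh\vartheta\\ \sinh\vartheta&\cosh\vartheta\end{pmatrix}$. Its left Haar measure is $d\mu(b,a,\vartheta)=\frac{db\,da\,d\vartheta}{a^3}$ and its modular function is $\Delta(b,a,\vartheta)=a^{-2}$. $L^p(P)$ is taken with respect to $\mu$. $\langle x;y\rangle=x_1y_1-x_2y_2$ is the Minkowski form on $\mathbb R^2$. The four cones are $C_1^1=\{x_1^2>x_2^2,\ x_1>0\}$, $C_2^1=\{x_1^2>x_2^2,\ x_1<0\}$, $C_1^2=\{x_1^2<x_2^2,\ x_2>0\}$, $C_2^2=\{x_1^2<x_2^2,\ x_2<0\}$ in $\mathbb R^2$. For $i,j=1,2$, $\pi_i^j$ is the unitary representation of $P$ on $L^2(C_i^j)$ given by $(\pi_i^j(b,a,\vartheta)\varphi)(x)=a\,e^{i\langle x;b\rangle}\varphi(a\Lambda_{-\vartheta}x)$, and $\widehat P=\{\pi_i^j:i,j=1,2\}$. The Duflo--Moore operators are the unbounded operators $(D_i^j\varphi)(x)=\frac1{2\pi}|\langle x;x\rangle|^{1/2}\varphi(x)$ on $L^2(C_i^j)$. For $f\in L^1(P)\cap L^2(P)$ the Fourier transform is the operator $(\widehat f(\pi_i^j)\varphi)(x)=\int_P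 f(b,a,\vartheta)\,\big(\pi_i^j(b,a,\vartheta)D_i^j\varphi\big)(x)\,d\mu(b,a,\vartheta)$ on $L^2(C_i^j)$; it is a Hilbert--Schmidt operator, and $f\mapsto\widehat f(\pi_i^j)$ is extended by continuity to $f\in L^2(P)$ with values in Hilbert--Schmidt operators. $B(L^2(C_i^j))$ is the space of bounded operators on $L^2(C_i^j)$. For $1\le q<\infty$, $S_q(C_i^j)$ is the Schatten class of compact operators on $L^2(C_i^j)$ with $q$-summable singular values, and $S_\infty(C_i^j)=B(L^2(C_i^j))$. The pseudo-differential operator with symbol $\sigma$ is $$(T_\sigma f)(b,a,\vartheta)=\Delta(b,a,\vartheta)^{-1/2}\sum_{i,j=1}^2\mathrm{Tr}\big[D_i^j\,\sigma(b,a,\vartheta,\pi_i^j)\,\widehat f(\pi_i^j)\,\pi_i^j(b,a,\vartheta)^*\big].$$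
   Formalization: The symbol σ is additionally assumed weakly measurable in (b,a,ϑ); without this T_σ f need not be measurable (multiply σ by a non-measurable ±1-valued function of (b,a,ϑ), which leaves every G_i^j unchanged). *)

theory Defs
  imports "HOL-Probability.Probability"
begin

section \<open>$L^p$ spaces and operators between them\<close>

text \<open>
  Elements of $L^p(M)$ are represented by measurable functions, and equality in $L^p(M)$ is equality
  almost everywhere. An operator is a map on representatives that is linear up to null sets; with
  the norm bound this makes it compatible with almost everywhere equality. The exponent ranges over
  $[1,\infty]$ and \<open>\<infinity>\<close> selects the essential supremum.
\<close>

definition Lp :: "ennreal \<Rightarrow> 'a measure \<Rightarrow> ('a \<Rightarrow> complex) set" where
  "Lp p M = {f \<in> borel_measurable M.
     if p = \<infinity> then esssup M (\<lambda>x. ennreal (cmod (f x))) < \<infinity>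
     else integrable M (\<lambda>x. cmod (f x) powr enn2real p)}"

definition Lp_norm :: "ennreal \<Rightarrow> 'a measure \<Rightarrow> ('a \<Rightarrow> complex) \<Rightarrow> real" where
  "Lp_norm p M f =
     (if p = \<infinity> then enn2real (esssup M (\<lambda>x. ennreal (cmod (f x))))
      else (\<integral>x. cmod (f x) powr enn2real p \<partial>M) powr (1 / enn2real p))"

definition bounded_op ::
  "ennreal \<Rightarrow> 'a measure \<Rightarrow> ennreal \<Rightarrow> 'b measure \<Rightarrow> (('a \<Rightarrow> complex) \<Rightarrow> 'b \<Rightarrow> complex) \<Rightarrow> bool"
where
  "bounded_op p M r N T \<longleftrightarrow>
     (\<forall>f\<in>Lp p M. T f \<in> Lp r N) \<and>
     (\<forall>f\<in>Lp p M. \<forall>g\<in>Lp p M. AE x in N. T (\<lambda>y. f y + g y) x = T f x + T g x) \<and>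
     (\<forall>c. \<forall>f\<in>Lp p M. AE x in N. T (\<lambda>y. c * f y) x = c * T f x) \<and>
     (\<exists>C. \<forall>f\<in>Lp p M. Lp_norm r N (T f) \<le> C * Lp_norm p M f)"

definition op_norm ::
  "ennreal \<Rightarrow> 'a measure \<Rightarrow> ennreal \<Rightarrow> 'b measure \<Rightarrow> (('a \<Rightarrow> complex) \<Rightarrow> 'b \<Rightarrow> complex) \<Rightarrow> real"
where
  "op_norm p M r N T =
     Inf {C. 0 \<le> C \<and> (\<forall>f\<in>Lp p M. Lp_norm r N (T f) \<le> C * Lp_norm p M f)}"

section \<open>Operators on the Hilbert space $L^2(M)$\<close>

type_synonym 'a operator = "('a \<Rightarrow> complex) \<Rightarrow> 'a \<Rightarrow> complex"

abbreviation L2 :: "'a measure \<Rightarrow> ('a \<Rightarrow> complex) set" where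
  "L2 M \<equiv> Lp 2 M"

abbreviation L2_norm :: "'a measure \<Rightarrow> ('a \<Rightarrow> complex) \<Rightarrow> real" where
  "L2_norm M \<equiv> Lp_norm 2 M"

text \<open>The bounded operators $B(L^2(M))$.\<close>

abbreviation L2_op :: "'a measure \<Rightarrow> 'a operator \<Rightarrow> bool" where
  "L2_op M \<equiv> bounded_op 2 M 2 M"

definition L2_inner :: "'a measure \<Rightarrow> ('a \<Rightarrow> complex) \<Rightarrow> ('a \<Rightarrow> complex) \<Rightarrow> complex" where
  "L2_inner M f g = (\<integral>x. f x * cnj (g x) \<partial>M)"

text \<open>Bases are indexed by \<^typ>\<open>nat\<close>: the spaces $L^2(C)$ below, with $C$ a cone, are separable
  and infinite-dimensional.\<close>

definition orthonormal_basis :: "'a measure \<Rightarrow> (nat \<Rightarrow> 'a \<Rightarrow> complex) \<Rightarrow> bool" where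
  "orthonormal_basis M e \<longleftrightarrow>
     (\<forall>k. e k \<in> L2 M) \<and>
     (\<forall>k l. L2_inner M (e k) (e l) = (if k = l then 1 else 0)) \<and>
     (\<forall>f\<in>L2 M. (\<lambda>n. L2_norm M (\<lambda>x. f x - (\<Sum>k<n. L2_inner M f (e k) * e k x))) \<longlonglongrightarrow> 0)"

definition some_basis :: "'a measure \<Rightarrow> nat \<Rightarrow> 'a \<Rightarrow> complex" where
  "some_basis M = (SOME e. orthonormal_basis M e)"

definition is_adjoint :: "'a measure \<Rightarrow> 'a operator \<Rightarrow> 'a operator \<Rightarrow> bool" where
  "is_adjoint M A B \<longleftrightarrow>
     L2_op M B \<and> (\<forall>f\<in>L2 M. \<forall>g\<in>L2 M. L2_inner M (A f) g = L2_inner M f (B g))"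

definition adjoint_op :: "'a measure \<Rightarrow> 'a operator \<Rightarrow> 'a operator" where
  "adjoint_op M A = (SOME B. is_adjoint M A B)"

definition compact_op :: "'a measure \<Rightarrow> 'a operator \<Rightarrow> bool" where
  "compact_op M A \<longleftrightarrow> L2_op M A \<and>
     (\<forall>f :: nat \<Rightarrow> 'a \<Rightarrow> complex. (\<forall>n. f n \<in> L2 M \<and> L2_norm M (f n) \<le> 1) \<longrightarrow>
        (\<exists>g\<in>L2 M. \<exists>r. strict_mono r \<and>
           (\<lambda>n. L2_norm M (\<lambda>x. A (f (r n)) x - g x)) \<longlonglongrightarrow> 0))"

text \<open>
  The singular values of a compact operator $A$ are the eigenvalues of $|A| = (A^*A)^{1/2}$, i.e. the
  nonnegative square roots of the eigenvalues of $A^*A$. They are listed with multiplicity along an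
  orthonormal eigenbasis (zeros included, in no particular order), so that \<open>s\<close> is determined by $A$ up
  to a permutation.
\<close>

definition singular_values :: "'a measure \<Rightarrow> 'a operator \<Rightarrow> (nat \<Rightarrow> real) \<Rightarrow> bool" where
  "singular_values M A s \<longleftrightarrow>
     (\<forall>k. 0 \<le> s k) \<and>
     (\<exists>e B. orthonormal_basis M e \<and> is_adjoint M A B \<and>
        (\<forall>k. AE x in M. B (A (e k)) x = complex_of_real ((s k)\<^sup>2) * e k x))"

definition schatten_class :: "ennreal \<Rightarrow> 'a measure \<Rightarrow> 'a operator set" where
  "schatten_class q M =
     (if q = \<infinity> then {A. L2_op M A}
      else {A. compact_op M A \<and>
              (\<exists>s. singular_values M A s \<and> summable (\<lambda>k. s k powr enn2real q))})"

definition schatten_norm :: "ennreal \<Rightarrow> 'a measure \<Rightarrow> 'a operator \<Rightarrow> real" where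
  "schatten_norm q M A =
     (if q = \<infinity> then op_norm 2 M 2 M A
      else (let s = (SOME s. singular_values M A s)
            in (\<Sum>k. s k powr enn2real q) powr (1 / enn2real q)))"

text \<open>The choice of basis in the next three definitions is immaterial.\<close>

definition hilbert_schmidt :: "'a measure \<Rightarrow> 'a operator \<Rightarrow> bool" where
  "hilbert_schmidt M A \<longleftrightarrow>
     L2_op M A \<and> summable (\<lambda>k. (L2_norm M (A (some_basis M k)))\<^sup>2)"

definition hs_norm :: "'a measure \<Rightarrow> 'a operator \<Rightarrow> real" where
  "hs_norm M A = sqrt (\<Sum>k. (L2_norm M (A (some_basis M k)))\<^sup>2)"

definition trace_op :: "'a measure \<Rightarrow> 'a operator \<Rightarrow> complex" where
  "trace_op M A = (\<Sum>k. L2_inner M (A (some_basis M k)) (some_basis M k))"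

section \<open>The affine Poincare group\<close>

type_synonym plane = "real \<times> real"
type_synonym pgroup = "plane \<times> real \<times> real"

definition Lambda :: "real \<Rightarrow> plane \<Rightarrow> plane" where
  "Lambda t x = (cosh t * fst x + sinh t * snd x, sinh t * fst x + cosh t * snd x)"

definition poincare :: "pgroup set" where
  "poincare = {(b, a, t). 0 < a}"

fun poincare_mult :: "pgroup \<Rightarrow> pgroup \<Rightarrow> pgroup" where
  "poincare_mult (b, a, t) (b', a', t') = (b + a *\<^sub>R Lambda t b', a * a', t + t')"

text \<open>The left Haar measure $a^{-3}\,db\,da\,d\vartheta$ and the modular function of the product above.\<close>

definition haar :: "pgroup measure" where
  "haar = density (restrict_space lborel poincare) (\<lambda>(b, a, t). ennreal (1 / a ^ 3))"

fun modular :: "pgroup \<Rightarrow> real" where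
  "modular (b, a, t) = 1 / a\<^sup>2"

section \<open>Representations, Duflo-Moore operators and Fourier transform\<close>

definition minkowski :: "plane \<Rightarrow> plane \<Rightarrow> real" where
  "minkowski x y = fst x * fst y - snd x * snd y"

text \<open>\<open>cone i j\<close> is $C_i^j$, for $i, j \in \{1, 2\}$.\<close>

definition cone :: "nat \<Rightarrow> nat \<Rightarrow> plane set" where
  "cone i j =
     (if j = 1
      then {x. (fst x)\<^sup>2 > (snd x)\<^sup>2 \<and> (if i = 1 then fst x > 0 else fst x < 0)}
      else {x. (fst x)\<^sup>2 < (snd x)\<^sup>2 \<and> (if i = 1 then snd x > 0 else snd x < 0)})"

definition cone_measure :: "nat \<Rightarrow> nat \<Rightarrow> plane measure" where
  "cone_measure i j = restrict_space lborel (cone i j)"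

text \<open>
  The representations $\pi_i^j$, and likewise the Duflo-Moore operators $D_i^j$, are given by one
  formula for all four cones; the pair $(i,j)$ only enters through the space $L^2(C_i^j)$ on which
  they act.
\<close>

fun rep :: "pgroup \<Rightarrow> plane operator" where
  "rep (b, a, t) \<phi> x =
     complex_of_real a * exp (\<i> * complex_of_real (minkowski x b)) * \<phi> (a *\<^sub>R Lambda (- t) x)"

lemma rep_mult: "rep (poincare_mult g h) \<phi> = rep g (rep h \<phi>)"
proof -
  obtain b a t b' a' t' where gh: "g = (b, a, t)" "h = (b', a', t')"
    by (metis prod_cases3)
  have m: "minkowski x (b + a *\<^sub>R Lambda t b')
      = minkowski x b + minkowski (a *\<^sub>R Lambda (- t) x) b'" for x
    by (simp add: minkowski_def Lambda_def algebra_simps)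
  have c: "cosh (- t - t') = cosh t * cosh t' + sinh t * sinh t'"
    and s: "sinh (- t - t') = - (sinh t * cosh t') - cosh t * sinh t'"
    using cosh_add[of "- t" "- t'"] sinh_add[of "- t" "- t'"] by simp_all
  have l: "(a * a') *\<^sub>R Lambda (- t - t') x
      = a' *\<^sub>R Lambda (- t') (a *\<^sub>R Lambda (- t) x)" for x
    unfolding Lambda_def c s by (simp add: prod_eq_iff algebra_simps)
  show ?thesis
    by (rule ext) (simp add: gh m l[symmetric] exp_add distrib_left mult_ac)
qed

definition duflo_moore :: "plane operator" where
  "duflo_moore \<phi> x = complex_of_real (sqrt \<bar>minkowski x x\<bar> / (2 * pi)) * \<phi> x"

definition duflo_moore_dom :: "nat \<Rightarrow> nat \<Rightarrow> (plane \<Rightarrow> complex) set" where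
  "duflo_moore_dom i j =
     {\<phi> \<in> L2 (cone_measure i j). duflo_moore \<phi> \<in> L2 (cone_measure i j)}"

text \<open>
  For $f \in L^1(P) \cap L^2(P)$, $\widehat f(\pi_i^j)$ is the Hilbert-Schmidt operator given by the
  integral formula on the (dense) domain of the unbounded operator $D_i^j$.
\<close>

definition is_fourier_L1 ::
  "nat \<Rightarrow> nat \<Rightarrow> (pgroup \<Rightarrow> complex) \<Rightarrow> plane operator \<Rightarrow> bool"
where
  "is_fourier_L1 i j f A \<longleftrightarrow>
     hilbert_schmidt (cone_measure i j) A \<and>
     (\<forall>\<phi>\<in>duflo_moore_dom i j. AE x in cone_measure i j.
        A \<phi> x = (\<integral>g. f g * rep g (duflo_moore \<phi>) x \<partial>haar))"

text \<open>Extension by continuity to $L^2(P)$, with respect to the Hilbert-Schmidt norm.\<close>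

definition is_fourier ::
  "nat \<Rightarrow> nat \<Rightarrow> (pgroup \<Rightarrow> complex) \<Rightarrow> plane operator \<Rightarrow> bool"
where
  "is_fourier i j f A \<longleftrightarrow>
     hilbert_schmidt (cone_measure i j) A \<and>
     (\<exists>F B. (\<forall>n. F n \<in> Lp 1 haar \<inter> L2 haar \<and> is_fourier_L1 i j (F n) (B n)) \<and>
        (\<lambda>n. L2_norm haar (\<lambda>g. F n g - f g)) \<longlonglongrightarrow> 0 \<and>
        (\<lambda>n. hs_norm (cone_measure i j) (\<lambda>\<phi> x. B n \<phi> x - A \<phi> x)) \<longlonglongrightarrow> 0)"

definition fourier :: "nat \<Rightarrow> nat \<Rightarrow> (pgroup \<Rightarrow> complex) \<Rightarrow> plane operator" where
  "fourier i j f = (SOME A. is_fourier i j f A)"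

section \<open>Pseudo-differential operators\<close>

text \<open>
  A symbol on $P \times \widehat P$ takes the pair $(i,j)$ in place of $\pi_i^j$. Since a symbol is a
  family of operators depending measurably on the group element, weak measurability is part of the
  definition; it is what makes the functions $T_\sigma f$ measurable.
\<close>

type_synonym symbol = "pgroup \<Rightarrow> nat \<Rightarrow> nat \<Rightarrow> plane operator"

definition operator_symbol :: "symbol \<Rightarrow> bool" where
  "operator_symbol \<sigma> \<longleftrightarrow>
     (\<forall>i\<in>{1, 2}. \<forall>j\<in>{1, 2}.
        (\<forall>g\<in>poincare. L2_op (cone_measure i j) (\<sigma> g i j)) \<and>
        (\<forall>\<phi>\<in>L2 (cone_measure i j). \<forall>\<psi>\<in>L2 (cone_measure i j).
           (\<lambda>g. L2_inner (cone_measure i j) (\<sigma> g i j \<phi>) \<psi>) \<in> borel_measurable haar))"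

text \<open>
  The composition $D_i^j\,\sigma(g,\pi_i^j)$. It maps $L^2(C_i^j)$ into itself exactly when the range of
  $\sigma(g,\pi_i^j)$ lies in the domain of $D_i^j$.
\<close>

definition duflo_symbol :: "symbol \<Rightarrow> symbol" where
  "duflo_symbol \<sigma> g i j = (\<lambda>\<phi>. duflo_moore (\<sigma> g i j \<phi>))"

definition symbol_norm :: "ennreal \<Rightarrow> symbol \<Rightarrow> nat \<Rightarrow> nat \<Rightarrow> pgroup \<Rightarrow> complex" where
  "symbol_norm q \<sigma> i j g =
     complex_of_real (modular g powr (- 1 / 2)
       * schatten_norm q (cone_measure i j) (duflo_symbol \<sigma> g i j))"

definition pseudo_diff :: "symbol \<Rightarrow> (pgroup \<Rightarrow> complex) \<Rightarrow> pgroup \<Rightarrow> complex" where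
  "pseudo_diff \<sigma> f g =
     complex_of_real (modular g powr (- 1 / 2)) *
     (\<Sum>i\<in>{1, 2}. \<Sum>j\<in>{1, 2}.
        trace_op (cone_measure i j)
          (\<lambda>\<phi>. duflo_symbol \<sigma> g i j (fourier i j f (adjoint_op (cone_measure i j) (rep g) \<phi>))))"

end

theory Submission
  imports Defs
begin

text \<open>
  Write the Haar measure as the product of Lebesgue measure in $b$ and a measure on the half-plane of
  the pairs $(a, t)$. The Duflo--Moore operator is exactly the weight for which, at each point $x$ of
  a cone, $\varphi \mapsto (D\varphi)(a \Lambda_{-t} x)$ (suitably normalised) is an isometry from
  $L^2$ of the cone into $L^2$ of the half-plane. Hence the Fourier transform of $f$ is an integral
  operator against the partial Fourier transform of $f$ in $b$, and Bessel's inequality at each $x$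
  together with the $L^2$ contraction property of the Euclidean Fourier transform bounds its
  Hilbert--Schmidt norm by $\|f\|_2$. Since $q \le 2$, the Schatten norm of order $q$ dominates the
  Hilbert--Schmidt norm, so Cauchy--Schwarz for the trace gives the pointwise estimate
  $|T_\sigma f| \le \|f\|_2 \sum_{i,j} G_i^j$, and Minkowski's inequality concludes.
\<close>

section \<open>The Hilbert space $L^2(M)$\<close>

text \<open>The basis, the adjoint and the Fourier transform are all picked by Hilbert choice, so
  each needs an existence proof and independence up to null sets. An orthonormal basis of L^2 of a
  cone is extracted from the hypothesis: \<open>q\<close> is at most 2, hence finite, and the
  singular values of a Schatten operator come with an eigenbasis. The Fourier transform is harder to
  reach: its formula is known only for integrable f and on the domain of the unbounded operator D,
  and beyond that it is a Hilbert-Schmidt limit. Both gaps are closed by comparison with one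
  explicit operator, \<open>fourier_op G\<close>, where G is the partial transform of f; the
  isometry absorbs D, so this operator is defined on all of L^2. The factor 1/(2 pi) in D gives the
  constant exactly 1: squared, it cancels the (2 pi)^2 of the Fourier transform on the plane. The
  adjoint of the representation inside the trace is absorbed by letting the Fourier transform act on
  the basis vectors moved by that adjoint; they satisfy Bessel's inequality, and Hilbert-Schmidt
  sums along such a system are no larger than along a basis.\<close>

lemma mult_le_sum_squares: "a * b \<le> a\<^sup>2 + (b :: real)\<^sup>2"
proof -
  have "2 * (a * b) \<le> a\<^sup>2 + b\<^sup>2" using sum_squares_bound[of a b] by simp
  with zero_le_power2[of a] zero_le_power2[of b] show ?thesis by linarith
qed

lemma borel_measurable_cnj [measurable (raw)]:
  "f \<in> borel_measurable M \<Longrightarrow> (\<lambda>x. cnj (f x)) \<in> borel_measurable M"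
  by (rule borel_measurable_continuous_on[of cnj]) (auto intro: continuous_intros)

lemma L2_iff: "f \<in> L2 M \<longleftrightarrow> f \<in> borel_measurable M \<and> integrable M (\<lambda>x. (cmod (f x))\<^sup>2)"
  by (simp add: Lp_def)

lemma L2_norm_eq: "L2_norm M f = sqrt (\<integral>x. (cmod (f x))\<^sup>2 \<partial>M)"
  by (simp add: Lp_norm_def powr_half_sqrt)

lemma L2_measurable [measurable_dest]: "f \<in> L2 M \<Longrightarrow> f \<in> borel_measurable M"
  by (simp add: L2_iff)

lemma L2_norm_nonneg [simp]: "0 \<le> L2_norm M f"
  by (simp add: L2_norm_eq)

lemma L2_norm_sq: "(L2_norm M f)\<^sup>2 = (\<integral>x. (cmod (f x))\<^sup>2 \<partial>M)"
  by (simp add: L2_norm_eq)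

lemma L2_nn_integral:
  "f \<in> L2 M \<Longrightarrow> (\<integral>\<^sup>+x. ennreal ((cmod (f x))\<^sup>2) \<partial>M) = ennreal ((L2_norm M f)\<^sup>2)"
  by (simp add: L2_iff L2_norm_sq nn_integral_eq_integral)

text \<open>One bound in the extended nonnegative reals yields membership and norm estimate
  together, with no integrability known beforehand; limits and integral operators enter L^2 this
  way.\<close>

lemma L2_nn_integralI:
  assumes [measurable]: "f \<in> borel_measurable M"
    and le: "(\<integral>\<^sup>+x. ennreal ((cmod (f x))\<^sup>2) \<partial>M) \<le> ennreal (c\<^sup>2)" and c: "0 \<le> c"
  shows "f \<in> L2 M" "L2_norm M f \<le> c"
proof -
  have "integrable M (\<lambda>x. (cmod (f x))\<^sup>2)"
    using le by (intro integrableI_bounded) (auto simp: less_top[symmetric] top_unique)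
  then show f: "f \<in> L2 M" by (simp add: L2_iff)
  have "(L2_norm M f)\<^sup>2 \<le> c\<^sup>2"
    using le L2_nn_integral[OF f] by simp
  then show "L2_norm M f \<le> c" using c by (rule power2_le_imp_le)
qed

lemma L2_norm_cong_AE:
  assumes "f \<in> borel_measurable M" "g \<in> borel_measurable M" "AE x in M. f x = g x"
  shows "L2_norm M f = L2_norm M g"
  unfolding L2_norm_eq using assms by (intro arg_cong[of _ _ sqrt] integral_cong_AE) auto

lemma L2_cong_AE:
  assumes f: "f \<in> L2 M" and [measurable]: "g \<in> borel_measurable M" and "AE x in M. f x = g x"
  shows "g \<in> L2 M"
proof -
  have [measurable]: "f \<in> borel_measurable M" using f by (simp add: L2_iff)
  have "integrable M (\<lambda>x. (cmod (f x))\<^sup>2) \<longleftrightarrow> integrable M (\<lambda>x. (cmod (g x))\<^sup>2)"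
    using assms by (intro integrable_cong_AE) auto
  then show ?thesis using assms by (simp add: L2_iff)
qed

lemma L2_mult_integrable:
  assumes f: "f \<in> L2 M" and g: "g \<in> L2 M"
  shows "integrable M (\<lambda>x. f x * g x)"
proof -
  have [measurable]: "f \<in> borel_measurable M" "g \<in> borel_measurable M"
    using f g by (simp_all add: L2_iff)
  have "integrable M (\<lambda>x. (cmod (f x))\<^sup>2 + (cmod (g x))\<^sup>2)"
    using f g by (simp add: L2_iff)
  then show ?thesis
  proof (rule Bochner_Integration.integrable_bound)
    show "AE x in M. norm (f x * g x) \<le> norm ((cmod (f x))\<^sup>2 + (cmod (g x))\<^sup>2)"
      by (simp add: norm_mult mult_le_sum_squares)
  qed measurable
qed

lemma L2_cnj [intro]: "f \<in> L2 M \<Longrightarrow> (\<lambda>x. cnj (f x)) \<in> L2 M"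
  by (auto simp: L2_iff)

lemma L2_inner_integrable:
  "f \<in> L2 M \<Longrightarrow> g \<in> L2 M \<Longrightarrow> integrable M (\<lambda>x. f x * cnj (g x))"
  by (rule L2_mult_integrable) auto

lemma L2_scale [intro]: "f \<in> L2 M \<Longrightarrow> (\<lambda>x. c * f x) \<in> L2 M"
  by (auto simp: L2_iff norm_mult power_mult_distrib)

lemma L2_add [intro]:
  assumes f: "f \<in> L2 M" and g: "g \<in> L2 M"
  shows "(\<lambda>x. f x + g x) \<in> L2 M"
proof -
  have [measurable]: "f \<in> borel_measurable M" "g \<in> borel_measurable M"
    using f g by (simp_all add: L2_iff)
  have "integrable M (\<lambda>x. 2 * ((cmod (f x))\<^sup>2 + (cmod (g x))\<^sup>2))"
    using f g by (simp add: L2_iff)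
  then have "integrable M (\<lambda>x. (cmod (f x + g x))\<^sup>2)"
  proof (rule Bochner_Integration.integrable_bound)
    have "(cmod (a + b))\<^sup>2 \<le> 2 * ((cmod a)\<^sup>2 + (cmod b)\<^sup>2)" for a b
    proof -
      have "(cmod (a + b))\<^sup>2 \<le> (cmod a + cmod b)\<^sup>2"
        by (intro power_mono norm_triangle_ineq) auto
      also have "\<dots> \<le> 2 * ((cmod a)\<^sup>2 + (cmod b)\<^sup>2)"
        using sum_squares_bound[of "cmod a" "cmod b"] by (simp add: power2_sum)
      finally show ?thesis .
    qed
    then show "AE x in M. norm ((cmod (f x + g x))\<^sup>2)
        \<le> norm (2 * ((cmod (f x))\<^sup>2 + (cmod (g x))\<^sup>2))"
      by simp
  qed measurable
  then show ?thesis by (simp add: L2_iff)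
qed

lemma L2_diff [intro]: "f \<in> L2 M \<Longrightarrow> g \<in> L2 M \<Longrightarrow> (\<lambda>x. f x - g x) \<in> L2 M"
  using L2_add[of f M "\<lambda>x. (-1) * g x"] L2_scale[of g M "-1"] by simp

lemma L2_zero [simp, intro]: "(\<lambda>x. 0) \<in> L2 M"
  by (simp add: L2_iff)

lemma L2_sum [intro]: "(\<And>k. k \<in> K \<Longrightarrow> f k \<in> L2 M) \<Longrightarrow> (\<lambda>x. \<Sum>k\<in>K. f k x) \<in> L2 M"
  by (induction K rule: infinite_finite_induct) auto

lemma L2_inner_commute: "L2_inner M g f = cnj (L2_inner M f g)"
proof -
  have "(\<lambda>x. g x * cnj (f x)) = (\<lambda>x. cnj (f x * cnj (g x)))"
    by (simp add: mult.commute)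
  then show ?thesis unfolding L2_inner_def
    by (simp del: complex_cnj_mult)
qed

lemma L2_inner_cong_AE:
  assumes "f \<in> borel_measurable M" "f' \<in> borel_measurable M" "AE x in M. f x = f' x"
    and "g \<in> borel_measurable M" "g' \<in> borel_measurable M" "AE x in M. g x = g' x"
  shows "L2_inner M f g = L2_inner M f' g'"
  unfolding L2_inner_def using assms by (intro integral_cong_AE) auto

lemma L2_inner_scale_left: "L2_inner M (\<lambda>x. c * f x) g = c * L2_inner M f g"
  by (simp add: L2_inner_def mult.assoc)

lemma L2_inner_scale_right: "L2_inner M f (\<lambda>x. c * g x) = cnj c * L2_inner M f g"
  by (subst (1 2) L2_inner_commute[of M f]) (simp add: L2_inner_scale_left)

context
  fixes M :: "'a measure" and f g h :: "'a \<Rightarrow> complex"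
  assumes f: "f \<in> L2 M" and g: "g \<in> L2 M" and h: "h \<in> L2 M"
begin

lemma L2_inner_add_left: "L2_inner M (\<lambda>x. f x + g x) h = L2_inner M f h + L2_inner M g h"
  using L2_inner_integrable[OF f h] L2_inner_integrable[OF g h]
  by (simp add: L2_inner_def ring_distribs)

lemma L2_inner_diff_left: "L2_inner M (\<lambda>x. f x - g x) h = L2_inner M f h - L2_inner M g h"
  using L2_inner_integrable[OF f h] L2_inner_integrable[OF g h]
  by (simp add: L2_inner_def ring_distribs)

lemma L2_inner_add_right: "L2_inner M h (\<lambda>x. f x + g x) = L2_inner M h f + L2_inner M h g"
  using L2_inner_integrable[OF h f] L2_inner_integrable[OF h g]
  by (simp add: L2_inner_def ring_distribs)

end

lemma L2_inner_zero [simp]: "L2_inner M (\<lambda>x. 0) g = 0" "L2_inner M g (\<lambda>x. 0) = 0"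
  by (simp_all add: L2_inner_def)

lemma L2_inner_sum_left:
  assumes "\<And>k. k \<in> K \<Longrightarrow> f k \<in> L2 M" "g \<in> L2 M"
  shows "L2_inner M (\<lambda>x. \<Sum>k\<in>K. f k x) g = (\<Sum>k\<in>K. L2_inner M (f k) g)"
  using assms
  by (induction K rule: infinite_finite_induct) (auto simp: L2_inner_add_left[OF _ L2_sum])

lemma L2_inner_sum_right:
  assumes "\<And>k. k \<in> K \<Longrightarrow> f k \<in> L2 M" "g \<in> L2 M"
  shows "L2_inner M g (\<lambda>x. \<Sum>k\<in>K. f k x) = (\<Sum>k\<in>K. L2_inner M g (f k))"
proof -
  have "cnj (L2_inner M (\<lambda>x. \<Sum>k\<in>K. f k x) g) = (\<Sum>k\<in>K. cnj (L2_inner M (f k) g))"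
    using L2_inner_sum_left[OF assms, of K] by simp
  then show ?thesis by (simp only: L2_inner_commute[of M g, symmetric])
qed

lemma L2_inner_self: "L2_inner M f f = complex_of_real ((L2_norm M f)\<^sup>2)"
  unfolding L2_inner_def L2_norm_sq complex_norm_square[symmetric]
  by (rule integral_complex_of_real)

lemma L2_norm_scale: "L2_norm M (\<lambda>x. c * f x) = cmod c * L2_norm M f"
  by (simp add: L2_norm_eq norm_mult power_mult_distrib real_sqrt_mult)

lemma L2_norm_minus_commute: "L2_norm M (\<lambda>x. f x - g x) = L2_norm M (\<lambda>x. g x - f x)"
  by (simp add: L2_norm_eq norm_minus_commute)

lemma L2_norm_add_sq:
  assumes "f \<in> L2 M" "g \<in> L2 M"
  shows "(L2_norm M (\<lambda>x. f x + g x))\<^sup>2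
    = (L2_norm M f)\<^sup>2 + (L2_norm M g)\<^sup>2 + 2 * Re (L2_inner M f g)"
proof -
  have "complex_of_real ((L2_norm M (\<lambda>x. f x + g x))\<^sup>2)
      = L2_inner M f f + L2_inner M g g + (L2_inner M f g + cnj (L2_inner M f g))"
    using assms unfolding L2_inner_self[symmetric]
    by (simp add: L2_inner_add_left L2_inner_add_right L2_add L2_inner_commute[of M g f])
  also have "\<dots> = complex_of_real ((L2_norm M f)\<^sup>2 + (L2_norm M g)\<^sup>2 + 2 * Re (L2_inner M f g))"
    by (simp add: L2_inner_self complex_add_cnj)
  finally show ?thesis by (simp only: of_real_eq_iff)
qed

lemma L2_norm_diff_sq:
  assumes "f \<in> L2 M" "g \<in> L2 M"
  shows "(L2_norm M (\<lambda>x. f x - g x))\<^sup>2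
    = (L2_norm M f)\<^sup>2 + (L2_norm M g)\<^sup>2 - 2 * Re (L2_inner M f g)"
  using L2_norm_add_sq[OF assms(1) L2_scale[OF assms(2), of "-1"]]
    L2_norm_scale[of M "-1" g] L2_inner_scale_right[of M f "-1" g]
  by simp

lemma L2_norm_eq_0_iff: "f \<in> L2 M \<Longrightarrow> L2_norm M f = 0 \<longleftrightarrow> (AE x in M. f x = 0)"
  by (simp add: L2_norm_eq integral_nonneg_eq_0_iff_AE L2_iff)

lemma L2_Cauchy_Schwarz:
  assumes f: "f \<in> L2 M" and g: "g \<in> L2 M"
  shows "cmod (L2_inner M f g) \<le> L2_norm M f * L2_norm M g"
proof (cases "L2_norm M g = 0")
  case True
  then have "AE x in M. g x = 0" using g by (simp add: L2_norm_eq_0_iff)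
  then have "L2_inner M f g = L2_inner M f (\<lambda>x. 0)"
    using f g by (intro L2_inner_cong_AE) (auto simp: L2_iff)
  then show ?thesis by simp
next
  case False
  define n a where "n = L2_norm M g" and "a = L2_inner M f g"
  have n: "0 < n" using False by (simp add: n_def less_le)
  have aa: "a * cnj a = complex_of_real ((cmod a)\<^sup>2)" by (simp only: complex_norm_square)
  have "0 \<le> (L2_norm M (\<lambda>x. f x - (a / n\<^sup>2) * g x))\<^sup>2" by simp
  also have "\<dots> = (L2_norm M f)\<^sup>2 + (cmod a / n\<^sup>2)\<^sup>2 * n\<^sup>2 - 2 * Re (cnj a * a / n\<^sup>2)"
    unfolding L2_norm_diff_sq[OF f L2_scale[OF g]] L2_norm_scale L2_inner_scale_right
    by (simp add: n_def[symmetric] a_def[symmetric] power_mult_distrib power_divide norm_divide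
        norm_power)
  also have "\<dots> = (L2_norm M f)\<^sup>2 - (cmod a)\<^sup>2 / n\<^sup>2"
    using n by (simp add: aa mult.commute[of "cnj a"] power_divide power2_eq_square)
  finally have "(cmod a)\<^sup>2 \<le> (L2_norm M f * n)\<^sup>2"
    using n by (simp add: field_simps power_mult_distrib)
  then show ?thesis unfolding a_def n_def
    by (rule power2_le_imp_le) simp
qed

lemma L2_norm_triangle:
  assumes "f \<in> L2 M" "g \<in> L2 M"
  shows "L2_norm M (\<lambda>x. f x + g x) \<le> L2_norm M f + L2_norm M g"
proof (rule power2_le_imp_le)
  have "Re (L2_inner M f g) \<le> L2_norm M f * L2_norm M g"
    using L2_Cauchy_Schwarz[OF assms] complex_Re_le_cmod order_trans by blast
  then show "(L2_norm M (\<lambda>x. f x + g x))\<^sup>2 \<le> (L2_norm M f + L2_norm M g)\<^sup>2"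
    by (simp add: L2_norm_add_sq[OF assms] power2_sum)
qed simp

lemma L2_norm_triangle_diff:
  assumes "f \<in> L2 M" "g \<in> L2 M"
  shows "L2_norm M (\<lambda>x. f x - g x) \<le> L2_norm M f + L2_norm M g"
  using L2_norm_triangle[OF assms(1) L2_scale[OF assms(2), of "-1"]] L2_norm_scale[of M "-1" g]
  by simp

lemma L2_dist_triangle:
  assumes "f \<in> L2 M" "g \<in> L2 M" "h \<in> L2 M"
  shows "L2_norm M (\<lambda>x. f x - h x)
    \<le> L2_norm M (\<lambda>x. f x - g x) + L2_norm M (\<lambda>x. g x - h x)"
  using L2_norm_triangle[OF L2_diff[OF assms(1,2)] L2_diff[OF assms(2,3)]] by simp

lemma L2_norm_triangle_reverse:
  assumes "f \<in> L2 M" "g \<in> L2 M"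
  shows "\<bar>L2_norm M f - L2_norm M g\<bar> \<le> L2_norm M (\<lambda>x. f x - g x)"
  using L2_norm_triangle[OF L2_diff[OF assms] assms(2)]
    L2_norm_triangle[OF L2_diff[OF assms(2,1)] assms(1)] L2_norm_minus_commute[of M f g]
  by simp

lemma L2_norm_tendsto:
  assumes "\<And>n. f n \<in> L2 M" "g \<in> L2 M" "(\<lambda>n. L2_norm M (\<lambda>x. f n x - g x)) \<longlonglongrightarrow> 0"
  shows "(\<lambda>n. L2_norm M (f n)) \<longlonglongrightarrow> L2_norm M g"
proof -
  have "(\<lambda>n. L2_norm M (f n) - L2_norm M g) \<longlonglongrightarrow> 0"
    using assms(3)
    by (rule Lim_null_comparison[rotated])
      (use L2_norm_triangle_reverse[OF assms(1,2)] in \<open>auto\<close>)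
  then show ?thesis by (simp add: LIM_zero_iff)
qed

lemma L2_inner_tendsto_left:
  assumes f: "\<And>n. f n \<in> L2 M" and g: "g \<in> L2 M" and h: "h \<in> L2 M"
    and lim: "(\<lambda>n. L2_norm M (\<lambda>x. f n x - g x)) \<longlonglongrightarrow> 0"
  shows "(\<lambda>n. L2_inner M (f n) h) \<longlonglongrightarrow> L2_inner M g h"
proof -
  have "(\<lambda>n. L2_norm M (\<lambda>x. f n x - g x) * L2_norm M h) \<longlonglongrightarrow> 0"
    using tendsto_mult_right[OF lim, of "L2_norm M h"] by simp
  then have "(\<lambda>n. L2_inner M (f n) h - L2_inner M g h) \<longlonglongrightarrow> 0"
    by (rule Lim_null_comparison[rotated])
      (use L2_Cauchy_Schwarz[OF L2_diff[OF f g] h] in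
        \<open>auto simp: L2_inner_diff_left[OF f g h]\<close>)
  then show ?thesis by (simp add: LIM_zero_iff)
qed

lemma L2_inner_tendsto_right:
  assumes "\<And>n. f n \<in> L2 M" "g \<in> L2 M" "h \<in> L2 M"
    and "(\<lambda>n. L2_norm M (\<lambda>x. f n x - g x)) \<longlonglongrightarrow> 0"
  shows "(\<lambda>n. L2_inner M h (f n)) \<longlonglongrightarrow> L2_inner M h g"
  using tendsto_cnj[OF L2_inner_tendsto_left[OF assms]] by (simp flip: L2_inner_commute)

text \<open>Assumption \<open>d\<close> says that \<open>T\<close> carries the density |c|^2 forward
  to \<open>N\<close>, so composition with \<open>T\<close> followed by multiplication with
  \<open>c\<close> preserves inner products. It is used twice: for the orbit map through a fixed
  point x, and for the representation itself.\<close>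

lemma L2_pullback:
  assumes T: "T \<in> measurable M N" and c: "c \<in> borel_measurable M"
    and d: "distr (density M (\<lambda>x. ennreal ((cmod (c x))\<^sup>2))) N T = N" and f: "f \<in> L2 N"
  shows "(\<lambda>x. c x * f (T x)) \<in> L2 M"
    and "L2_norm M (\<lambda>x. c x * f (T x)) = L2_norm N f"
    and "g \<in> L2 N \<Longrightarrow> L2_inner M (\<lambda>x. c x * f (T x)) (\<lambda>x. c x * g (T x)) = L2_inner N f g"
proof -
  have dm: "(\<lambda>x. ennreal ((cmod (c x))\<^sup>2)) \<in> borel_measurable M" using c by measurable
  have m: "(\<lambda>y. ennreal ((cmod (f y))\<^sup>2)) \<in> borel_measurable N" using L2_measurable[OF f] by measurable
  have "ennreal ((L2_norm N f)\<^sup>2)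
      = (\<integral>\<^sup>+y. ennreal ((cmod (f y))\<^sup>2) \<partial>distr (density M (\<lambda>x. ennreal ((cmod (c x))\<^sup>2))) N T)"
    unfolding d L2_nn_integral[OF f] ..
  also have "\<dots> = (\<integral>\<^sup>+x. ennreal ((cmod (c x))\<^sup>2) * ennreal ((cmod (f (T x)))\<^sup>2) \<partial>M)"
    by (subst nn_integral_distr)
      (use T m in simp_all, rule nn_integral_density[OF dm measurable_compose[OF T m]])
  finally have eq: "(\<integral>\<^sup>+x. ennreal ((cmod (c x * f (T x)))\<^sup>2) \<partial>M) = ennreal ((L2_norm N f)\<^sup>2)"
    by (simp add: norm_mult power_mult_distrib ennreal_mult)
  have [measurable]: "(\<lambda>x. f (T x)) \<in> borel_measurable M"
    by (rule measurable_compose[OF T L2_measurable[OF f]])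
  show L: "(\<lambda>x. c x * f (T x)) \<in> L2 M"
    using c eq by (intro L2_nn_integralI(1)[of _ _ "L2_norm N f"]) auto
  have "(L2_norm M (\<lambda>x. c x * f (T x)))\<^sup>2 = (L2_norm N f)\<^sup>2"
    using eq unfolding L2_nn_integral[OF L] by simp
  then show "L2_norm M (\<lambda>x. c x * f (T x)) = L2_norm N f"
    by (rule power2_eq_imp_eq) simp_all
  assume g: "g \<in> L2 N"
  have fg: "(\<lambda>y. f y * cnj (g y)) \<in> borel_measurable N"
    using L2_measurable[OF f] L2_measurable[OF g] by measurable
  have "L2_inner N f g = (\<integral>y. f y * cnj (g y) \<partial>distr (density M (\<lambda>x. ennreal ((cmod (c x))\<^sup>2))) N T)"
    unfolding d L2_inner_def ..
  also have "\<dots> = (\<integral>x. f (T x) * cnj (g (T x)) \<partial>density M (\<lambda>x. ennreal ((cmod (c x))\<^sup>2)))"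
    by (rule integral_distr) (use T fg in simp_all)
  also have "\<dots> = (\<integral>x. (cmod (c x))\<^sup>2 *\<^sub>R (f (T x) * cnj (g (T x))) \<partial>M)"
    using c by (intro integral_density[OF measurable_compose[OF T fg]]) auto
  also have "\<dots> = L2_inner M (\<lambda>x. c x * f (T x)) (\<lambda>x. c x * g (T x))"
    by (simp add: L2_inner_def scaleR_conv_of_real complex_norm_square mult_ac del: of_real_power)
  finally show "L2_inner M (\<lambda>x. c x * f (T x)) (\<lambda>x. c x * g (T x)) = L2_inner N f g" ..
qed

subsection \<open>Orthonormal systems\<close>

text \<open>With s the projection of f, <f, s> and <s, s> both equal the sum of |c_k|^2, so one copy
  survives with a minus sign when the square is expanded. Orthonormality is asked only on the finite
  set \<open>K\<close>, so that any orthonormal system, complete or not, is covered.\<close>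

lemma Bessel_residual:
  assumes fin: "finite K" and e: "\<And>k. k \<in> K \<Longrightarrow> e k \<in> L2 M"
    and on: "\<And>k l. k \<in> K \<Longrightarrow> l \<in> K \<Longrightarrow> L2_inner M (e k) (e l) = (if k = l then 1 else 0)"
    and f: "f \<in> L2 M"
  shows "(L2_norm M (\<lambda>x. f x - (\<Sum>k\<in>K. L2_inner M f (e k) * e k x)))\<^sup>2
    = (L2_norm M f)\<^sup>2 - (\<Sum>k\<in>K. (cmod (L2_inner M f (e k)))\<^sup>2)"
proof -
  let ?c = "\<lambda>k. L2_inner M f (e k)"
  let ?s = "\<lambda>x. \<Sum>k\<in>K. ?c k * e k x"
  have s: "?s \<in> L2 M" by (intro L2_sum L2_scale e)
  have fs: "L2_inner M f ?s = complex_of_real (\<Sum>k\<in>K. (cmod (?c k))\<^sup>2)"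
    using L2_inner_sum_right[of K "\<lambda>k x. ?c k * e k x" M f] e f
    by (simp add: L2_scale L2_inner_scale_right complex_norm_square mult.commute[of "cnj _"]
             del: of_real_power)
  have es: "L2_inner M (e k) ?s = cnj (?c k)" if "k \<in> K" for k
  proof -
    have "L2_inner M (e k) ?s = (\<Sum>l\<in>K. L2_inner M (e k) (\<lambda>x. ?c l * e l x))"
      using that e by (intro L2_inner_sum_right L2_scale) auto
    also have "\<dots> = (\<Sum>l\<in>K. if k = l then cnj (?c l) else 0)"
      using that by (intro sum.cong refl) (simp add: L2_inner_scale_right on)
    finally show ?thesis using fin that by simp
  qed
  have "L2_inner M ?s ?s = (\<Sum>k\<in>K. L2_inner M (\<lambda>x. ?c k * e k x) ?s)"
    using s e by (intro L2_inner_sum_left L2_scale) auto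
  also have "\<dots> = (\<Sum>k\<in>K. cnj (?c k) * ?c k)"
    by (intro sum.cong refl) (simp add: L2_inner_scale_left es)
  also have "\<dots> = complex_of_real (\<Sum>k\<in>K. (cmod (?c k))\<^sup>2)"
    by (simp add: complex_norm_square mult.commute del: of_real_power)
  finally have "(L2_norm M ?s)\<^sup>2 = (\<Sum>k\<in>K. (cmod (?c k))\<^sup>2)"
    unfolding L2_inner_self of_real_eq_iff .
  then show ?thesis unfolding L2_norm_diff_sq[OF f s] fs by simp
qed

lemma Bessel_ineq:
  assumes "finite K" "\<And>k. k \<in> K \<Longrightarrow> e k \<in> L2 M"
    and "\<And>k l. k \<in> K \<Longrightarrow> l \<in> K \<Longrightarrow> L2_inner M (e k) (e l) = (if k = l then 1 else 0)"
    and "f \<in> L2 M"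
  shows "(\<Sum>k\<in>K. (cmod (L2_inner M f (e k)))\<^sup>2) \<le> (L2_norm M f)\<^sup>2"
  using Bessel_residual[OF assms]
    zero_le_power2[of "L2_norm M (\<lambda>x. f x - (\<Sum>k\<in>K. L2_inner M f (e k) * e k x))"]
  by linarith

context
  fixes M :: "'a measure" and e
  assumes onb: "orthonormal_basis M e"
begin

lemma onb_L2: "e k \<in> L2 M"
  and onb_inner: "L2_inner M (e k) (e l) = (if k = l then 1 else 0)"
  using onb by (simp_all add: orthonormal_basis_def)

lemma onb_norm: "L2_norm M (e k) = 1"
proof -
  have "complex_of_real ((L2_norm M (e k))\<^sup>2) = of_real 1"
    using onb_inner[of k k] unfolding L2_inner_self by simp
  then have "(L2_norm M (e k))\<^sup>2 = 1\<^sup>2" unfolding of_real_eq_iff by simp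
  then show ?thesis by (rule power2_eq_imp_eq) simp_all
qed

lemma onb_expand:
  "f \<in> L2 M \<Longrightarrow> (\<lambda>n. L2_norm M (\<lambda>x. (\<Sum>k<n. L2_inner M f (e k) * e k x) - f x)) \<longlonglongrightarrow> 0"
  using onb by (subst L2_norm_minus_commute) (simp add: orthonormal_basis_def)

lemma onb_partial_L2: "(\<lambda>x. \<Sum>k<n. c k * e k x) \<in> L2 M"
  by (intro L2_sum L2_scale onb_L2)

lemma onb_inner_sums:
  assumes f: "f \<in> L2 M" and g: "g \<in> L2 M"
  shows "(\<lambda>k. L2_inner M f (e k) * L2_inner M (e k) g) sums L2_inner M f g"
proof -
  have "L2_inner M (\<lambda>x. \<Sum>k<n. L2_inner M f (e k) * e k x) g
      = (\<Sum>k<n. L2_inner M f (e k) * L2_inner M (e k) g)" for n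
    using L2_inner_sum_left[of "{..<n}" "\<lambda>k x. L2_inner M f (e k) * e k x" M g] g
    by (simp add: onb_L2 L2_scale L2_inner_scale_left)
  then show ?thesis
    using L2_inner_tendsto_left[OF onb_partial_L2 f g onb_expand[OF f]] by (simp add: sums_def)
qed

lemma onb_Parseval:
  assumes f: "f \<in> L2 M"
  shows "(\<lambda>k. (cmod (L2_inner M f (e k)))\<^sup>2) sums (L2_norm M f)\<^sup>2"
proof -
  have "(\<lambda>k. L2_inner M f (e k) * cnj (L2_inner M f (e k))) sums L2_inner M f f"
    using onb_inner_sums[OF f f] unfolding L2_inner_commute[of M "e _" f] .
  then have "(\<lambda>k. complex_of_real ((cmod (L2_inner M f (e k)))\<^sup>2))
      sums complex_of_real ((L2_norm M f)\<^sup>2)"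
    unfolding L2_inner_self complex_norm_square[symmetric] .
  then show ?thesis by (simp only: sums_of_real_iff)
qed

lemma onb_Bessel:
  assumes "f \<in> L2 M" "finite K"
  shows "(\<Sum>k\<in>K. (cmod (L2_inner M f (e k)))\<^sup>2) \<le> (L2_norm M f)\<^sup>2"
  by (intro Bessel_ineq assms onb_L2 onb_inner)

end

text \<open>A single basis, whatever its origin, legitimises the choice behind
  \<open>some_basis\<close>.\<close>

lemma some_basis_onb: "orthonormal_basis M e \<Longrightarrow> orthonormal_basis M (some_basis M)"
  unfolding some_basis_def by (rule someI[of "orthonormal_basis M"])

subsection \<open>Completeness\<close>

text \<open>The measure may be infinite, so the increments themselves need not be integrable. Their
  squares weighted by 2^n are: the integrals are at most 2^n 4^(-n), which is summable, and a finite
  integral forces convergence at almost every point.\<close>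

lemma L2_summable_telescope:
  assumes f: "\<And>n. f n \<in> L2 M"
    and small: "\<And>n. L2_norm M (\<lambda>x. f (Suc n) x - f n x) \<le> (1 / 2) ^ n"
  shows "AE x in M. convergent (\<lambda>n. f n x)"
proof -
  have [measurable]: "\<And>n. f n \<in> borel_measurable M" using f by (simp add: L2_iff)
  let ?d = "\<lambda>n x. (2::real) ^ n * (cmod (f (Suc n) x - f n x))\<^sup>2"
  have "(\<integral>\<^sup>+x. (\<Sum>n. ennreal (?d n x)) \<partial>M) = (\<Sum>n. \<integral>\<^sup>+x. ennreal (?d n x) \<partial>M)"
    by (rule nn_integral_suminf) measurable
  also have "\<dots> = (\<Sum>n. ennreal (2 ^ n * (L2_norm M (\<lambda>x. f (Suc n) x - f n x))\<^sup>2))"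
    by (simp add: ennreal_mult nn_integral_cmult L2_nn_integral[OF L2_diff[OF f f]])
  also have "\<dots> \<le> (\<Sum>n. ennreal ((1 / 2) ^ n))"
  proof (intro suminf_le ennreal_leI)
    fix n
    have "(L2_norm M (\<lambda>x. f (Suc n) x - f n x))\<^sup>2 \<le> ((1 / 2) ^ n)\<^sup>2"
      by (intro power_mono small) simp
    then have "2 ^ n * (L2_norm M (\<lambda>x. f (Suc n) x - f n x))\<^sup>2 \<le> 2 ^ n * ((1 / 2) ^ n)\<^sup>2"
      by simp
    also have "\<dots> = (1 / 2 :: real) ^ n"
      by (simp add: power2_eq_square power_divide)
    finally show "2 ^ n * (L2_norm M (\<lambda>x. f (Suc n) x - f n x))\<^sup>2 \<le> (1 / 2) ^ n" .
  qed auto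
  also have "\<dots> = ennreal (\<Sum>n. (1 / 2) ^ n)"
    by (rule suminf_ennreal2) (auto intro: summable_geometric)
  finally have "(\<integral>\<^sup>+x. (\<Sum>n. ennreal (?d n x)) \<partial>M) \<noteq> \<infinity>"
    by (auto simp: top_unique)
  then have "AE x in M. (\<Sum>n. ennreal (?d n x)) \<noteq> \<infinity>"
    by (intro nn_integral_noteq_infinite) measurable
  then show ?thesis
  proof eventually_elim
    fix x assume "(\<Sum>n. ennreal (?d n x)) \<noteq> \<infinity>"
    then have d: "summable (\<lambda>n. ?d n x)"
      by (intro summable_suminf_not_top) auto
    have "summable (\<lambda>n. (1 / 2 :: real) ^ n + ?d n x)"
      by (intro summable_add d summable_geometric) simp
    moreover have "norm (f (Suc n) x - f n x) \<le> (1 / 2) ^ n + ?d n x" for n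
    proof -
      \<comment> \<open>At c = (1/2)^n this trades the weighted square 2^n t^2 back for the
        increment t, at the cost of a summable geometric term.\<close>
      have "t \<le> c + t\<^sup>2 / c" if "0 < c" for c t :: real
      proof -
        show ?thesis using mult_le_sum_squares[of c t] that
          by (simp add: field_simps power2_eq_square)
      qed
      from this[of "(1 / 2) ^ n" "cmod (f (Suc n) x - f n x)"] show ?thesis
        by (simp add: power_divide mult.commute)
    qed
    ultimately have "summable (\<lambda>n. f (Suc n) x - f n x)"
      by (rule summable_comparison_test'[where N = 0])
    then have "convergent (\<lambda>n. \<Sum>i<n. f (Suc i) x - f i x)"
      by (simp add: summable_iff_convergent)
    then have "convergent (\<lambda>n. (f n x - f 0 x) + f 0 x)"
      using sum_lessThan_telescope[of "\<lambda>n. f n x"] by (intro convergent_add convergent_const) simp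
    then show "convergent (\<lambda>n. f n x)" by simp
  qed
qed

text \<open>Riesz-Fischer: a rapidly Cauchy subsequence converges almost everywhere, and Fatou's
  lemma along it turns the Cauchy estimate into convergence in norm of the whole sequence.\<close>

lemma L2_complete:
  assumes f: "\<And>n. f n \<in> L2 M"
    and cauchy: "\<And>\<epsilon>. 0 < \<epsilon> \<Longrightarrow> \<exists>N. \<forall>m\<ge>N. \<forall>n\<ge>N. L2_norm M (\<lambda>x. f m x - f n x) < \<epsilon>"
  shows "\<exists>g\<in>L2 M. (\<lambda>n. L2_norm M (\<lambda>x. f n x - g x)) \<longlonglongrightarrow> 0"
proof -
  have meas [measurable]: "\<And>n. f n \<in> borel_measurable M" using f by (simp add: L2_iff)
  have "\<exists>N. \<forall>k. \<forall>m\<ge>N k. \<forall>n\<ge>N k. L2_norm M (\<lambda>x. f m x - f n x) < (1 / 2) ^ k"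
    using cauchy[of "(1 / 2) ^ k" for k] by (intro choice) auto
  then obtain N where N: "\<And>k m n. N k \<le> m \<Longrightarrow> N k \<le> n \<Longrightarrow>
      L2_norm M (\<lambda>x. f m x - f n x) < (1 / 2) ^ k" by blast
  \<comment> \<open>The accumulated sum keeps \<open>r\<close> monotone while \<open>r k\<close>
    stays above \<open>N k\<close>.\<close>
  define r where "r k = (\<Sum>i\<le>k. N i) + k" for k
  have rN: "N k \<le> r k" for k unfolding r_def by (simp add: trans_le_add1 member_le_sum)
  have mono: "r k \<le> r (Suc k)" for k by (simp add: r_def)
  have "L2_norm M (\<lambda>x. f (r (Suc k)) x - f (r k) x) \<le> (1 / 2) ^ k" for k
    using N[of k "r (Suc k)" "r k"] rN[of k] mono[of k] by simp
  then have conv: "AE x in M. convergent (\<lambda>k. f (r k) x)"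
    by (intro L2_summable_telescope f)
  \<comment> \<open>Outside a null set the guard holds; elsewhere \<open>g\<close> takes the default
    0.\<close>
  define g where "g x = (if Cauchy (\<lambda>k. f (r k) x) then lim (\<lambda>k. f (r k) x) else 0)" for x
  have [measurable]: "g \<in> borel_measurable M" unfolding g_def by measurable
  have lim: "AE x in M. (\<lambda>k. f (r k) x) \<longlonglongrightarrow> g x"
    using conv by eventually_elim (simp add: g_def convergent_LIMSEQ_iff Cauchy_convergent_iff)
  have bound: "(\<lambda>x. f n x - g x) \<in> L2 M \<and> L2_norm M (\<lambda>x. f n x - g x) \<le> (1 / 2) ^ k"
    if n: "N k \<le> n" for n k
  proof -
    have "(\<integral>\<^sup>+x. ennreal ((cmod (f n x - g x))\<^sup>2) \<partial>M)
        = (\<integral>\<^sup>+x. liminf (\<lambda>m. ennreal ((cmod (f n x - f (r m) x))\<^sup>2)) \<partial>M)"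
    proof (rule nn_integral_cong_AE)
      show "AE x in M. ennreal ((cmod (f n x - g x))\<^sup>2)
          = liminf (\<lambda>m. ennreal ((cmod (f n x - f (r m) x))\<^sup>2))"
        using lim
      proof eventually_elim
        fix x assume "(\<lambda>k. f (r k) x) \<longlonglongrightarrow> g x"
        then have "(\<lambda>m. ennreal ((cmod (f n x - f (r m) x))\<^sup>2))
            \<longlonglongrightarrow> ennreal ((cmod (f n x - g x))\<^sup>2)"
          by (intro tendsto_intros)
        then show "ennreal ((cmod (f n x - g x))\<^sup>2)
            = liminf (\<lambda>m. ennreal ((cmod (f n x - f (r m) x))\<^sup>2))"
          by (intro lim_imp_Liminf[symmetric]) simp_all
      qed
    qed
    also have "\<dots> \<le> liminf (\<lambda>m. \<integral>\<^sup>+x. ennreal ((cmod (f n x - f (r m) x))\<^sup>2) \<partial>M)"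
      by (rule nn_integral_liminf) measurable
    also have "\<dots> = liminf (\<lambda>m. ennreal ((L2_norm M (\<lambda>x. f n x - f (r m) x))\<^sup>2))"
      by (simp add: L2_nn_integral[OF L2_diff[OF f f]])
    also have "\<dots> \<le> liminf (\<lambda>m. ennreal (((1 / 2) ^ k)\<^sup>2))"
    proof (intro Liminf_mono eventually_sequentiallyI[of k] ennreal_leI power_mono)
      fix m assume "k \<le> m"
      then have "r k \<le> r m" using lift_Suc_mono_le[of r, OF mono] by simp
      then show "L2_norm M (\<lambda>x. f n x - f (r m) x) \<le> (1 / 2) ^ k"
        using N[OF n, of "r m"] rN[of k] by simp
    qed simp
    also have "\<dots> = ennreal (((1 / 2) ^ k)\<^sup>2)" by (simp add: Liminf_const)
    finally show ?thesis by (intro conjI L2_nn_integralI) auto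
  qed
  \<comment> \<open>Membership of the limit comes from \<open>f (N 0)\<close> and its difference to
    the limit, both already in L^2.\<close>
  have "(\<lambda>x. f (N 0) x - (f (N 0) x - g x)) \<in> L2 M"
    by (rule L2_diff[OF f]) (use bound[of 0 "N 0"] in simp)
  then have "g \<in> L2 M" by simp
  moreover have "(\<lambda>n. L2_norm M (\<lambda>x. f n x - g x)) \<longlonglongrightarrow> 0"
  proof (rule LIMSEQ_I)
    fix \<epsilon> :: real assume "0 < \<epsilon>"
    then obtain k where "(1 / 2 :: real) ^ k < \<epsilon>"
      using real_arch_pow_inv[of \<epsilon> "1 / 2"] by auto
    then show "\<exists>no. \<forall>n\<ge>no. norm (L2_norm M (\<lambda>x. f n x - g x) - 0) < \<epsilon>"
      using bound[of k] by (intro exI[of _ "N k"]) (auto intro: order.strict_trans1)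
  qed
  ultimately show ?thesis by blast
qed

section \<open>Operators on $L^2(M)$\<close>

lemma L2_opI:
  assumes "\<And>f. f \<in> L2 M \<Longrightarrow> A f \<in> L2 M"
    and "\<And>f g. f \<in> L2 M \<Longrightarrow> g \<in> L2 M \<Longrightarrow> AE x in M. A (\<lambda>y. f y + g y) x = A f x + A g x"
    and "\<And>c f. f \<in> L2 M \<Longrightarrow> AE x in M. A (\<lambda>y. c * f y) x = c * A f x"
    and "\<And>f. f \<in> L2 M \<Longrightarrow> L2_norm M (A f) \<le> C * L2_norm M f"
  shows "L2_op M A"
  unfolding bounded_op_def using assms by blast

context
  fixes M :: "'a measure" and A
  assumes A: "L2_op M A"
begin

lemma L2_op_L2: "f \<in> L2 M \<Longrightarrow> A f \<in> L2 M"
  and L2_op_add: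
    "f \<in> L2 M \<Longrightarrow> g \<in> L2 M \<Longrightarrow> AE x in M. A (\<lambda>y. f y + g y) x = A f x + A g x"
  and L2_op_scale: "f \<in> L2 M \<Longrightarrow> AE x in M. A (\<lambda>y. c * f y) x = c * A f x"
  using A by (simp_all add: bounded_op_def)

lemma L2_op_bound: "\<exists>C\<ge>0. \<forall>f\<in>L2 M. L2_norm M (A f) \<le> C * L2_norm M f"
proof -
  obtain C where C: "\<forall>f\<in>L2 M. L2_norm M (A f) \<le> C * L2_norm M f"
    using A unfolding bounded_op_def by blast
  have "L2_norm M (A f) \<le> \<bar>C\<bar> * L2_norm M f" if "f \<in> L2 M" for f
    using C[rule_format, OF that] by (rule order_trans) (intro mult_right_mono, auto)
  then show ?thesis by (intro exI[of _ "\<bar>C\<bar>"]) simp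
qed

lemma L2_op_diff:
  assumes f: "f \<in> L2 M" and g: "g \<in> L2 M"
  shows "AE x in M. A (\<lambda>y. f y - g y) x = A f x - A g x"
  using L2_op_add[OF f L2_scale[OF g, of "-1"]] L2_op_scale[OF g, of "-1"]
  by eventually_elim simp

lemma L2_op_norm_diff:
  assumes f: "f \<in> L2 M" and g: "g \<in> L2 M"
  shows "L2_norm M (\<lambda>x. A f x - A g x) = L2_norm M (A (\<lambda>x. f x - g x))"
proof (rule L2_norm_cong_AE)
  show "AE x in M. A f x - A g x = A (\<lambda>x. f x - g x) x"
    using L2_op_diff[OF f g] by eventually_elim simp
qed (intro L2_measurable L2_diff L2_op_L2 f g)+

text \<open>Operators act on functions rather than classes. Null sets are respected because, by
  linearity and the norm bound, a difference of norm 0 is sent to a difference of norm 0.\<close>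

lemma L2_op_cong_AE:
  assumes f: "f \<in> L2 M" and g: "g \<in> L2 M" and eq: "AE x in M. f x = g x"
  shows "AE x in M. A f x = A g x"
proof -
  obtain C where C: "0 \<le> C" "\<And>f. f \<in> L2 M \<Longrightarrow> L2_norm M (A f) \<le> C * L2_norm M f"
    using L2_op_bound by blast
  have "L2_norm M (\<lambda>x. f x - g x) = 0"
    using eq by (subst L2_norm_eq_0_iff[OF L2_diff[OF f g]]) simp
  then have "L2_norm M (\<lambda>x. A f x - A g x) = 0"
    using C(2)[OF L2_diff[OF f g]] L2_norm_nonneg[of M "A (\<lambda>x. f x - g x)"]
    unfolding L2_op_norm_diff[OF f g] by simp
  then show ?thesis
    unfolding L2_norm_eq_0_iff[OF L2_diff[OF L2_op_L2[OF f] L2_op_L2[OF g]]] by simp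
qed

lemma L2_op_sum:
  assumes "finite K" "\<And>k. k \<in> K \<Longrightarrow> f k \<in> L2 M"
  shows "AE x in M. A (\<lambda>y. \<Sum>k\<in>K. c k * f k y) x = (\<Sum>k\<in>K. c k * A (f k) x)"
  using assms
proof (induction K)
  case empty
  show ?case using L2_op_scale[OF L2_zero, of 0] by simp
next
  case (insert k K)
  have "AE x in M. A (\<lambda>y. c k * f k y + (\<Sum>k\<in>K. c k * f k y)) x
      = A (\<lambda>y. c k * f k y) x + A (\<lambda>y. \<Sum>k\<in>K. c k * f k y) x"
    using insert.prems by (intro L2_op_add L2_scale L2_sum) auto
  moreover have "AE x in M. A (\<lambda>y. c k * f k y) x = c k * A (f k) x"
    using insert.prems by (intro L2_op_scale) auto
  moreover have "AE x in M. A (\<lambda>y. \<Sum>k\<in>K. c k * f k y) x = (\<Sum>k\<in>K. c k * A (f k) x)"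
    using insert by (intro insert.IH) auto
  ultimately show ?case
    unfolding sum.insert[OF insert.hyps] by eventually_elim simp
qed

lemma L2_op_tendsto:
  assumes f: "\<And>n. f n \<in> L2 M" and g: "g \<in> L2 M"
    and lim: "(\<lambda>n. L2_norm M (\<lambda>x. f n x - g x)) \<longlonglongrightarrow> 0"
  shows "(\<lambda>n. L2_norm M (\<lambda>x. A (f n) x - A g x)) \<longlonglongrightarrow> 0"
proof -
  obtain C where C: "0 \<le> C" "\<And>f. f \<in> L2 M \<Longrightarrow> L2_norm M (A f) \<le> C * L2_norm M f"
    using L2_op_bound by blast
  have "(\<lambda>n. C * L2_norm M (\<lambda>x. f n x - g x)) \<longlonglongrightarrow> 0"
    using tendsto_mult_left[OF lim, of C] by simp
  then show ?thesis
    by (rule Lim_null_comparison[rotated])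
      (use C(2)[OF L2_diff[OF f g]] in \<open>auto simp: L2_op_norm_diff[OF f g]\<close>)
qed

text \<open>Continuity allows \<open>A\<close> to be applied to the expansion of \<open>f\<close>
  term by term. This scalar series replaces matrix multiplication below: it inserts a basis between
  two operators, both for trace estimates and for measurability in the group element.\<close>

lemma L2_op_onb_sums:
  assumes e: "orthonormal_basis M e" and f: "f \<in> L2 M" and g: "g \<in> L2 M"
  shows "(\<lambda>k. L2_inner M f (e k) * L2_inner M (A (e k)) g) sums L2_inner M (A f) g"
proof -
  let ?S = "\<lambda>n x. \<Sum>k<n. L2_inner M f (e k) * e k x"
  have Ae: "A (e k) \<in> L2 M" for k by (intro L2_op_L2 onb_L2[OF e])
  have "L2_inner M (A (?S n)) g = (\<Sum>k<n. L2_inner M f (e k) * L2_inner M (A (e k)) g)" for n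
  proof -
    have "L2_inner M (A (?S n)) g
        = L2_inner M (\<lambda>x. \<Sum>k<n. L2_inner M f (e k) * A (e k) x) g"
    proof (rule L2_inner_cong_AE)
      show "AE x in M. A (?S n) x = (\<Sum>k<n. L2_inner M f (e k) * A (e k) x)"
        by (intro L2_op_sum onb_L2[OF e]) auto
      show "(\<lambda>x. \<Sum>k<n. L2_inner M f (e k) * A (e k) x) \<in> borel_measurable M"
        by (intro L2_measurable L2_sum L2_scale Ae)
      show "A (?S n) \<in> borel_measurable M"
        by (intro L2_measurable L2_op_L2 onb_partial_L2[OF e])
    qed (simp_all add: L2_measurable[OF g])
    also have "\<dots> = (\<Sum>k<n. L2_inner M (\<lambda>x. L2_inner M f (e k) * A (e k) x) g)"
      by (intro L2_inner_sum_left L2_scale Ae g)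
    finally show ?thesis by (simp add: L2_inner_scale_left)
  qed
  moreover have "(\<lambda>n. L2_inner M (A (?S n)) g) \<longlonglongrightarrow> L2_inner M (A f) g"
    by (intro L2_inner_tendsto_left L2_op_L2 L2_op_tendsto onb_expand[OF e]
        onb_partial_L2[OF e] f g)
  ultimately show ?thesis by (simp add: sums_def)
qed

end

lemma L2_op_lincomb:
  assumes A: "L2_op M A" and B: "L2_op M B"
  shows "L2_op M (\<lambda>\<phi> x. A \<phi> x + c * B \<phi> x)"
proof -
  obtain C D where C: "0 \<le> C" "\<And>f. f \<in> L2 M \<Longrightarrow> L2_norm M (A f) \<le> C * L2_norm M f"
    and D: "0 \<le> D" "\<And>f. f \<in> L2 M \<Longrightarrow> L2_norm M (B f) \<le> D * L2_norm M f"
    using L2_op_bound[OF A] L2_op_bound[OF B] by blast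
  show ?thesis
  proof (rule L2_opI)
    fix f assume f: "f \<in> L2 M"
    show "(\<lambda>x. A f x + c * B f x) \<in> L2 M"
      by (intro L2_add L2_scale L2_op_L2[OF A] L2_op_L2[OF B] f)
    have "L2_norm M (\<lambda>x. A f x + c * B f x) \<le> L2_norm M (A f) + L2_norm M (\<lambda>x. c * B f x)"
      by (intro L2_norm_triangle L2_scale L2_op_L2[OF A] L2_op_L2[OF B] f)
    also have "\<dots> \<le> C * L2_norm M f + cmod c * (D * L2_norm M f)"
      unfolding L2_norm_scale using C(2)[OF f] D(2)[OF f] by (intro add_mono mult_left_mono) auto
    finally show "L2_norm M (\<lambda>x. A f x + c * B f x) \<le> (C + cmod c * D) * L2_norm M f"
      by (simp add: algebra_simps)
    show "AE x in M. A (\<lambda>y. d * f y) x + c * B (\<lambda>y. d * f y) x = d * (A f x + c * B f x)" for d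
      using L2_op_scale[OF A f, of d] L2_op_scale[OF B f, of d]
      by eventually_elim (simp add: algebra_simps)
  next
    fix f g assume fg: "f \<in> L2 M" "g \<in> L2 M"
    show "AE x in M. A (\<lambda>y. f y + g y) x + c * B (\<lambda>y. f y + g y) x
        = (A f x + c * B f x) + (A g x + c * B g x)"
      using L2_op_add[OF A fg] L2_op_add[OF B fg]
      by eventually_elim (simp add: algebra_simps)
  qed
qed

lemma L2_eqI:
  assumes f: "f \<in> L2 M" and g: "g \<in> L2 M"
    and eq: "\<And>h. h \<in> L2 M \<Longrightarrow> L2_inner M f h = L2_inner M g h"
  shows "AE x in M. f x = g x"
proof -
  have d: "(\<lambda>x. f x - g x) \<in> L2 M" using f g by auto
  have "L2_inner M (\<lambda>x. f x - g x) (\<lambda>x. f x - g x) = 0"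
    using eq[OF d] by (simp add: L2_inner_diff_left[OF f g d])
  then have "L2_norm M (\<lambda>x. f x - g x) = 0" by (simp add: L2_inner_self)
  then show ?thesis by (simp add: L2_norm_eq_0_iff[OF d])
qed

lemma L2_op_eq_on_basis:
  assumes A: "L2_op M A" and B: "L2_op M B" and e: "orthonormal_basis M e"
    and eq: "\<And>k. AE x in M. A (e k) x = B (e k) x" and f: "f \<in> L2 M"
  shows "AE x in M. A f x = B f x"
proof (rule L2_eqI)
  fix h assume h: "h \<in> L2 M"
  have "L2_inner M (A (e k)) h = L2_inner M (B (e k)) h" for k
    by (intro L2_inner_cong_AE eq L2_measurable L2_op_L2[OF A] L2_op_L2[OF B] onb_L2[OF e] h) simp
  then show "L2_inner M (A f) h = L2_inner M (B f) h"
    using L2_op_onb_sums[OF A e f h] L2_op_onb_sums[OF B e f h] by (simp add: sums_unique2)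
qed (intro L2_op_L2[OF A] L2_op_L2[OF B] f)+

lemma is_adjointD:
  assumes "is_adjoint M A B"
  shows "L2_op M B" "f \<in> L2 M \<Longrightarrow> g \<in> L2 M \<Longrightarrow> L2_inner M (A f) g = L2_inner M f (B g)"
    "f \<in> L2 M \<Longrightarrow> g \<in> L2 M \<Longrightarrow> L2_inner M (B f) g = L2_inner M f (A g)"
proof -
  show "L2_op M B" using assms by (simp add: is_adjoint_def)
  have *: "L2_inner M (A f) g = L2_inner M f (B g)" if "f \<in> L2 M" "g \<in> L2 M" for f g
    using assms that by (simp add: is_adjoint_def)
  show "f \<in> L2 M \<Longrightarrow> g \<in> L2 M \<Longrightarrow> L2_inner M (A f) g = L2_inner M f (B g)" by (rule *)
  assume "f \<in> L2 M" "g \<in> L2 M"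
  then have "cnj (L2_inner M (A g) f) = cnj (L2_inner M g (B f))" by (simp add: *)
  then show "L2_inner M (B f) g = L2_inner M f (A g)"
    by (simp only: L2_inner_commute[of M _ g, symmetric] L2_inner_commute[of M f "A g"])
qed

subsection \<open>Hilbert--Schmidt sums\<close>

text \<open>Tonelli's theorem, with one of the sums read as an integral over counting measure on the
  naturals.\<close>

lemma suminf_swap_ennreal: "(\<Sum>k. \<Sum>l. f k l) = (\<Sum>l. \<Sum>k. f k l :: ennreal)"
  using nn_integral_suminf[of "\<lambda>l k. f k l" "count_space UNIV"]
  by (simp add: nn_integral_count_space_nat)

lemma onb_Parseval_ennreal:
  assumes "orthonormal_basis M e" "f \<in> L2 M"
  shows "(\<Sum>k. ennreal ((cmod (L2_inner M f (e k)))\<^sup>2)) = ennreal ((L2_norm M f)\<^sup>2)"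
  using onb_Parseval[OF assms] by (intro suminf_ennreal_eq) auto

lemma onb_norm_partial_sum:
  assumes e: "orthonormal_basis M e"
  shows "(L2_norm M (\<lambda>x. \<Sum>k<n. c k * e k x))\<^sup>2 = (\<Sum>k<n. (cmod (c k))\<^sup>2)"
proof -
  let ?s = "\<lambda>x. \<Sum>k<n. c k * e k x"
  have es: "L2_inner M (e k) ?s = cnj (c k)" if "k < n" for k
  proof -
    have "L2_inner M (e k) ?s = (\<Sum>l<n. L2_inner M (e k) (\<lambda>x. c l * e l x))"
      by (intro L2_inner_sum_right L2_scale onb_L2[OF e])
    also have "\<dots> = (\<Sum>l<n. if k = l then cnj (c l) else 0)"
      by (intro sum.cong refl) (simp add: L2_inner_scale_right onb_inner[OF e])
    finally show ?thesis using that by simp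
  qed
  have "L2_inner M ?s ?s = (\<Sum>k<n. L2_inner M (\<lambda>x. c k * e k x) ?s)"
    by (intro L2_inner_sum_left L2_scale onb_L2[OF e] onb_partial_L2[OF e])
  also have "\<dots> = (\<Sum>k<n. c k * cnj (c k))"
    by (intro sum.cong refl) (simp add: L2_inner_scale_left es)
  also have "\<dots> = complex_of_real (\<Sum>k<n. (cmod (c k))\<^sup>2)"
    by (simp add: complex_norm_square del: of_real_power)
  finally show ?thesis unfolding L2_inner_self of_real_eq_iff .
qed

text \<open>For an orthonormal basis \<open>u\<close> this is the squared Hilbert-Schmidt norm.
  Values in \<open>ennreal\<close> spare every convergence question, and \<open>u\<close> is left
  free because basis vectors moved by the adjoint of the representation will be inserted.\<close>

definition hs_sum :: "'a measure \<Rightarrow> 'a operator \<Rightarrow> (nat \<Rightarrow> 'a \<Rightarrow> complex) \<Rightarrow> ennreal" where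
  "hs_sum M A u = (\<Sum>k. ennreal ((L2_norm M (A (u k)))\<^sup>2))"

text \<open>
  The partial sums of \<open>\<Sum>\<^sub>m cnj \<langle>A e\<^sub>m, e\<^sub>l\<rangle> e\<^sub>m\<close> stand in for the vector $A^* e_l$; this avoids
  constructing the adjoint.
\<close>

lemma hs_sum_Bessel:
  assumes A: "L2_op M A" and e: "orthonormal_basis M e" and u: "\<And>k. u k \<in> L2 M"
    and Bessel: "\<And>v n. v \<in> L2 M \<Longrightarrow> (\<Sum>k<n. (cmod (L2_inner M v (u k)))\<^sup>2) \<le> (L2_norm M v)\<^sup>2"
  shows "hs_sum M A u \<le> hs_sum M A e"
proof -
  have col: "(\<Sum>k. ennreal ((cmod (L2_inner M (A (u k)) h))\<^sup>2))
      \<le> (\<Sum>m. ennreal ((cmod (L2_inner M (A (e m)) h))\<^sup>2))" if h: "h \<in> L2 M" for h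
  proof (rule suminf_le_const)
    fix n
    define a where "a m = L2_inner M (A (e m)) h" for m
    define v where "v N = (\<lambda>x. \<Sum>m<N. cnj (a m) * e m x)" for N
    have v: "v N \<in> L2 M" for N unfolding v_def by (rule onb_partial_L2[OF e])
    have uv: "L2_inner M (u k) (v N) = (\<Sum>m<N. L2_inner M (u k) (e m) * a m)" for k N
      using L2_inner_sum_right[of "{..<N}" "\<lambda>m x. cnj (a m) * e m x" M "u k"] onb_L2[OF e] u
      by (simp add: v_def L2_scale L2_inner_scale_right mult.commute)
    have "(\<lambda>N. \<Sum>k<n. (cmod (L2_inner M (u k) (v N)))\<^sup>2)
        \<longlonglongrightarrow> (\<Sum>k<n. (cmod (L2_inner M (A (u k)) h))\<^sup>2)"
      using L2_op_onb_sums[OF A e u h] unfolding uv a_def sums_def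
      by (intro tendsto_sum tendsto_power tendsto_norm)
    then have "(\<lambda>N. ennreal (\<Sum>k<n. (cmod (L2_inner M (u k) (v N)))\<^sup>2))
        \<longlonglongrightarrow> ennreal (\<Sum>k<n. (cmod (L2_inner M (A (u k)) h))\<^sup>2)"
      by (rule tendsto_ennrealI)
    moreover have "ennreal (\<Sum>k<n. (cmod (L2_inner M (u k) (v N)))\<^sup>2)
        \<le> (\<Sum>m. ennreal ((cmod (L2_inner M (A (e m)) h))\<^sup>2))" for N
    proof -
      have "(\<Sum>k<n. (cmod (L2_inner M (u k) (v N)))\<^sup>2)
          = (\<Sum>k<n. (cmod (L2_inner M (v N) (u k)))\<^sup>2)"
        by (subst L2_inner_commute) simp
      also have "\<dots> \<le> (L2_norm M (v N))\<^sup>2" by (rule Bessel[OF v])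
      also have "\<dots> = (\<Sum>m<N. (cmod (a m))\<^sup>2)"
        unfolding v_def onb_norm_partial_sum[OF e] by simp
      finally have "ennreal (\<Sum>k<n. (cmod (L2_inner M (u k) (v N)))\<^sup>2)
          \<le> (\<Sum>m<N. ennreal ((cmod (a m))\<^sup>2))"
        by (simp add: sum_ennreal ennreal_leI)
      also have "\<dots> \<le> (\<Sum>m. ennreal ((cmod (a m))\<^sup>2))" by (rule sum_le_suminf) auto
      finally show ?thesis by (simp add: a_def)
    qed
    ultimately have "ennreal (\<Sum>k<n. (cmod (L2_inner M (A (u k)) h))\<^sup>2)
        \<le> (\<Sum>m. ennreal ((cmod (L2_inner M (A (e m)) h))\<^sup>2))"
      by (intro LIMSEQ_le_const2) auto
    then show "(\<Sum>k<n. ennreal ((cmod (L2_inner M (A (u k)) h))\<^sup>2))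
        \<le> (\<Sum>m. ennreal ((cmod (L2_inner M (A (e m)) h))\<^sup>2))"
      by (simp add: sum_ennreal)
  qed simp
  \<comment> \<open>Parseval in the output variable and an exchange of sums leave one output
    direction \<open>e l\<close> at a time, where \<open>col\<close> applies.\<close>
  have "hs_sum M A w = (\<Sum>l. \<Sum>k. ennreal ((cmod (L2_inner M (A (w k)) (e l)))\<^sup>2))"
    if "\<And>k. w k \<in> L2 M" for w
    unfolding hs_sum_def
    by (subst suminf_swap_ennreal)
      (intro suminf_cong onb_Parseval_ennreal[OF e, symmetric] L2_op_L2[OF A] that)
  then show ?thesis
    using u onb_L2[OF e] by (auto intro!: suminf_le col onb_L2[OF e])
qed

text \<open>Each basis satisfies Bessel's inequality, so the previous comparison runs in both
  directions.\<close>

lemma hs_sum_basis: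
  assumes "L2_op M A" "orthonormal_basis M e" "orthonormal_basis M e'"
  shows "hs_sum M A e = hs_sum M A e'"
  using assms
  by (intro antisym hs_sum_Bessel) (auto intro: onb_L2 onb_Bessel)

lemma suminf_ennreal_bound:
  fixes f :: "nat \<Rightarrow> real"
  assumes "\<And>k. 0 \<le> f k" "(\<Sum>k. ennreal (f k)) \<le> ennreal c" "0 \<le> c"
  shows "summable f" "suminf f \<le> c"
proof -
  show s: "summable f"
    using assms by (intro summable_suminf_not_top) (auto simp: top_unique)
  show "suminf f \<le> c"
    using assms suminf_ennreal2[OF assms(1) s] by (simp add: suminf_nonneg s)
qed

text \<open>
  The double series \<open>\<Sum>\<^sub>k\<^sub>l \<langle>A u\<^sub>k, e\<^sub>l\<rangle> \<langle>S e\<^sub>l, e\<^sub>k\<rangle>\<close> is dominated by means of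
  \<open>2 x y \<le> t x\<^sup>2 + y\<^sup>2 / t\<close> with \<open>t = s / a\<close>.
\<close>

lemma trace_bound_pos:
  assumes S: "L2_op M S" and A: "L2_op M A" and e: "orthonormal_basis M e"
    and u: "\<And>k. u k \<in> L2 M"
    and a: "hs_sum M A u \<le> ennreal (a\<^sup>2)" "0 < a"
    and s: "hs_sum M S e \<le> ennreal (s\<^sup>2)" "0 < s"
  shows "summable (\<lambda>k. cmod (L2_inner M (S (A (u k))) (e k)))"
    and "(\<Sum>k. cmod (L2_inner M (S (A (u k))) (e k))) \<le> a * s"
proof -
  define X where "X k l = cmod (L2_inner M (A (u k)) (e l))" for k l
  define Y where "Y k l = cmod (L2_inner M (S (e l)) (e k))" for k l
  have Au: "A (u k) \<in> L2 M" for k by (intro L2_op_L2[OF A] u)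
  have Se: "S (e k) \<in> L2 M" for k by (intro L2_op_L2[OF S] onb_L2[OF e])
  have term_le: "ennreal (cmod (L2_inner M (S (A (u k))) (e k)))
      \<le> (\<Sum>l. ennreal (X k l * Y k l))" for k
  proof -
    \<comment> \<open>A basis is inserted between the two operators: the diagonal entry of the
      composition becomes a series of products of matrix entries.\<close>
    let ?g = "\<lambda>l. L2_inner M (A (u k)) (e l) * L2_inner M (S (e l)) (e k)"
    have sums: "?g sums L2_inner M (S (A (u k))) (e k)"
      by (rule L2_op_onb_sums[OF S e Au onb_L2[OF e]])
    have lim: "(\<lambda>n. ennreal (cmod (\<Sum>l<n. ?g l)))
        \<longlonglongrightarrow> ennreal (cmod (L2_inner M (S (A (u k))) (e k)))"
      using sums unfolding sums_def by (intro tendsto_ennrealI tendsto_norm)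
    have le: "ennreal (cmod (\<Sum>l<n. ?g l)) \<le> (\<Sum>l. ennreal (X k l * Y k l))" for n
    proof -
      have "ennreal (cmod (\<Sum>l<n. ?g l)) \<le> ennreal (\<Sum>l<n. X k l * Y k l)"
        unfolding X_def Y_def by (intro ennreal_leI sum_norm_le) (simp add: norm_mult)
      also have "\<dots> = (\<Sum>l<n. ennreal (X k l * Y k l))"
        by (simp add: sum_ennreal X_def Y_def)
      also have "\<dots> \<le> (\<Sum>l. ennreal (X k l * Y k l))" by (rule sum_le_suminf) auto
      finally show ?thesis .
    qed
    show ?thesis by (rule Lim_bounded[OF lim, of 0]) (intro allI impI le)
  qed
  have XX: "(\<Sum>k. \<Sum>l. ennreal ((X k l)\<^sup>2)) = hs_sum M A u"
    unfolding X_def hs_sum_def by (simp add: onb_Parseval_ennreal[OF e Au])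
  have YY: "(\<Sum>k. \<Sum>l. ennreal ((Y k l)\<^sup>2)) = hs_sum M S e"
    unfolding Y_def hs_sum_def
    by (subst suminf_swap_ennreal) (simp add: onb_Parseval_ennreal[OF e Se])
  have "X k l * Y k l \<le> s / (2 * a) * (X k l)\<^sup>2 + a / (2 * s) * (Y k l)\<^sup>2" for k l
  proof -
    have "0 \<le> (s * X k l - a * Y k l)\<^sup>2 / (2 * a * s)" using a(2) s(2) by simp
    also have "\<dots> = s / (2 * a) * (X k l)\<^sup>2 + a / (2 * s) * (Y k l)\<^sup>2 - X k l * Y k l"
      using a(2) s(2) by (simp add: power2_eq_square field_simps)
    finally show ?thesis by simp
  qed
  then have "(\<Sum>k. \<Sum>l. ennreal (X k l * Y k l))
      \<le> (\<Sum>k. \<Sum>l. ennreal (s / (2 * a)) * ennreal ((X k l)\<^sup>2)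
            + ennreal (a / (2 * s)) * ennreal ((Y k l)\<^sup>2))"
    using a(2) s(2)
    by (intro suminf_le) (auto simp flip: ennreal_mult ennreal_plus intro!: ennreal_leI)
  also have "\<dots> = ennreal (s / (2 * a)) * hs_sum M A u + ennreal (a / (2 * s)) * hs_sum M S e"
    by (simp add: suminf_add[symmetric] XX YY)
  also have "\<dots> \<le> ennreal (s / (2 * a)) * ennreal (a\<^sup>2) + ennreal (a / (2 * s)) * ennreal (s\<^sup>2)"
    by (intro add_mono mult_left_mono a s) auto
  \<comment> \<open>The weights \<open>s / (2 * a)\<close> and \<open>a / (2 * s)\<close> make each
    half contribute exactly \<open>a * s / 2\<close>.\<close>
  also have "\<dots> = ennreal (a * s)"
    using a(2) s(2)
    by (subst (1 2) ennreal_mult[symmetric]; simp flip: ennreal_plus add: power2_eq_square)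
  finally have "(\<Sum>k. \<Sum>l. ennreal (X k l * Y k l)) \<le> ennreal (a * s)" .
  moreover have "(\<Sum>k. ennreal (cmod (L2_inner M (S (A (u k))) (e k))))
      \<le> (\<Sum>k. \<Sum>l. ennreal (X k l * Y k l))"
    by (intro suminf_le term_le) auto
  ultimately have "(\<Sum>k. ennreal (cmod (L2_inner M (S (A (u k))) (e k)))) \<le> ennreal (a * s)"
    by (rule order_trans[rotated])
  from suminf_ennreal_bound[OF _ this]
  show "summable (\<lambda>k. cmod (L2_inner M (S (A (u k))) (e k)))"
    and "(\<Sum>k. cmod (L2_inner M (S (A (u k))) (e k))) \<le> a * s"
    using a(2) s(2) by simp_all
qed

text \<open>The weights of the positive case degenerate when \<open>a\<close> or \<open>s\<close> is
  0, for instance when \<open>a\<close> is the norm of f = 0. Both bounds are therefore enlarged by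
  a positive amount that then tends to 0.\<close>

lemma trace_bound:
  assumes S: "L2_op M S" and A: "L2_op M A" and e: "orthonormal_basis M e"
    and u: "\<And>k. u k \<in> L2 M"
    and a: "hs_sum M A u \<le> ennreal (a\<^sup>2)" "0 \<le> a"
    and s: "hs_sum M S e \<le> ennreal (s\<^sup>2)" "0 \<le> s"
  shows "summable (\<lambda>k. L2_inner M (S (A (u k))) (e k))"
    and "cmod (\<Sum>k. L2_inner M (S (A (u k))) (e k)) \<le> a * s"
proof -
  have pert: "hs_sum M A u \<le> ennreal ((a + \<epsilon>)\<^sup>2)" "hs_sum M S e \<le> ennreal ((s + \<epsilon>)\<^sup>2)"
    if "0 < \<epsilon>" for \<epsilon>
    by (rule order_trans[OF a(1)], intro ennreal_leI power_mono, use that a in simp_all)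
      (rule order_trans[OF s(1)], intro ennreal_leI power_mono, use that s in simp_all)
  have pos: "0 < a + \<epsilon>" "0 < s + \<epsilon>" if "0 < \<epsilon>" for \<epsilon> using that a s by auto
  note tb = trace_bound_pos[OF S A e u pert(1) pos(1) pert(2) pos(2)]
  have sm: "summable (\<lambda>k. cmod (L2_inner M (S (A (u k))) (e k)))"
    by (rule tb(1)[of 1 1]) auto
  then show "summable (\<lambda>k. L2_inner M (S (A (u k))) (e k))" by (rule summable_norm_cancel)
  have "(\<lambda>n. (a + inverse (real (Suc n))) * (s + inverse (real (Suc n)))) \<longlonglongrightarrow> (a + 0) * (s + 0)"
    by (intro tendsto_intros LIMSEQ_inverse_real_of_nat)
  then have "(\<Sum>k. cmod (L2_inner M (S (A (u k))) (e k))) \<le> (a + 0) * (s + 0)"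
    by (rule LIMSEQ_le_const) (auto intro!: tb(2))
  then show "cmod (\<Sum>k. L2_inner M (S (A (u k))) (e k)) \<le> a * s"
    using summable_norm[OF sm] by simp
qed

subsection \<open>Singular values and Schatten norms\<close>

lemma singular_valuesE:
  assumes "singular_values M A s"
  obtains e B where "orthonormal_basis M e" "is_adjoint M A B"
    "\<forall>k. AE x in M. B (A (e k)) x = complex_of_real ((s k)\<^sup>2) * e k x" "\<forall>k. 0 \<le> s k"
proof -
  obtain e where "\<exists>B. orthonormal_basis M e \<and> is_adjoint M A B \<and>
      (\<forall>k. AE x in M. B (A (e k)) x = complex_of_real ((s k)\<^sup>2) * e k x)"
    using assms[unfolded singular_values_def, THEN conjunct2] by (rule exE)
  then obtain B where "orthonormal_basis M e \<and> is_adjoint M A B \<and>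
      (\<forall>k. AE x in M. B (A (e k)) x = complex_of_real ((s k)\<^sup>2) * e k x)" by (rule exE)
  moreover have "\<forall>k. 0 \<le> s k" using assms by (simp add: singular_values_def)
  ultimately show ?thesis by (intro that[of e B]) simp_all
qed

text \<open>Because <A e_k, A e_k> = <B A e_k, e_k> = s_k^2, an eigenvector is stretched by exactly
  its singular value.\<close>

lemma singular_values_norm:
  assumes A: "L2_op M A" and e: "orthonormal_basis M e" and B: "is_adjoint M A B"
    and eig: "\<And>k. AE x in M. B (A (e k)) x = complex_of_real ((s k)\<^sup>2) * e k x" and s: "0 \<le> s k"
  shows "L2_norm M (A (e k)) = s k"
proof -
  have Ae: "A (e k) \<in> L2 M" by (intro L2_op_L2[OF A] onb_L2[OF e])
  have "L2_inner M (A (e k)) (A (e k)) = L2_inner M (B (A (e k))) (e k)"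
    by (rule is_adjointD(3)[OF B Ae onb_L2[OF e], symmetric])
  also have "\<dots> = L2_inner M (\<lambda>x. complex_of_real ((s k)\<^sup>2) * e k x) (e k)"
    using L2_measurable[OF L2_op_L2[OF is_adjointD(1)[OF B] Ae]]
      L2_measurable[OF L2_scale[OF onb_L2[OF e]]] eig
    by (rule L2_inner_cong_AE) (simp_all add: L2_measurable[OF onb_L2[OF e]])
  also have "\<dots> = complex_of_real ((s k)\<^sup>2)"
    unfolding L2_inner_scale_left onb_inner[OF e] by simp
  finally have "complex_of_real ((L2_norm M (A (e k)))\<^sup>2) = complex_of_real ((s k)\<^sup>2)"
    unfolding L2_inner_self .
  then have "(L2_norm M (A (e k)))\<^sup>2 = (s k)\<^sup>2"
    by (rule of_real_eq_iff[THEN iffD1])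
  then show ?thesis by (rule power2_eq_imp_eq[OF _ L2_norm_nonneg s])
qed

text \<open>In the eigenbasis each term of the sum is the square of a singular value; basis
  independence moves the result to any \<open>e'\<close>.\<close>

lemma singular_values_hs_sum:
  assumes A: "L2_op M A" and s: "singular_values M A s" and e': "orthonormal_basis M e'"
  shows "hs_sum M A e' = (\<Sum>k. ennreal ((s k)\<^sup>2))"
proof -
  obtain e B where e: "orthonormal_basis M e" and B: "is_adjoint M A B"
    and eig: "\<forall>k. AE x in M. B (A (e k)) x = complex_of_real ((s k)\<^sup>2) * e k x"
    and s: "\<forall>k. 0 \<le> s k"
    by (rule singular_valuesE[OF s])
  note eig = eig[rule_format] and s = s[rule_format]
  show ?thesis
    unfolding hs_sum_basis[OF A e' e]
    by (simp add: hs_sum_def singular_values_norm[OF A e B eig s])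
qed

text \<open>
  The matrix \<open>|\<langle>e\<^sub>k, e'\<^sub>l\<rangle>|\<^sup>2\<close> is doubly stochastic, and it vanishes unless
  \<open>s\<^sub>k = s'\<^sub>l\<close> because eigenvectors of $A^*A$ for distinct eigenvalues are orthogonal.
\<close>

lemma singular_values_suminf_eq:
  assumes A: "L2_op M A" and s: "singular_values M A s" and s': "singular_values M A s'"
  shows "(\<Sum>k. h (s k) :: ennreal) = (\<Sum>k. h (s' k))"
proof -
  obtain e B where e: "orthonormal_basis M e" and B: "is_adjoint M A B"
    and eig: "\<forall>k. AE x in M. B (A (e k)) x = complex_of_real ((s k)\<^sup>2) * e k x"
    and s: "\<forall>k. 0 \<le> s k"
    by (rule singular_valuesE[OF s])
  note eig = eig[rule_format] and s = s[rule_format]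
  obtain e' B' where e': "orthonormal_basis M e'" and B': "is_adjoint M A B'"
    and eig': "\<forall>k. AE x in M. B' (A (e' k)) x = complex_of_real ((s' k)\<^sup>2) * e' k x"
    and s': "\<forall>k. 0 \<le> s' k"
    by (rule singular_valuesE[OF s'])
  note eig' = eig'[rule_format] and s' = s'[rule_format]
  have Ae: "A (e k) \<in> L2 M" "A (e' k) \<in> L2 M" for k
    by (intro L2_op_L2[OF A] onb_L2[OF e] onb_L2[OF e'])+
  have u: "cmod (L2_inner M (e k) (e' l)) = 0 \<or> s k = s' l" for k l
  proof -
    have "complex_of_real ((s k)\<^sup>2) * L2_inner M (e k) (e' l) = L2_inner M (B (A (e k))) (e' l)"
      unfolding L2_inner_scale_left[symmetric]
      by (intro L2_inner_cong_AE AE_symmetric[OF eig] L2_measurable L2_scale Ae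
          L2_op_L2[OF is_adjointD(1)[OF B]] onb_L2[OF e] onb_L2[OF e']) simp
    also have "\<dots> = L2_inner M (e k) (B' (A (e' l)))"
      using is_adjointD(3)[OF B Ae(1) onb_L2[OF e']] is_adjointD(2)[OF B' onb_L2[OF e] Ae(2)]
      by simp
    also have "\<dots> = L2_inner M (e k) (\<lambda>x. complex_of_real ((s' l)\<^sup>2) * e' l x)"
      by (intro L2_inner_cong_AE eig' L2_measurable L2_scale Ae
          L2_op_L2[OF is_adjointD(1)[OF B']] onb_L2[OF e] onb_L2[OF e']) simp
    also have "\<dots> = complex_of_real ((s' l)\<^sup>2) * L2_inner M (e k) (e' l)"
      unfolding L2_inner_scale_right by simp
    finally have "L2_inner M (e k) (e' l) = 0
        \<or> complex_of_real ((s k)\<^sup>2) = complex_of_real ((s' l)\<^sup>2)"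
      unfolding mult_cancel_right .
    then show ?thesis using power2_eq_imp_eq[OF _ s s'] unfolding of_real_eq_iff by auto
  qed
  let ?w = "\<lambda>k l. ennreal ((cmod (L2_inner M (e k) (e' l)))\<^sup>2)"
  \<comment> \<open>Rows of \<open>?w\<close> sum to 1 by Parseval in \<open>e'\<close>, columns by
    Parseval in \<open>e\<close>.\<close>
  have "(\<Sum>k. h (s k)) = (\<Sum>k. \<Sum>l. h (s k) * ?w k l)"
    by (simp add: onb_Parseval_ennreal[OF e' onb_L2[OF e]] onb_norm[OF e])
  also have "\<dots> = (\<Sum>k. \<Sum>l. h (s' l) * ?w k l)"
  proof -
    have "h (s k) * ?w k l = h (s' l) * ?w k l" for k l using u[of k l] by auto
    then show ?thesis by simp
  qed
  also have "\<dots> = (\<Sum>l. \<Sum>k. h (s' l) * ?w k l)" by (rule suminf_swap_ennreal)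
  also have "\<dots> = (\<Sum>l. \<Sum>k. h (s' l) * ennreal ((cmod (L2_inner M (e' l) (e k)))\<^sup>2))"
    by (subst (2) L2_inner_commute) simp
  also have "\<dots> = (\<Sum>k. h (s' k))"
    by (simp add: onb_Parseval_ennreal[OF e onb_L2[OF e']] onb_norm[OF e'])
  finally show ?thesis .
qed

text \<open>For finite \<open>q\<close> membership carries singular values, and these carry an
  eigenbasis. This is where an orthonormal basis of L^2 comes from.\<close>

lemma schatten_classD:
  assumes "A \<in> schatten_class q M" "q \<noteq> \<infinity>"
  shows "L2_op M A" "\<exists>e. orthonormal_basis M e"
  using assms by (auto simp: schatten_class_def compact_op_def singular_values_def)

lemma schatten_norm_nonneg: "q \<noteq> \<infinity> \<Longrightarrow> 0 \<le> schatten_norm q M A"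
  by (simp add: schatten_norm_def Let_def)

text \<open>The inclusion of l^q into l^2 has norm 1 for q <= 2: every s_k is at most the l^q norm
  N, hence s_k^2 <= N^(2-q) s_k^q, and summation gives N^2.\<close>

lemma hs_sum_le_schatten_norm:
  assumes A: "A \<in> schatten_class q M" and e: "orthonormal_basis M e" and q: "1 \<le> q" "q \<le> 2"
  shows "hs_sum M A e \<le> ennreal ((schatten_norm q M A)\<^sup>2)"
proof -
  define r where "r = enn2real q"
  have "q < top" using q(2) by (rule order_le_less_trans) simp
  then have qr: "q = ennreal r" "q \<noteq> \<infinity>" by (simp_all add: r_def)
  have r: "1 \<le> r"
    using q(1) unfolding qr(1) by (simp add: r_def)
  have r2: "r \<le> 2"
    using enn2real_mono[OF q(2)] by (simp add: r_def)
  have "\<exists>s. singular_values M A s \<and> summable (\<lambda>k. s k powr r)"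
    using A qr(2) by (simp add: schatten_class_def r_def)
  then obtain s0 where s0: "singular_values M A s0" "summable (\<lambda>k. s0 k powr r)" by blast
  have op: "L2_op M A" using schatten_classD[OF A qr(2)] by simp
  define s where "s = (SOME s. singular_values M A s)"
  have s: "singular_values M A s" unfolding s_def using s0(1) by (rule someI[of "singular_values M A"])
  have s_nonneg: "0 \<le> s k" for k using s by (simp add: singular_values_def)
  \<comment> \<open>The sequence chosen inside \<open>schatten_norm\<close> need not be the one
    whose summability membership provides; both have the same sum of powers.\<close>
  have "(\<Sum>k. ennreal (s k powr r)) = (\<Sum>k. ennreal (s0 k powr r))"
    by (rule singular_values_suminf_eq[OF op s s0(1), of "\<lambda>x. ennreal (x powr r)"])
  also have "\<dots> \<noteq> top" by (rule ennreal_suminf_neq_top[OF s0(2)]) simp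
  finally have sm: "summable (\<lambda>k. s k powr r)" by (intro summable_suminf_not_top) auto
  define N where "N = (\<Sum>k. s k powr r) powr (1 / r)"
  have Nr: "N powr r = (\<Sum>k. s k powr r)"
    using r by (simp add: N_def powr_powr suminf_nonneg[OF sm])
  have sN: "s k \<le> N" for k
  proof -
    have "(\<Sum>j\<in>{k}. s j powr r) \<le> (\<Sum>k. s k powr r)"
      by (rule sum_le_suminf[OF sm]) auto
    then have "s k powr r \<le> N powr r" by (simp add: Nr)
    moreover have "0 \<le> N" by (simp add: N_def)
    ultimately show ?thesis
      using powr_less_mono2[of r N "s k"] r by (meson less_le_trans not_le zero_less_one)
  qed
  have "(s k)\<^sup>2 \<le> N powr (2 - r) * s k powr r" for k
  proof (cases "s k = 0")
    case False
    then have pos: "0 < s k" using s_nonneg[of k] by simp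
    then have "(s k)\<^sup>2 = s k powr (2 - r) * s k powr r"
      by (simp flip: powr_add add: powr_numeral)
    also have "\<dots> \<le> N powr (2 - r) * s k powr r"
      using r2 pos sN[of k] by (intro mult_right_mono powr_mono2) auto
    finally show ?thesis .
  qed simp
  then have "hs_sum M A e \<le> (\<Sum>k. ennreal (N powr (2 - r)) * ennreal (s k powr r))"
    unfolding singular_values_hs_sum[OF op s e]
    by (intro suminf_le) (auto simp flip: ennreal_mult intro!: ennreal_leI)
  also have "\<dots> = ennreal (N powr (2 - r) * N powr r)"
    by (simp add: suminf_ennreal2[OF _ sm] Nr ennreal_mult suminf_nonneg[OF sm])
  also have "\<dots> = ennreal (N\<^sup>2)"
    using N_def by (cases "N = 0") (simp_all flip: powr_add add: powr_numeral)
  finally show ?thesis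
    using qr(2) by (simp add: schatten_norm_def Let_def s_def[symmetric] r_def[symmetric] N_def)
qed

section \<open>The Haar measure as a product\<close>

text \<open>Rectangles generate one side, and measurability of the inclusion map handles the other.
  It lets the product of the plane with a half-plane carry the same sigma-algebra as the restriction
  of the Borel sets to the group.\<close>

lemma sets_pair_restrict_space:
  assumes S: "S \<in> sets B"
  shows "sets (A \<Otimes>\<^sub>M restrict_space B S) = sets (restrict_space (A \<Otimes>\<^sub>M B) (space A \<times> S))"
proof
  have sub: "S \<subseteq> space B" using S by (rule sets.sets_into_space)
  have ST: "space A \<times> S \<in> sets (A \<Otimes>\<^sub>M B)" using S by auto
  have "sigma_sets (space A \<times> S) {a \<times> b |a b. a \<in> sets A \<and> b \<in> sets (restrict_space B S)}
      \<subseteq> sets (restrict_space (A \<Otimes>\<^sub>M B) (space A \<times> S))"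
  proof -
    have sp: "space A \<times> S = space (restrict_space (A \<Otimes>\<^sub>M B) (space A \<times> S))"
      using sub by (auto simp: space_restrict_space space_pair_measure)
    have gen: "{a \<times> b |a b. a \<in> sets A \<and> b \<in> sets (restrict_space B S)}
        \<subseteq> sets (restrict_space (A \<Otimes>\<^sub>M B) (space A \<times> S))"
    proof safe
      fix a b assume ab: "a \<in> sets A" "b \<in> sets (restrict_space B S)"
      then have b: "b \<in> sets B" "b \<subseteq> S" using S by (auto simp: sets_restrict_space_iff)
      have "a \<times> b \<subseteq> space A \<times> S" using ab b sets.sets_into_space[of a A] by auto
      with ab b show "a \<times> b \<in> sets (restrict_space (A \<Otimes>\<^sub>M B) (space A \<times> S))"
        using ST by (subst sets_restrict_space_iff) auto
    qed
    show ?thesis using sets.sigma_sets_subset[OF gen] by (simp only: sp[symmetric])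
  qed
  then show "sets (A \<Otimes>\<^sub>M restrict_space B S) \<subseteq> sets (restrict_space (A \<Otimes>\<^sub>M B) (space A \<times> S))"
    using sub by (simp add: sets_pair_measure space_restrict_space Int_absorb1 Int_absorb2)
  show "sets (restrict_space (A \<Otimes>\<^sub>M B) (space A \<times> S)) \<subseteq> sets (A \<Otimes>\<^sub>M restrict_space B S)"
  proof
    fix X assume X: "X \<in> sets (restrict_space (A \<Otimes>\<^sub>M B) (space A \<times> S))"
    then have X': "X \<in> sets (A \<Otimes>\<^sub>M B)" "X \<subseteq> space A \<times> S"
      using ST by (auto simp: sets_restrict_space_iff)
    have "(\<lambda>p. snd p) \<in> measurable (A \<Otimes>\<^sub>M restrict_space B S) B"
      by (rule measurable_compose[OF measurable_snd measurable_restrict_space1]) simp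
    then have "(\<lambda>p. (fst p, snd p)) \<in> measurable (A \<Otimes>\<^sub>M restrict_space B S) (A \<Otimes>\<^sub>M B)"
      by (intro measurable_Pair measurable_fst)
    then have "(\<lambda>p. (fst p, snd p)) -` X \<inter> space (A \<Otimes>\<^sub>M restrict_space B S)
        \<in> sets (A \<Otimes>\<^sub>M restrict_space B S)"
      using X'(1) by (rule measurable_sets)
    moreover have "(\<lambda>p. (fst p, snd p)) -` X \<inter> space (A \<Otimes>\<^sub>M restrict_space B S) = X"
      using X'(2) sub by (auto simp: space_pair_measure space_restrict_space)
    ultimately show "X \<in> sets (A \<Otimes>\<^sub>M restrict_space B S)" by simp
  qed
qed

definition halfplane :: "(real \<times> real) set" where
  "halfplane = {(a, t). 0 < a}"

text \<open>The second factor of the Haar measure: a group element is read as (b, h) with h = (a,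
  t), and the density involves only a.\<close>

definition fiber_measure :: "(real \<times> real) measure" where
  "fiber_measure = density (restrict_space lborel halfplane) (\<lambda>(a, t). ennreal (1 / a ^ 3))"

lemma halfplane_borel [measurable]: "halfplane \<in> sets borel"
proof -
  have "halfplane = {p. 0 < fst p}" by (auto simp: halfplane_def)
  moreover have "{p :: real \<times> real. 0 < fst p} \<in> sets borel"
    by (intro borel_open open_Collect_less continuous_intros)
  ultimately show ?thesis by simp
qed

lemma poincare_eq: "poincare = UNIV \<times> halfplane"
  by (auto simp: poincare_def halfplane_def)

lemma poincare_borel [measurable]: "poincare \<in> sets borel"
proof -
  have "poincare \<in> sets (borel \<Otimes>\<^sub>M borel)" unfolding poincare_eq by measurable
  then show ?thesis unfolding borel_prod .
qed

lemma space_fiber_measure [simp]: "space fiber_measure = halfplane"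
  and sets_fiber_measure: "sets fiber_measure = sets (restrict_space borel halfplane)"
  by (auto simp: fiber_measure_def space_restrict_space sets_restrict_space)

lemma space_haar [simp]: "space haar = poincare"
  and sets_haar: "sets haar = sets (restrict_space borel poincare)"
  by (auto simp: haar_def space_restrict_space sets_restrict_space)

lemma measurable_into_fiber:
  "f \<in> borel_measurable borel \<Longrightarrow> f \<in> borel_measurable fiber_measure"
  by (simp add: measurable_restrict_space1 cong: measurable_cong_sets[OF sets_fiber_measure refl])

lemma nn_integral_fiber:
  assumes [measurable]: "f \<in> borel_measurable fiber_measure"
  shows "(\<integral>\<^sup>+h. f h \<partial>fiber_measure)
    = (\<integral>\<^sup>+h. ennreal (1 / fst h ^ 3) * f h * indicator halfplane h \<partial>lborel)"
proof -
  have f: "f \<in> borel_measurable (restrict_space lborel halfplane)"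
    using assms by (simp cong: measurable_cong_sets add: fiber_measure_def)
  have "(\<lambda>(a, t). ennreal (1 / a ^ 3)) \<in> borel_measurable (borel \<Otimes>\<^sub>M borel :: (real \<times> real) measure)"
    by measurable
  then have d: "(\<lambda>(a, t). ennreal (1 / a ^ 3)) \<in> borel_measurable (restrict_space lborel halfplane)"
    by (intro measurable_restrict_space1) (simp add: borel_prod)
  show ?thesis
    unfolding fiber_measure_def nn_integral_density[OF d f]
    by (subst nn_integral_restrict_space) (auto simp: case_prod_beta)
qed

lemma sigma_finite_fiber: "sigma_finite_measure fiber_measure"
proof -
  have *: "sigma_finite_measure (restrict_space lborel halfplane)"
    by (intro sigma_finite_measure_restrict_space lborel.sigma_finite_measure_axioms) simp
  have "(\<lambda>(a, t). ennreal (1 / a ^ 3)) \<in> borel_measurable (borel \<Otimes>\<^sub>M borel :: (real \<times> real) measure)"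
    by measurable
  then have d: "(\<lambda>(a, t). ennreal (1 / a ^ 3)) \<in> borel_measurable (restrict_space lborel halfplane)"
    by (intro measurable_restrict_space1) (simp add: borel_prod)
  show ?thesis
    unfolding fiber_measure_def sigma_finite_measure.sigma_finite_iff_density_finite[OF * d]
    by auto
qed

interpretation fiber: sigma_finite_measure fiber_measure by (rule sigma_finite_fiber)

text \<open>The translation b runs over the whole plane and does not enter the density. Uniqueness
  of product measures reduces the claim to rectangles, and the result makes Fubini in b against (a,
  t) available.\<close>

lemma haar_eq: "haar = lborel \<Otimes>\<^sub>M fiber_measure"
proof (rule pair_measure_eqI[symmetric])
  show "sigma_finite_measure (lborel :: plane measure)" by (rule lborel.sigma_finite_measure_axioms)
  show "sigma_finite_measure fiber_measure" by (rule sigma_finite_fiber)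
  show "sets (lborel \<Otimes>\<^sub>M fiber_measure) = sets haar"
  proof -
    have "sets ((lborel :: plane measure) \<Otimes>\<^sub>M fiber_measure)
        = sets ((borel :: plane measure) \<Otimes>\<^sub>M restrict_space borel halfplane)"
      by (intro sets_pair_measure_cong sets_fiber_measure) simp
    also have "\<dots> = sets (restrict_space (borel \<Otimes>\<^sub>M borel) (space (borel :: plane measure) \<times> halfplane))"
      by (rule sets_pair_restrict_space) simp
    also have "\<dots> = sets haar"
      by (simp add: sets_haar borel_prod poincare_eq)
    finally show ?thesis .
  qed
next
  fix A :: "plane set" and B
  assume A: "A \<in> sets lborel" and B: "B \<in> sets fiber_measure"
  then have AB: "A \<times> B \<in> sets (lborel \<Otimes>\<^sub>M fiber_measure)" by auto
  have [measurable]: "A \<in> sets borel" using A by simp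
  have B': "B \<in> sets borel" "B \<subseteq> halfplane"
    using B by (auto simp: sets_fiber_measure sets_restrict_space_iff)
  note [measurable] = B'(1)
  have AB': "A \<times> B \<in> sets (restrict_space lborel poincare)"
  proof -
    have "A \<times> B \<in> sets (borel \<Otimes>\<^sub>M borel)" by measurable
    then have "A \<times> B \<in> sets borel" unfolding borel_prod .
    moreover have "A \<times> B \<subseteq> poincare" using B'(2) by (auto simp: poincare_eq)
    ultimately show ?thesis by (subst sets_restrict_space_iff) auto
  qed
  have "(\<lambda>(b, a, t). ennreal (1 / a ^ 3))
      \<in> borel_measurable (borel \<Otimes>\<^sub>M (borel \<Otimes>\<^sub>M borel) :: pgroup measure)"
    by measurable
  then have d: "(\<lambda>(b, a, t). ennreal (1 / a ^ 3)) \<in> borel_measurable (restrict_space lborel poincare)"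
    by (intro measurable_restrict_space1) (simp add: borel_prod)
  have "B \<in> sets (borel \<Otimes>\<^sub>M borel)" unfolding borel_prod by measurable
  then have "(\<lambda>h. ennreal (1 / fst h ^ 3) * indicator B h) \<in> borel_measurable (borel \<Otimes>\<^sub>M borel)"
    by measurable
  then have [measurable]: "(\<lambda>h. ennreal (1 / fst h ^ 3) * indicator B h) \<in> borel_measurable borel"
    unfolding borel_prod .
  have "emeasure haar (A \<times> B)
      = (\<integral>\<^sup>+p. ennreal (1 / fst (snd p) ^ 3) * indicator (A \<times> B) p * indicator poincare p \<partial>lborel)"
    unfolding haar_def emeasure_density[OF d AB']
    by (subst nn_integral_restrict_space) (auto simp: case_prod_beta)
  also have "\<dots> = (\<integral>\<^sup>+p. indicator A (fst p) *
      (ennreal (1 / fst (snd p) ^ 3) * indicator B (snd p)) \<partial>(lborel \<Otimes>\<^sub>M lborel))"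
    unfolding lborel_prod using B'(2)
    by (intro nn_integral_cong) (auto simp: indicator_def poincare_eq)
  also have "\<dots> = (\<integral>\<^sup>+b. \<integral>\<^sup>+h. indicator A b * (ennreal (1 / fst h ^ 3) * indicator B h) \<partial>lborel \<partial>lborel)"
    by (subst lborel.nn_integral_fst[symmetric]) simp_all
  also have "\<dots> = (\<integral>\<^sup>+b. indicator A b * emeasure fiber_measure B \<partial>lborel)"
  proof (intro nn_integral_cong)
    fix b :: plane
    have "(\<integral>\<^sup>+h. indicator A b * (ennreal (1 / fst h ^ 3) * indicator B h) \<partial>lborel)
        = indicator A b * (\<integral>\<^sup>+h. ennreal (1 / fst h ^ 3) * indicator B h \<partial>lborel)"
      by (rule nn_integral_cmult) measurable
    also have "(\<integral>\<^sup>+h. ennreal (1 / fst h ^ 3) * indicator B h \<partial>lborel)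
        = (\<integral>\<^sup>+h. indicator B h \<partial>fiber_measure)"
      using B B'(2)
      by (subst nn_integral_fiber) (auto intro!: nn_integral_cong simp: indicator_def)
    finally show "(\<integral>\<^sup>+h. indicator A b * (ennreal (1 / fst h ^ 3) * indicator B h) \<partial>lborel)
        = indicator A b * emeasure fiber_measure B"
      using B by simp
  qed
  also have "\<dots> = emeasure lborel A * emeasure fiber_measure B"
    by (subst nn_integral_multc) auto
  finally show "emeasure lborel A * emeasure fiber_measure B = emeasure haar (A \<times> B)" by simp
qed

section \<open>Lightcone coordinates\<close>

text \<open>Two one-dimensional affine substitutions, first in the first coordinate at fixed y and
  then y = (u - v)/2 at fixed u; the second supplies the Jacobian 1/2.\<close>

lemma nn_integral_lightcone:
  fixes h :: "plane \<Rightarrow> ennreal"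
  assumes [measurable]: "h \<in> borel_measurable borel"
  shows "(\<integral>\<^sup>+y. h y \<partial>lborel)
    = (\<integral>\<^sup>+u. \<integral>\<^sup>+v. ennreal (1 / 2) * h ((u + v) / 2, (u - v) / 2) \<partial>lborel \<partial>lborel)"
proof -
  have [measurable]: "h \<in> borel_measurable (borel \<Otimes>\<^sub>M borel)" by (simp add: borel_prod)
  have "(\<integral>\<^sup>+y. h y \<partial>lborel) = (\<integral>\<^sup>+y. \<integral>\<^sup>+z. h (z, y) \<partial>lborel \<partial>lborel)"
    by (subst lborel_prod[symmetric], subst lborel_pair.nn_integral_snd[symmetric]) simp_all
  also have "\<dots> = (\<integral>\<^sup>+y. \<integral>\<^sup>+u. h (u - y, y) \<partial>lborel \<partial>lborel)"
  proof (rule nn_integral_cong)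
    fix y :: real
    show "(\<integral>\<^sup>+z. h (z, y) \<partial>lborel) = (\<integral>\<^sup>+u. h (u - y, y) \<partial>lborel)"
      by (subst nn_integral_real_affine[where c = 1 and t = "- y"]) simp_all
  qed
  also have "\<dots> = (\<integral>\<^sup>+u. \<integral>\<^sup>+y. h (u - y, y) \<partial>lborel \<partial>lborel)"
    by (rule lborel_pair.Fubini') simp
  also have "\<dots> = (\<integral>\<^sup>+u. \<integral>\<^sup>+v. ennreal (1 / 2) * h ((u + v) / 2, (u - v) / 2) \<partial>lborel \<partial>lborel)"
  proof (rule nn_integral_cong)
    fix u :: real
    have "(\<integral>\<^sup>+y. h (u - y, y) \<partial>lborel)
        = ennreal \<bar>- 1 / 2\<bar> * (\<integral>\<^sup>+v. h (u - (u / 2 + - 1 / 2 * v), u / 2 + - 1 / 2 * v) \<partial>lborel)"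
      by (rule nn_integral_real_affine) simp_all
    also have "\<dots> = (\<integral>\<^sup>+v. ennreal (1 / 2) * h (u - (u / 2 + - 1 / 2 * v), u / 2 + - 1 / 2 * v) \<partial>lborel)"
      by (subst nn_integral_cmult) simp_all
    also have "\<dots> = (\<integral>\<^sup>+v. ennreal (1 / 2) * h ((u + v) / 2, (u - v) / 2) \<partial>lborel)"
      by (simp add: field_simps)
    finally show "(\<integral>\<^sup>+y. h (u - y, y) \<partial>lborel)
        = (\<integral>\<^sup>+v. ennreal (1 / 2) * h ((u + v) / 2, (u - v) / 2) \<partial>lborel)" .
  qed
  finally show ?thesis .
qed

lemma nn_integral_scale:
  assumes "f \<in> borel_measurable borel" "c \<noteq> (0::real)"
  shows "(\<integral>\<^sup>+x. f x \<partial>lborel) = ennreal \<bar>c\<bar> * (\<integral>\<^sup>+x. f (c * x) \<partial>lborel)"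
  using nn_integral_real_affine[OF assms, of 0] by simp

text \<open>The substitution w = exp t is made on [-n, n], and monotone convergence lets n grow on
  both sides.\<close>

lemma nn_integral_exp:
  fixes f :: "real \<Rightarrow> ennreal"
  assumes [measurable]: "f \<in> borel_measurable borel"
  shows "(\<integral>\<^sup>+t. f (exp t) * ennreal (exp t) \<partial>lborel) = (\<integral>\<^sup>+w. f w * indicator {0<..} w \<partial>lborel)"
proof -
  have "(\<integral>\<^sup>+t. f (exp t) * ennreal (exp t) * indicator {- real n..real n} t \<partial>lborel)
      = (\<integral>\<^sup>+w. f w * indicator {exp (- real n)..exp (real n)} w \<partial>lborel)" for n
  proof (cases n)
    case (Suc m)
    then show ?thesis
      by (intro nn_integral_substitution_aux[symmetric])
        (auto intro!: continuous_intros derivative_eq_intros)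
  next
    \<comment> \<open>The interval degenerates to a point, outside the scope of the substitution
      rule; both integrals vanish.\<close>
    case 0
    have "AE t in lborel. f (exp t) * ennreal (exp t) * indicator {0::real} t = 0"
      using AE_lborel_singleton[of 0] by eventually_elim simp
    moreover have "AE t in lborel. f t * indicator {1::real} t = 0"
      using AE_lborel_singleton[of 1] by eventually_elim simp
    ultimately have "(\<integral>\<^sup>+t. f (exp t) * ennreal (exp t) * indicator {0::real} t \<partial>lborel) = 0"
        "(\<integral>\<^sup>+t. f t * indicator {1::real} t \<partial>lborel) = 0"
      by (simp_all add: nn_integral_0_iff_AE)
    then show ?thesis using 0 by simp
  qed
  then have "(SUP n. \<integral>\<^sup>+t. f (exp t) * ennreal (exp t) * indicator {- real n..real n} t \<partial>lborel)
      = (SUP n. \<integral>\<^sup>+w. f w * indicator {exp (- real n)..exp (real n)} w \<partial>lborel)"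
    by simp
  moreover have "(SUP n. \<integral>\<^sup>+t. f (exp t) * ennreal (exp t) * indicator {- real n..real n} t \<partial>lborel)
      = (\<integral>\<^sup>+t. (SUP n. f (exp t) * ennreal (exp t) * indicator {- real n..real n} t) \<partial>lborel)"
    by (intro nn_integral_monotone_convergence_SUP[symmetric])
      (auto simp: incseq_def le_fun_def intro!: mult_left_mono split: split_indicator)
  moreover have "(SUP n. \<integral>\<^sup>+w. f w * indicator {exp (- real n)..exp (real n)} w \<partial>lborel)
      = (\<integral>\<^sup>+w. (SUP n. f w * indicator {exp (- real n)..exp (real n)} w) \<partial>lborel)"
  proof (intro nn_integral_monotone_convergence_SUP[symmetric] incseq_SucI le_funI mult_left_mono)
    fix n and w :: real
    have "exp (- real (Suc n)) \<le> exp (- real n)" "exp (real n) \<le> exp (real (Suc n))"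
      by simp_all
    then show "indicator {exp (- real n)..exp (real n)} w
        \<le> (indicator {exp (- real (Suc n))..exp (real (Suc n))} w :: ennreal)"
      unfolding indicator_def atLeastAtMost_iff by (smt (verit) of_bool_eq order_refl zero_le)
  qed simp_all
  moreover have "(SUP n. f (exp t) * ennreal (exp t) * indicator {- real n..real n} t)
      = f (exp t) * ennreal (exp t)" for t
  proof (rule antisym)
    obtain n where "\<bar>t\<bar> \<le> real n" using real_arch_simple by blast
    then have "f (exp t) * ennreal (exp t) \<le> f (exp t) * ennreal (exp t) * indicator {- real n..real n} t"
      by (auto simp: indicator_def)
    then show "f (exp t) * ennreal (exp t)
        \<le> (SUP n. f (exp t) * ennreal (exp t) * indicator {- real n..real n} t)"
      by (rule order_trans[OF _ SUP_upper]) simp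
  qed (auto intro!: SUP_least split: split_indicator)
  moreover have "(SUP n. f w * indicator {exp (- real n)..exp (real n)} w) = f w * indicator {0<..} w"
    for w
  proof (rule antisym)
    show "f w * indicator {0<..} w \<le> (SUP n. f w * indicator {exp (- real n)..exp (real n)} w)"
    proof (cases "0 < w")
      case True
      obtain n where "\<bar>ln w\<bar> \<le> real n" using real_arch_simple by blast
      then have "- real n \<le> ln w" "ln w \<le> real n" by auto
      then have "exp (- real n) \<le> w" "w \<le> exp (real n)"
        using True by (metis exp_le_cancel_iff exp_ln)+
      then have "f w * indicator {0<..} w \<le> f w * indicator {exp (- real n)..exp (real n)} w"
        by (auto simp: indicator_def)
      then show ?thesis by (rule order_trans[OF _ SUP_upper]) simp
    qed simp
    show "(SUP n. f w * indicator {exp (- real n)..exp (real n)} w) \<le> f w * indicator {0<..} w"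
      by (intro SUP_least)
        (auto split: split_indicator dest: order_less_le_trans[OF exp_gt_zero])
  qed
  ultimately show ?thesis by simp
qed

lemma sgn_mult_eq_iff: "(c :: real) \<noteq> 0 \<Longrightarrow> sgn (c * x) = sgn c \<longleftrightarrow> 0 < x"
  by (simp add: sgn_mult sgn_1_pos sgn_zero_iff)

text \<open>As t varies, w = c exp(2t) sweeps the ray from 0 through c, which \<open>sgn\<close>
  records. Since dw = 2 c exp(2t) dt, the factor 1/2 appears.\<close>

lemma nn_integral_exp_ray:
  fixes f :: "real \<Rightarrow> ennreal"
  assumes [measurable]: "f \<in> borel_measurable borel" and c: "c \<noteq> 0"
  shows "(\<integral>\<^sup>+t. f (c * exp (2 * t)) * ennreal (\<bar>c\<bar> * exp (2 * t)) \<partial>lborel)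
    = (\<integral>\<^sup>+w. ennreal (1 / 2) * (f w * indicator {w. sgn w = sgn c} w) \<partial>lborel)"
proof -
  have [measurable]: "{w :: real. sgn w = s} \<in> sets borel" for s by measurable
  have "(\<integral>\<^sup>+w. f w * indicator {w. sgn w = sgn c} w \<partial>lborel)
      = ennreal \<bar>c\<bar> * (\<integral>\<^sup>+w. f (c * w) * indicator {w. sgn w = sgn c} (c * w) \<partial>lborel)"
    by (rule nn_integral_scale[OF _ c]) measurable
  also have "\<dots> = ennreal \<bar>c\<bar> * (\<integral>\<^sup>+w. f (c * w) * indicator {0<..} w \<partial>lborel)"
    by (simp add: indicator_def sgn_mult_eq_iff[OF c])
  also have "\<dots> = ennreal \<bar>c\<bar> * (\<integral>\<^sup>+t. f (c * exp t) * ennreal (exp t) \<partial>lborel)"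
    by (subst nn_integral_exp[symmetric]) simp_all
  also have "\<dots> = (\<integral>\<^sup>+t. f (c * exp t) * ennreal (\<bar>c\<bar> * exp t) \<partial>lborel)"
    by (subst nn_integral_cmult[symmetric]) (simp_all add: ennreal_mult mult_ac)
  also have "\<dots> = ennreal \<bar>2\<bar> * (\<integral>\<^sup>+t. f (c * exp (2 * t)) * ennreal (\<bar>c\<bar> * exp (2 * t)) \<partial>lborel)"
    by (rule nn_integral_scale) simp_all
  finally have "ennreal (1 / 2) * (\<integral>\<^sup>+w. f w * indicator {w. sgn w = sgn c} w \<partial>lborel)
      = ennreal (1 / 2) * (ennreal 2
          * (\<integral>\<^sup>+t. f (c * exp (2 * t)) * ennreal (\<bar>c\<bar> * exp (2 * t)) \<partial>lborel))"
    by simp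
  also have "\<dots> = (\<integral>\<^sup>+t. f (c * exp (2 * t)) * ennreal (\<bar>c\<bar> * exp (2 * t)) \<partial>lborel)"
    by (subst mult.assoc[symmetric], subst ennreal_mult[symmetric]) simp_all
  finally show ?thesis by (subst nn_integral_cmult) simp_all
qed

lemma Lambda_measurable [measurable (raw)]:
  assumes [measurable]: "f \<in> borel_measurable M" "g \<in> borel_measurable M"
  shows "(\<lambda>x. Lambda (f x) (g x)) \<in> borel_measurable M"
  unfolding Lambda_def
  by (rule borel_measurable_continuous_Pair[OF assms]) (intro continuous_intros)

text \<open>Boosts are diagonal in lightcone coordinates: \<open>Lambda (- t)\<close> has the
  eigenvalues \<open>exp (- t)\<close> and \<open>exp t\<close>.\<close>

lemma Lambda_lightcone:
  "fst (a *\<^sub>R Lambda (- t) x) + snd (a *\<^sub>R Lambda (- t) x) = a * exp (- t) * (fst x + snd x)"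
  "fst (a *\<^sub>R Lambda (- t) x) - snd (a *\<^sub>R Lambda (- t) x) = a * exp t * (fst x - snd x)"
  by (simp_all add: Lambda_def cosh_plus_sinh[symmetric] cosh_minus_sinh[symmetric] algebra_simps)

lemma plane_eq_lightcone:
  "(x :: plane) = ((fst x + snd x + (fst x - snd x)) / 2, (fst x + snd x - (fst x - snd x)) / 2)"
  by (simp add: prod_eq_iff)

text \<open>When both lightcone coordinates of x are nonzero, this is the orbit of x under dilations
  and boosts.\<close>

definition same_quadrant :: "plane \<Rightarrow> plane set" where
  "same_quadrant x = {y. sgn (fst y + snd y) = sgn (fst x + snd x)
                       \<and> sgn (fst y - snd y) = sgn (fst x - snd x)}"

lemma same_quadrant_borel [measurable]: "same_quadrant x \<in> sets borel"
proof -
  have "{y \<in> space (borel \<Otimes>\<^sub>M borel). sgn (fst y + snd y) = sgn (fst x + snd x)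
      \<and> sgn (fst y - snd y) = sgn (fst x - snd x)} \<in> sets (borel \<Otimes>\<^sub>M borel :: plane measure)"
    by measurable
  then show ?thesis unfolding same_quadrant_def borel_prod by simp
qed

text \<open>
  In lightcone coordinates $u = x_1 + x_2$, $v = x_1 - x_2$ the orbit map is
  $(a, t) \mapsto (a e^{-t} u, a e^t v)$; substituting $a = \alpha e^t$ turns it into
  $(\alpha u, \alpha e^{2t} v)$, where the two variables separate.
\<close>

lemma nn_integral_orbit:
  fixes h :: "plane \<Rightarrow> ennreal"
  assumes h [measurable]: "h \<in> borel_measurable borel"
    and u: "fst x + snd x \<noteq> 0" and v: "fst x - snd x \<noteq> 0"
  shows "(\<integral>\<^sup>+(a, t). h (a *\<^sub>R Lambda (- t) x) * ennreal (a * \<bar>minkowski x x\<bar>) * indicator {0<..} a \<partial>lborel)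
    = (\<integral>\<^sup>+y. h y * indicator (same_quadrant x) y \<partial>lborel)"
proof -
  define u v where "u = fst x + snd x" and "v = fst x - snd x"
  have uv: "u \<noteq> 0" "v \<noteq> 0" using assms by (simp_all add: u_def v_def)
  have mink: "minkowski x x = u * v" by (simp add: minkowski_def u_def v_def algebra_simps)
  define H where "H p = h ((fst p + snd p) / 2, (fst p - snd p) / 2)" for p
  have "(\<lambda>p :: plane. ((fst p + snd p) / 2, (fst p - snd p) / 2)) \<in> borel_measurable borel"
    by (intro borel_measurable_continuous_onI continuous_intros) simp_all
  then have "H \<in> borel_measurable borel"
    unfolding H_def by (rule measurable_compose[OF _ h])
  then have [measurable]: "H \<in> borel_measurable (borel \<Otimes>\<^sub>M borel)" by (simp add: borel_prod)
  have hH: "h (a *\<^sub>R Lambda (- t) x) = H (a * exp (- t) * u, a * exp t * v)" for a t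
    by (subst plane_eq_lightcone[of "a *\<^sub>R Lambda (- t) x"])
      (simp only: H_def Lambda_lightcone fst_conv snd_conv u_def v_def)
  have [measurable]: "{w :: real. sgn w = s} \<in> sets borel" for s by measurable
  let ?F = "\<lambda>a t. H (a * exp (- t) * u, a * exp t * v) * ennreal (a * \<bar>u * v\<bar>) * indicator {0<..} a"
  have "(\<integral>\<^sup>+(a, t). h (a *\<^sub>R Lambda (- t) x) * ennreal (a * \<bar>minkowski x x\<bar>) * indicator {0<..} a \<partial>lborel)
      = (\<integral>\<^sup>+(a, t). ?F a t \<partial>(lborel \<Otimes>\<^sub>M lborel))"
    unfolding lborel_prod hH mink ..
  also have "\<dots> = (\<integral>\<^sup>+t. \<integral>\<^sup>+a. ?F a t \<partial>lborel \<partial>lborel)"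
    by (subst lborel_pair.nn_integral_snd[symmetric]) simp_all
  also have "\<dots> = (\<integral>\<^sup>+t. \<integral>\<^sup>+\<alpha>. H (\<alpha> * u, \<alpha> * v * exp (2 * t)) * ennreal (\<bar>\<alpha> * v\<bar> * exp (2 * t))
      * (ennreal \<bar>u\<bar> * indicator {0<..} \<alpha>) \<partial>lborel \<partial>lborel)"
  proof (rule nn_integral_cong)
    fix t :: real
    \<comment> \<open>The substitution is a = exp t * \<alpha>. Its factor \<open>exp t\<close> and
      the factor a of the weight together form the \<open>exp (2 * t)\<close> that
      \<open>nn_integral_exp_ray\<close> requires.\<close>
    have "(\<integral>\<^sup>+a. ?F a t \<partial>lborel) = ennreal \<bar>exp t\<bar> * (\<integral>\<^sup>+\<alpha>. ?F (exp t * \<alpha>) t \<partial>lborel)"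
      by (rule nn_integral_scale) simp_all
    also have "\<dots> = (\<integral>\<^sup>+\<alpha>. ennreal (exp t) * ?F (exp t * \<alpha>) t \<partial>lborel)"
      by (subst nn_integral_cmult) simp_all
    also have "\<dots> = (\<integral>\<^sup>+\<alpha>. H (\<alpha> * u, \<alpha> * v * exp (2 * t)) * ennreal (\<bar>\<alpha> * v\<bar> * exp (2 * t))
      * (ennreal \<bar>u\<bar> * indicator {0<..} \<alpha>) \<partial>lborel)"
    proof (rule nn_integral_cong)
      fix \<alpha> :: real
      show "ennreal (exp t) * ?F (exp t * \<alpha>) t
          = H (\<alpha> * u, \<alpha> * v * exp (2 * t)) * ennreal (\<bar>\<alpha> * v\<bar> * exp (2 * t))
              * (ennreal \<bar>u\<bar> * indicator {0<..} \<alpha>)"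
      proof (cases "0 < \<alpha>")
        case True
        have 1: "exp t * \<alpha> * exp (- t) * u = \<alpha> * u" "exp t * \<alpha> * exp t * v = \<alpha> * v * exp (2 * t)"
          by (simp_all add: exp_minus exp_double power2_eq_square)
        have "exp (2 * t) = exp t * exp t" by (simp add: exp_double power2_eq_square)
        then have 2: "ennreal (exp t) * ennreal (exp t * \<alpha> * \<bar>u * v\<bar>)
            = ennreal (\<bar>\<alpha> * v\<bar> * exp (2 * t)) * ennreal \<bar>u\<bar>"
          using True by (simp add: ennreal_mult[symmetric] abs_mult mult_ac del: exp_double)
        have "ennreal (exp t) * ?F (exp t * \<alpha>) t
            = H (\<alpha> * u, \<alpha> * v * exp (2 * t)) * (ennreal (exp t) * ennreal (exp t * \<alpha> * \<bar>u * v\<bar>))"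
          unfolding 1 using True by (simp add: mult_ac)
        then show ?thesis unfolding 2 using True by (simp add: mult_ac)
      qed (simp add: zero_less_mult_iff)
    qed
    finally show "(\<integral>\<^sup>+a. ?F a t \<partial>lborel)
        = (\<integral>\<^sup>+\<alpha>. H (\<alpha> * u, \<alpha> * v * exp (2 * t)) * ennreal (\<bar>\<alpha> * v\<bar> * exp (2 * t))
      * (ennreal \<bar>u\<bar> * indicator {0<..} \<alpha>) \<partial>lborel)" .
  qed
  also have "\<dots> = (\<integral>\<^sup>+\<alpha>. \<integral>\<^sup>+t. H (\<alpha> * u, \<alpha> * v * exp (2 * t)) * ennreal (\<bar>\<alpha> * v\<bar> * exp (2 * t))
      * (ennreal \<bar>u\<bar> * indicator {0<..} \<alpha>) \<partial>lborel \<partial>lborel)"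
    by (rule lborel_pair.Fubini') simp
  also have "\<dots> = (\<integral>\<^sup>+\<alpha>. (\<integral>\<^sup>+w. ennreal (1 / 2) * (H (\<alpha> * u, w) * indicator {w. sgn w = sgn v} w) \<partial>lborel)
      * (ennreal \<bar>u\<bar> * indicator {0<..} \<alpha>) \<partial>lborel)"
  proof (rule nn_integral_cong)
    fix \<alpha> :: real
    show "(\<integral>\<^sup>+t. H (\<alpha> * u, \<alpha> * v * exp (2 * t)) * ennreal (\<bar>\<alpha> * v\<bar> * exp (2 * t))
        * (ennreal \<bar>u\<bar> * indicator {0<..} \<alpha>) \<partial>lborel)
      = (\<integral>\<^sup>+w. ennreal (1 / 2) * (H (\<alpha> * u, w) * indicator {w. sgn w = sgn v} w) \<partial>lborel)
        * (ennreal \<bar>u\<bar> * indicator {0<..} \<alpha>)"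
    proof (cases "0 < \<alpha>")
      case True
      then have "sgn (\<alpha> * v) = sgn v" by (simp add: sgn_mult)
      with True uv nn_integral_exp_ray[of "\<lambda>w. H (\<alpha> * u, w)" "\<alpha> * v"]
      show ?thesis by (subst nn_integral_multc) simp_all
    qed simp
  qed
  \<comment> \<open>Positivity of \<alpha> is rewritten as a sign condition on u * \<alpha>, ready
    for the rescaling by u, which consumes the factor |u|.\<close>
  also have "\<dots> = ennreal \<bar>u\<bar> * (\<integral>\<^sup>+\<alpha>. (\<integral>\<^sup>+w. ennreal (1 / 2) * (H (u * \<alpha>, w)
      * indicator {w. sgn w = sgn v} w) \<partial>lborel) * indicator {w. sgn w = sgn u} (u * \<alpha>) \<partial>lborel)"
    using sgn_mult_eq_iff[OF uv(1)]
    by (subst nn_integral_cmult[symmetric])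
      (auto intro!: nn_integral_cong simp: indicator_def mult_ac)
  also have "\<dots> = (\<integral>\<^sup>+z. (\<integral>\<^sup>+w. ennreal (1 / 2) * (H (z, w)
      * indicator {w. sgn w = sgn v} w) \<partial>lborel) * indicator {w. sgn w = sgn u} z \<partial>lborel)"
    using uv by (intro nn_integral_scale[symmetric]) simp_all
  also have "\<dots> = (\<integral>\<^sup>+z. \<integral>\<^sup>+w. ennreal (1 / 2) * (H (z, w)
      * (indicator {w. sgn w = sgn v} w * indicator {w. sgn w = sgn u} z)) \<partial>lborel \<partial>lborel)"
    by (subst nn_integral_multc[symmetric]) (simp_all add: mult_ac)
  \<comment> \<open>The 1/2 left by the exponential substitution is precisely the Jacobian of
    lightcone coordinates.\<close>
  also have "\<dots> = (\<integral>\<^sup>+z. \<integral>\<^sup>+w. ennreal (1 / 2) * (h ((z + w) / 2, (z - w) / 2)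
      * indicator (same_quadrant x) ((z + w) / 2, (z - w) / 2)) \<partial>lborel \<partial>lborel)"
    by (intro nn_integral_cong)
      (auto simp: H_def indicator_def same_quadrant_def u_def v_def simp flip: add_divide_distrib diff_divide_distrib)
  also have "\<dots> = (\<integral>\<^sup>+y. h y * indicator (same_quadrant x) y \<partial>lborel)"
    by (rule nn_integral_lightcone[symmetric]) measurable
  finally show ?thesis .
qed

text \<open>The lightcone coordinates are scaled by a exp(-t) and a exp t; the boost cancels in the
  product and the Jacobian a^2 is left. This is why the factor a makes the representation
  unitary.\<close>

lemma nn_integral_dilation_boost:
  fixes h :: "plane \<Rightarrow> ennreal"
  assumes h [measurable]: "h \<in> borel_measurable borel" and a: "0 < a"
  shows "(\<integral>\<^sup>+x. ennreal (a\<^sup>2) * h (a *\<^sub>R Lambda (- t) x) \<partial>lborel) = (\<integral>\<^sup>+y. h y \<partial>lborel)"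
proof -
  define H where "H p = h ((fst p + snd p) / 2, (fst p - snd p) / 2)" for p
  have "(\<lambda>p :: plane. ((fst p + snd p) / 2, (fst p - snd p) / 2)) \<in> borel_measurable borel"
    by (intro borel_measurable_continuous_onI continuous_intros) simp_all
  then have "H \<in> borel_measurable borel"
    unfolding H_def by (rule measurable_compose[OF _ h])
  then have [measurable]: "H \<in> borel_measurable (borel \<Otimes>\<^sub>M borel)" by (simp add: borel_prod)
  have hH: "h (a *\<^sub>R Lambda (- t) x) = H (a * exp (- t) * (fst x + snd x), a * exp t * (fst x - snd x))" for x
    by (subst plane_eq_lightcone[of "a *\<^sub>R Lambda (- t) x"])
      (simp only: H_def Lambda_lightcone fst_conv snd_conv)
  have "(\<integral>\<^sup>+x. ennreal (a\<^sup>2) * h (a *\<^sub>R Lambda (- t) x) \<partial>lborel)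
      = (\<integral>\<^sup>+u. \<integral>\<^sup>+v. ennreal (1 / 2) * (ennreal (a\<^sup>2)
          * h (a *\<^sub>R Lambda (- t) ((u + v) / 2, (u - v) / 2))) \<partial>lborel \<partial>lborel)"
    by (rule nn_integral_lightcone) measurable
  also have "\<dots> = (\<integral>\<^sup>+u. \<integral>\<^sup>+v. ennreal (1 / 2)
      * (ennreal (a\<^sup>2) * H (a * exp (- t) * u, a * exp t * v)) \<partial>lborel \<partial>lborel)"
    unfolding hH by (simp flip: add_divide_distrib diff_divide_distrib)
  also have "\<dots> = (\<integral>\<^sup>+u. ennreal (a * exp (- t)) *
      (\<integral>\<^sup>+w. ennreal (1 / 2) * H (a * exp (- t) * u, w) \<partial>lborel) \<partial>lborel)"
  proof (rule nn_integral_cong)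
    fix u :: real
    have "(\<integral>\<^sup>+w. ennreal (1 / 2) * H (a * exp (- t) * u, w) \<partial>lborel)
        = ennreal \<bar>a * exp t\<bar> * (\<integral>\<^sup>+v. ennreal (1 / 2) * H (a * exp (- t) * u, a * exp t * v) \<partial>lborel)"
      using a by (intro nn_integral_scale) simp_all
    then have "ennreal (a * exp (- t)) * (\<integral>\<^sup>+w. ennreal (1 / 2) * H (a * exp (- t) * u, w) \<partial>lborel)
        = ennreal (a * exp (- t)) * ennreal (a * exp t)
            * (\<integral>\<^sup>+v. ennreal (1 / 2) * H (a * exp (- t) * u, a * exp t * v) \<partial>lborel)"
      using a by (simp add: mult.assoc)
    also have "ennreal (a * exp (- t)) * ennreal (a * exp t) = ennreal (a\<^sup>2)"
      using a by (subst ennreal_mult[symmetric]) (simp_all add: exp_minus power2_eq_square)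
    also have "ennreal (a\<^sup>2) * (\<integral>\<^sup>+v. ennreal (1 / 2) * H (a * exp (- t) * u, a * exp t * v) \<partial>lborel)
        = (\<integral>\<^sup>+v. ennreal (1 / 2) * (ennreal (a\<^sup>2) * H (a * exp (- t) * u, a * exp t * v)) \<partial>lborel)"
      by (subst nn_integral_cmult[symmetric]) (simp_all add: mult_ac)
    finally show "(\<integral>\<^sup>+v. ennreal (1 / 2) * (ennreal (a\<^sup>2) * H (a * exp (- t) * u, a * exp t * v)) \<partial>lborel)
        = ennreal (a * exp (- t)) * (\<integral>\<^sup>+w. ennreal (1 / 2) * H (a * exp (- t) * u, w) \<partial>lborel)" ..
  qed
  also have "\<dots> = ennreal \<bar>a * exp (- t)\<bar> *
      (\<integral>\<^sup>+u. \<integral>\<^sup>+w. ennreal (1 / 2) * H (a * exp (- t) * u, w) \<partial>lborel \<partial>lborel)"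
    using a by (subst nn_integral_cmult) simp_all
  also have "\<dots> = (\<integral>\<^sup>+u. \<integral>\<^sup>+w. ennreal (1 / 2) * H (u, w) \<partial>lborel \<partial>lborel)"
    using a by (intro nn_integral_scale[symmetric]) simp_all
  also have "\<dots> = (\<integral>\<^sup>+y. h y \<partial>lborel)"
    by (subst nn_integral_lightcone) (simp_all add: H_def)
  finally show ?thesis .
qed

section \<open>The cones\<close>

text \<open>In lightcone coordinates the four cones are the four open quadrants.\<close>

lemma cone_iff:
  "y \<in> cone i j \<longleftrightarrow>
    (if j = 1 then (if i = 1 then 0 < fst y + snd y \<and> 0 < fst y - snd y
                    else fst y + snd y < 0 \<and> fst y - snd y < 0)
     else (if i = 1 then 0 < fst y + snd y \<and> fst y - snd y < 0
           else fst y + snd y < 0 \<and> 0 < fst y - snd y))"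
proof -
  have "(fst y)\<^sup>2 < (snd y)\<^sup>2 \<longleftrightarrow> \<bar>fst y\<bar> < \<bar>snd y\<bar>" "(snd y)\<^sup>2 < (fst y)\<^sup>2 \<longleftrightarrow> \<bar>snd y\<bar> < \<bar>fst y\<bar>"
    by (simp_all add: abs_le_square_iff flip: not_le)
  then show ?thesis unfolding cone_def by auto
qed

lemma cone_lightcone_nonzero:
  assumes "x \<in> cone i j"
  shows "fst x + snd x \<noteq> 0" "fst x - snd x \<noteq> 0" "minkowski x x \<noteq> 0"
proof -
  show *: "fst x + snd x \<noteq> 0" "fst x - snd x \<noteq> 0"
    using assms by (auto simp: cone_iff split: if_splits)
  have "minkowski x x = (fst x + snd x) * (fst x - snd x)"
    by (simp add: minkowski_def algebra_simps)
  then show "minkowski x x \<noteq> 0" using * by simp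
qed

lemma same_quadrant_cone: "x \<in> cone i j \<Longrightarrow> same_quadrant x = cone i j"
  by (auto simp: same_quadrant_def cone_iff sgn_1_pos sgn_1_neg split: if_splits)

lemma cone_borel [measurable]: "cone i j \<in> sets borel"
proof -
  have "cone i j \<in> sets (borel \<Otimes>\<^sub>M borel)"
  proof -
    have "{y \<in> space (borel \<Otimes>\<^sub>M borel). y \<in> cone i j} \<in> sets (borel \<Otimes>\<^sub>M borel)"
      unfolding cone_iff by measurable
    moreover have "{y \<in> space (borel \<Otimes>\<^sub>M borel). y \<in> cone i j} = cone i j"
      by (auto simp: space_pair_measure)
    ultimately show ?thesis by (simp only:)
  qed
  then show ?thesis unfolding borel_prod .
qed

lemma orbit_in_cone:
  assumes "0 < a"
  shows "a *\<^sub>R Lambda (- t) x \<in> cone i j \<longleftrightarrow> x \<in> cone i j"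
  unfolding cone_iff Lambda_lightcone using assms
  by (simp add: zero_less_mult_iff mult_less_0_iff)

lemma space_cone_measure [simp]: "space (cone_measure i j) = cone i j"
  and sets_cone_measure: "sets (cone_measure i j) = sets (restrict_space borel (cone i j))"
  by (auto simp: cone_measure_def space_restrict_space sets_restrict_space)

lemma measurable_into_cone_measure:
  "f \<in> borel_measurable borel \<Longrightarrow> f \<in> borel_measurable (cone_measure i j)"
  by (simp add: measurable_restrict_space1 cong: measurable_cong_sets[OF sets_cone_measure refl])

lemma sigma_finite_cone: "sigma_finite_measure (cone_measure i j)"
  unfolding cone_measure_def
  by (intro sigma_finite_measure_restrict_space lborel.sigma_finite_measure_axioms) simp

interpretation cone: sigma_finite_measure "cone_measure i j" for i j by (rule sigma_finite_cone)

lemma emeasure_cone_measure: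
  assumes "A \<in> sets (cone_measure i j)"
  shows "A \<in> sets borel" "A \<subseteq> cone i j" "emeasure (cone_measure i j) A = emeasure lborel A"
proof -
  show A: "A \<in> sets borel" "A \<subseteq> cone i j"
    using assms by (auto simp: sets_cone_measure sets_restrict_space_iff)
  show "emeasure (cone_measure i j) A = emeasure lborel A"
    unfolding cone_measure_def using A by (intro emeasure_restrict_space) auto
qed

lemma nn_integral_cone:
  "(\<integral>\<^sup>+x. f x \<partial>cone_measure i j) = (\<integral>\<^sup>+x. f x * indicator (cone i j) x \<partial>lborel)"
  unfolding cone_measure_def by (rule nn_integral_restrict_space) simp

lemma fst_borel: "fst \<in> borel_measurable (borel :: ('a :: second_countable_topology \<times> 'b :: second_countable_topology) measure)"
  and snd_borel: "snd \<in> borel_measurable (borel :: ('a \<times> 'b) measure)"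
  by (intro borel_measurable_continuous_onI continuous_intros)+

lemma measurable_minkowski [measurable (raw)]:
  assumes "f \<in> borel_measurable M" "g \<in> borel_measurable M"
  shows "(\<lambda>x. minkowski (f x) (g x)) \<in> borel_measurable M"
  unfolding minkowski_def
  by (rule borel_measurable_continuous_Pair[OF assms]) (intro continuous_intros)

subsection \<open>Orbits of the dilations and boosts\<close>

lemma fst_fiber [measurable]: "fst \<in> borel_measurable fiber_measure"
  and snd_fiber [measurable]: "snd \<in> borel_measurable fiber_measure"
  by (intro measurable_into_fiber fst_borel snd_borel)+

lemma orbit_measurable:
  assumes "x \<in> cone i j"
  shows "(\<lambda>h. fst h *\<^sub>R Lambda (- snd h) x) \<in> measurable fiber_measure (cone_measure i j)"
  unfolding cone_measure_def
proof (rule measurable_restrict_space2)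
  show "(\<lambda>h. fst h *\<^sub>R Lambda (- snd h) x) \<in> space fiber_measure \<rightarrow> cone i j"
    using assms by (auto simp: halfplane_def orbit_in_cone)
qed measurable

text \<open>The density a^4 |<x;x>| is made so that, against the a^(-3) of the fiber, it leaves the
  weight a |<x;x>| of \<open>nn_integral_orbit\<close>. The orbit fills the quadrant of x, which is
  the cone.\<close>

lemma distr_orbit:
  assumes x: "x \<in> cone i j"
  shows "distr (density fiber_measure (\<lambda>h. ennreal (fst h ^ 4 * \<bar>minkowski x x\<bar>)))
      (cone_measure i j) (\<lambda>h. fst h *\<^sub>R Lambda (- snd h) x) = cone_measure i j"
proof (rule measure_eqI)
  let ?T = "\<lambda>h. fst h *\<^sub>R Lambda (- snd h) x"
  fix A assume "A \<in> sets (distr (density fiber_measure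
    (\<lambda>h. ennreal (fst h ^ 4 * \<bar>minkowski x x\<bar>))) (cone_measure i j) ?T)"
  then have A: "A \<in> sets (cone_measure i j)" by simp
  note [measurable] = orbit_measurable[OF x] A
  note A' = emeasure_cone_measure[OF A]
  have d: "(\<lambda>h. ennreal (fst h ^ 4 * \<bar>minkowski x x\<bar>)) \<in> borel_measurable fiber_measure"
    by measurable
  have "emeasure (distr (density fiber_measure (\<lambda>h. ennreal (fst h ^ 4 * \<bar>minkowski x x\<bar>)))
      (cone_measure i j) ?T) A
    = (\<integral>\<^sup>+h. ennreal (fst h ^ 4 * \<bar>minkowski x x\<bar>) * indicator A (?T h) \<partial>fiber_measure)"
  proof (subst emeasure_distr)
    show "emeasure (density fiber_measure (\<lambda>h. ennreal (fst h ^ 4 * \<bar>minkowski x x\<bar>)))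
        (?T -` A \<inter> space (density fiber_measure (\<lambda>h. ennreal (fst h ^ 4 * \<bar>minkowski x x\<bar>))))
      = (\<integral>\<^sup>+h. ennreal (fst h ^ 4 * \<bar>minkowski x x\<bar>) * indicator A (?T h) \<partial>fiber_measure)"
      using measurable_sets[OF orbit_measurable[OF x] A]
      by (subst emeasure_density[OF d]) (auto intro!: nn_integral_cong simp: indicator_def)
  qed (simp_all add: A)
  also have "\<dots> = (\<integral>\<^sup>+(a, t). indicator A (a *\<^sub>R Lambda (- t) x)
      * ennreal (a * \<bar>minkowski x x\<bar>) * indicator {0<..} a \<partial>lborel)"
  proof (subst nn_integral_fiber)
    show "(\<lambda>h. ennreal (fst h ^ 4 * \<bar>minkowski x x\<bar>) * indicator A (?T h))
        \<in> borel_measurable fiber_measure"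
      by measurable
    have w: "ennreal (1 / a ^ 3) * ennreal (a ^ 4 * m) = ennreal (a * m)"
      if "0 < a" "0 \<le> m" for a m :: real
      using that by (subst ennreal_mult[symmetric]) (simp_all add: field_simps power3_eq_cube power4_eq_xxxx)
    show "(\<integral>\<^sup>+h. ennreal (1 / fst h ^ 3) * (ennreal (fst h ^ 4 * \<bar>minkowski x x\<bar>) * indicator A (?T h))
          * indicator halfplane h \<partial>lborel)
      = (\<integral>\<^sup>+(a, t). indicator A (a *\<^sub>R Lambda (- t) x)
        * ennreal (a * \<bar>minkowski x x\<bar>) * indicator {0<..} a \<partial>lborel)"
      by (intro nn_integral_cong) (auto simp: indicator_def halfplane_def w)
  qed
  also have "\<dots> = (\<integral>\<^sup>+y. indicator A y * indicator (same_quadrant x) y \<partial>lborel)"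
    using A'(1) cone_lightcone_nonzero[OF x] by (intro nn_integral_orbit) simp_all
  also have "\<dots> = (\<integral>\<^sup>+y. indicator A y \<partial>lborel)"
    using A'(2) unfolding same_quadrant_cone[OF x]
    by (intro nn_integral_cong) (auto simp: indicator_def)
  also have "\<dots> = emeasure (cone_measure i j) A" using A' by simp
  finally show "emeasure (distr (density fiber_measure (\<lambda>h. ennreal (fst h ^ 4 * \<bar>minkowski x x\<bar>)))
      (cone_measure i j) ?T) A = emeasure (cone_measure i j) A" .
qed simp

text \<open>Apart from 1/(2 pi), this is the value at x of the representation at (0, a, t) applied
  to D phi: one power of a is the factor in the representation, the other comes from the Minkowski
  form at the orbit point.\<close>

definition fiber_lift :: "plane \<Rightarrow> (plane \<Rightarrow> complex) \<Rightarrow> real \<times> real \<Rightarrow> complex" where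
  "fiber_lift x \<phi> h =
     complex_of_real (sqrt \<bar>minkowski x x\<bar> * (fst h)\<^sup>2) * \<phi> (fst h *\<^sub>R Lambda (- snd h) x)"

text \<open>The squared modulus of the prefactor is the density of \<open>distr_orbit\<close>, so
  the pullback isometry applies at each x of the cone, and orthonormal systems lift to orthonormal
  systems.\<close>

lemma fiber_lift_L2:
  assumes x: "x \<in> cone i j" and \<phi>: "\<phi> \<in> L2 (cone_measure i j)"
  shows "fiber_lift x \<phi> \<in> L2 fiber_measure"
    and "L2_norm fiber_measure (fiber_lift x \<phi>) = L2_norm (cone_measure i j) \<phi>"
    and "\<psi> \<in> L2 (cone_measure i j) \<Longrightarrow>
      L2_inner fiber_measure (fiber_lift x \<phi>) (fiber_lift x \<psi>) = L2_inner (cone_measure i j) \<phi> \<psi>"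
proof -
  let ?c = "\<lambda>h :: real \<times> real. complex_of_real (sqrt \<bar>minkowski x x\<bar> * (fst h)\<^sup>2)"
  have c: "?c \<in> borel_measurable fiber_measure" by measurable
  have "(cmod (?c h))\<^sup>2 = fst h ^ 4 * \<bar>minkowski x x\<bar>" for h
    by (simp add: norm_mult norm_power power_mult_distrib power_mult[symmetric] mult.commute)
  then have d: "distr (density fiber_measure (\<lambda>h. ennreal ((cmod (?c h))\<^sup>2)))
      (cone_measure i j) (\<lambda>h. fst h *\<^sub>R Lambda (- snd h) x) = cone_measure i j"
    using distr_orbit[OF x] by simp
  have lift: "fiber_lift x \<phi> = (\<lambda>h. ?c h * \<phi> (fst h *\<^sub>R Lambda (- snd h) x))" for \<phi>
    by (simp add: fun_eq_iff fiber_lift_def)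
  note pb = L2_pullback[OF orbit_measurable[OF x] c d \<phi>]
  show "fiber_lift x \<phi> \<in> L2 fiber_measure"
    and "L2_norm fiber_measure (fiber_lift x \<phi>) = L2_norm (cone_measure i j) \<phi>"
    and "\<psi> \<in> L2 (cone_measure i j) \<Longrightarrow>
      L2_inner fiber_measure (fiber_lift x \<phi>) (fiber_lift x \<psi>) = L2_inner (cone_measure i j) \<phi> \<psi>"
    unfolding lift using pb by simp_all
qed

lemma minkowski_orbit: "minkowski (a *\<^sub>R Lambda (- t) x) (a *\<^sub>R Lambda (- t) x) = a\<^sup>2 * minkowski x x"
proof -
  have *: "minkowski y y = (fst y + snd y) * (fst y - snd y)" for y
    by (simp add: minkowski_def algebra_simps)
  have "exp (- t) * exp t = 1" by (simp flip: exp_add)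
  then show ?thesis unfolding * Lambda_lightcone
    by (metis (no_types, opaque_lifting) mult.assoc mult.commute mult_1 power2_eq_square)
qed

text \<open>Separation of variables: b survives only in the character, while all of (a, t) sits in
  the lift.\<close>

lemma rep_duflo_moore:
  assumes "0 < fst h"
  shows "rep (b, h) (duflo_moore \<phi>) x
    = complex_of_real (1 / (2 * pi)) * exp (\<i> * complex_of_real (minkowski x b)) * fiber_lift x \<phi> h"
proof -
  obtain a t where h: "h = (a, t)" by (cases h)
  show ?thesis
    using assms
    by (simp add: h fiber_lift_def duflo_moore_def minkowski_orbit abs_mult real_sqrt_mult
        power2_eq_square)
qed

subsection \<open>The representations are unitary\<close>

lemma measurable_dilation_boost:
  assumes "0 < a"
  shows "(\<lambda>x. a *\<^sub>R Lambda (- t) x) \<in> measurable (cone_measure i j) (cone_measure i j)"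
  unfolding cone_measure_def
proof (rule measurable_restrict_space2)
  show "(\<lambda>x. a *\<^sub>R Lambda (- t) x) \<in> space (restrict_space lborel (cone i j)) \<rightarrow> cone i j"
    using assms by (auto simp: space_restrict_space orbit_in_cone)
qed (intro measurable_restrict_space1, measurable)

lemma distr_dilation_boost:
  assumes a: "0 < a"
  shows "distr (density (cone_measure i j) (\<lambda>_. ennreal (a\<^sup>2))) (cone_measure i j)
      (\<lambda>x. a *\<^sub>R Lambda (- t) x) = cone_measure i j"
proof (rule measure_eqI)
  let ?T = "\<lambda>x. a *\<^sub>R Lambda (- t) x"
  fix A assume "A \<in> sets (distr (density (cone_measure i j) (\<lambda>_. ennreal (a\<^sup>2))) (cone_measure i j) ?T)"
  then have A: "A \<in> sets (cone_measure i j)" by simp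
  note [measurable] = measurable_dilation_boost[OF a] A
  note A' = emeasure_cone_measure[OF A]
  have "emeasure (distr (density (cone_measure i j) (\<lambda>_. ennreal (a\<^sup>2))) (cone_measure i j) ?T) A
      = (\<integral>\<^sup>+x. ennreal (a\<^sup>2) * indicator A (?T x) \<partial>cone_measure i j)"
    using measurable_sets[OF measurable_dilation_boost[OF a] A]
    by (subst emeasure_distr, simp, simp, subst emeasure_density)
      (auto intro!: nn_integral_cong simp: indicator_def)
  also have "\<dots> = (\<integral>\<^sup>+x. ennreal (a\<^sup>2) * indicator A (?T x) \<partial>lborel)"
    unfolding nn_integral_cone using A'(2) orbit_in_cone[OF a]
    by (intro nn_integral_cong) (auto simp: indicator_def)
  also have "\<dots> = (\<integral>\<^sup>+y. indicator A y \<partial>lborel)"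
    using A'(1) by (intro nn_integral_dilation_boost a) simp
  also have "\<dots> = emeasure (cone_measure i j) A" using A' by simp
  finally show "emeasure (distr (density (cone_measure i j) (\<lambda>_. ennreal (a\<^sup>2))) (cone_measure i j) ?T) A
      = emeasure (cone_measure i j) A" .
qed simp

text \<open>The prefactor has modulus a, and a^2 is the Jacobian of the dilation and boost, so the
  pullback isometry applies.\<close>

lemma rep_L2:
  assumes g: "g \<in> poincare" and \<phi>: "\<phi> \<in> L2 (cone_measure i j)"
  shows "rep g \<phi> \<in> L2 (cone_measure i j)"
    and "L2_norm (cone_measure i j) (rep g \<phi>) = L2_norm (cone_measure i j) \<phi>"
    and "\<psi> \<in> L2 (cone_measure i j) \<Longrightarrow>
      L2_inner (cone_measure i j) (rep g \<phi>) (rep g \<psi>) = L2_inner (cone_measure i j) \<phi> \<psi>"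
proof -
  obtain b a t where gb: "g = (b, a, t)" and a: "0 < a" using g by (auto simp: poincare_def)
  let ?c = "\<lambda>x. complex_of_real a * iexp (minkowski x b)"
  have [measurable]: "(\<lambda>x. minkowski x b) \<in> borel_measurable (cone_measure i j)"
    by (rule measurable_into_cone_measure) measurable
  have c: "?c \<in> borel_measurable (cone_measure i j)" by measurable
  have "(cmod (?c x))\<^sup>2 = a\<^sup>2" for x by (simp add: norm_mult)
  then have d: "distr (density (cone_measure i j) (\<lambda>x. ennreal ((cmod (?c x))\<^sup>2)))
      (cone_measure i j) (\<lambda>x. a *\<^sub>R Lambda (- t) x) = cone_measure i j"
    using distr_dilation_boost[OF a] by simp
  have rep: "rep g \<phi> = (\<lambda>x. ?c x * \<phi> (a *\<^sub>R Lambda (- t) x))" for \<phi>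
    by (simp add: gb fun_eq_iff)
  note pb = L2_pullback[OF measurable_dilation_boost[OF a] c d \<phi>]
  show "rep g \<phi> \<in> L2 (cone_measure i j)"
    and "L2_norm (cone_measure i j) (rep g \<phi>) = L2_norm (cone_measure i j) \<phi>"
    and "\<psi> \<in> L2 (cone_measure i j) \<Longrightarrow>
      L2_inner (cone_measure i j) (rep g \<phi>) (rep g \<psi>) = L2_inner (cone_measure i j) \<phi> \<psi>"
    unfolding rep using pb by simp_all
qed

lemma rep_L2_op: "g \<in> poincare \<Longrightarrow> L2_op (cone_measure i j) (rep g)"
  by (rule L2_opI[where C = 1]; cases g) (auto simp: rep_L2 algebra_simps intro: rep_L2(1))

text \<open>The inverse group element supplies an adjoint, which is what the choice in
  \<open>adjoint_op\<close> requires. Since \<open>rep g\<close> preserves inner products, <rep g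
  phi, psi> with psi written as rep g (rep g' psi) reduces to <phi, rep g' psi>.\<close>

lemma adjoint_op_rep:
  assumes g: "g \<in> poincare"
  shows "is_adjoint (cone_measure i j) (rep g) (adjoint_op (cone_measure i j) (rep g))"
proof -
  obtain b a t where gb: "g = (b, a, t)" and a: "0 < a" using g by (auto simp: poincare_def)
  \<comment> \<open>The inverse of \<open>g\<close>: its translation part b' solves b + a Lambda t
    b' = 0.\<close>
  define g' :: pgroup where "g' = (- ((1 / a) *\<^sub>R Lambda (- t) b), 1 / a, - t)"
  have g': "g' \<in> poincare" using a by (simp add: g'_def poincare_def)
  have "Lambda t (Lambda (- t) b) = b"
  proof -
    have "cosh t * cosh t = 1 + sinh t * sinh t"
      using cosh_square_eq[of t] by (simp add: power2_eq_square)
    then show ?thesis by (simp add: Lambda_def prod_eq_iff algebra_simps)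
  qed
  moreover have "Lambda t (- (c *\<^sub>R y)) = - (c *\<^sub>R Lambda t y)" for c y
    by (simp add: Lambda_def prod_eq_iff algebra_simps)
  ultimately have "poincare_mult g g' = (0, 1, 0)" using a by (simp add: gb g'_def)
  then have inv: "rep g (rep g' \<psi>) = \<psi>" for \<psi>
    using rep_mult[of g g' \<psi>] by (auto simp: fun_eq_iff minkowski_def Lambda_def)
  have "is_adjoint (cone_measure i j) (rep g) (rep g')"
    unfolding is_adjoint_def
  proof (intro conjI ballI rep_L2_op[OF g'])
    fix \<phi> \<psi> assume \<phi>: "\<phi> \<in> L2 (cone_measure i j)" and \<psi>: "\<psi> \<in> L2 (cone_measure i j)"
    have "L2_inner (cone_measure i j) (rep g \<phi>) \<psi>
        = L2_inner (cone_measure i j) (rep g \<phi>) (rep g (rep g' \<psi>))" unfolding inv ..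
    also have "\<dots> = L2_inner (cone_measure i j) \<phi> (rep g' \<psi>)"
      by (rule rep_L2(3)[OF g \<phi> rep_L2(1)[OF g' \<psi>]])
    finally show "L2_inner (cone_measure i j) (rep g \<phi>) \<psi> = L2_inner (cone_measure i j) \<phi> (rep g' \<psi>)" .
  qed
  then show ?thesis
    unfolding adjoint_op_def by (rule someI[of "is_adjoint (cone_measure i j) (rep g)"])
qed

section \<open>The Fourier transform is an $L^2$ contraction\<close>

lemma integrable_product_measure:
  fixes f :: "'a \<Rightarrow> 'c :: {real_normed_field, second_countable_topology, banach}"
  assumes "sigma_finite_measure M" "sigma_finite_measure N" "integrable M f" "integrable N g"
  shows "integrable (M \<Otimes>\<^sub>M N) (\<lambda>p. f (fst p) * g (snd p))"
    and "(\<integral>p. f (fst p) * g (snd p) \<partial>(M \<Otimes>\<^sub>M N)) = (\<integral>x. f x \<partial>M) * (\<integral>y. g y \<partial>N)"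
proof -
  interpret pair_sigma_finite M N using assms by (simp add: pair_sigma_finite_def)
  have [measurable]: "f \<in> borel_measurable M" "g \<in> borel_measurable N" using assms by auto
  show *: "integrable (M \<Otimes>\<^sub>M N) (\<lambda>p. f (fst p) * g (snd p))"
  proof (rule Fubini_integrable)
    show "integrable M (\<lambda>x. \<integral>y. norm (f (fst (x, y)) * g (snd (x, y))) \<partial>N)"
      using assms by (simp add: norm_mult)
    show "AE x in M. integrable N (\<lambda>y. f (fst (x, y)) * g (snd (x, y)))"
      using assms by simp
  qed measurable
  show "(\<integral>p. f (fst p) * g (snd p) \<partial>(M \<Otimes>\<^sub>M N)) = (\<integral>x. f x \<partial>M) * (\<integral>y. g y \<partial>N)"
    using assms by (subst integral_fst'[OF *, symmetric]) simp
qed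

lemma norm_integral_le_nn_integral:
  fixes f :: "'a \<Rightarrow> 'b :: {banach, second_countable_topology}"
  shows "ennreal (norm (integral\<^sup>L M f)) \<le> (\<integral>\<^sup>+x. ennreal (norm (f x)) \<partial>M)"
  by (cases "integrable M f")
    (simp_all add: integral_norm_bound_ennreal not_integrable_integral_eq)

text \<open>The extra factor has modulus one. For non-integrable f the equivalence makes every
  Fourier integral take the default value 0, so the estimates below extend to all measurable
  f.\<close>

lemma integrable_mult_iexp_iff:
  assumes [measurable]: "f \<in> borel_measurable M" "h \<in> borel_measurable M"
  shows "integrable M (\<lambda>b. f b * iexp (h b)) \<longleftrightarrow> integrable M f"
proof
  assume "integrable M (\<lambda>b. f b * iexp (h b))"
  then show "integrable M f"
    by (rule Bochner_Integration.integrable_bound) (auto simp: norm_mult)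
next
  assume "integrable M f"
  then show "integrable M (\<lambda>b. f b * iexp (h b))"
    by (rule Bochner_Integration.integrable_bound) (auto simp: norm_mult)
qed

text \<open>After y = s x this is the characteristic function of the standard normal distribution at
  c / s.\<close>

lemma gaussian_fourier:
  fixes s c :: real
  assumes s: "0 < s"
  shows "(\<integral>x. complex_of_real (std_normal_density (s * x)) * iexp (c * x) \<partial>lborel)
    = complex_of_real (exp (- (c / s)\<^sup>2 / 2) / s)"
proof -
  have "complex_of_real (exp (- (c / s)\<^sup>2 / 2)) = char std_normal_distribution (c / s)"
    unfolding char_std_normal_distribution by simp
  also have "\<dots> = (\<integral>y. complex_of_real (std_normal_density y) * iexp (c / s * y) \<partial>lborel)"
    unfolding char_def
    by (subst integral_density) (auto simp: normal_density_nonneg scaleR_conv_of_real)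
  also have "\<dots> = \<bar>s\<bar> *\<^sub>R (\<integral>x. complex_of_real (std_normal_density (0 + s * x)) * iexp (c / s * (0 + s * x)) \<partial>lborel)"
    by (rule lborel_integral_real_affine) (use s in simp)
  also have "\<dots> = complex_of_real s * (\<integral>x. complex_of_real (std_normal_density (s * x)) * iexp (c * x) \<partial>lborel)"
    using s by (simp add: scaleR_conv_of_real)
  finally show ?thesis using s by (simp add: field_simps)
qed

lemma nn_integral_std_normal_density:
  assumes "0 < s"
  shows "(\<integral>\<^sup>+x. ennreal (std_normal_density (s * x)) \<partial>lborel) = ennreal (1 / s)"
proof -
  have "(\<integral>\<^sup>+x. ennreal (std_normal_density x) \<partial>lborel) = 1"
    by (subst nn_integral_eq_integral) (auto simp: normal_density_nonneg integral_normal_density)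
  moreover have "(\<integral>\<^sup>+x. ennreal (std_normal_density x) \<partial>lborel)
      = ennreal \<bar>s\<bar> * (\<integral>\<^sup>+x. ennreal (std_normal_density (s * x)) \<partial>lborel)"
    by (rule nn_integral_scale) (use assms in simp_all)
  ultimately have "ennreal (1 / s) * 1
      = ennreal (1 / s) * (ennreal s * (\<integral>\<^sup>+x. ennreal (std_normal_density (s * x)) \<partial>lborel))"
    using assms by simp
  also have "\<dots> = (\<integral>\<^sup>+x. ennreal (std_normal_density (s * x)) \<partial>lborel)"
    using assms by (subst mult.assoc[symmetric], subst ennreal_mult[symmetric]) simp_all
  finally show ?thesis by simp
qed

text \<open>
  With $F$ and $G$ the Fourier transforms of $f$ and of the Gaussian weight $w$, Fubini gives
  \<open>\<integral> w |F|\<^sup>2 = \<integral>\<integral> f(b) cnj (f(b')) G(b - b')\<close>. Since \<open>G\<close> is a nonnegative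
  Gaussian of known mass, \<open>2 |f(b) f(b')| \<le> |f(b)|\<^sup>2 + |f(b')|\<^sup>2\<close> bounds the right side.
\<close>

lemma fourier_gaussian_bound:
  fixes f :: "real \<Rightarrow> complex"
  assumes f: "integrable lborel f" and s: "0 < s"
  shows "(\<integral>\<^sup>+x. ennreal (std_normal_density (s * x) * (cmod (\<integral>b. f b * iexp (x * b) \<partial>lborel))\<^sup>2) \<partial>lborel)
    \<le> ennreal (sqrt (2 * pi)) * (\<integral>\<^sup>+b. ennreal ((cmod (f b))\<^sup>2) \<partial>lborel)"
proof -
  have [measurable]: "f \<in> borel_measurable borel" using f by auto
  define w where "w x = std_normal_density (s * x)" for x
  have [measurable]: "w \<in> borel_measurable borel" unfolding w_def by measurable
  have w0: "0 \<le> w x" for x by (simp add: w_def normal_density_nonneg)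
  have wi: "integrable lborel w"
    using nn_integral_std_normal_density[OF s]
    by (intro integrableI_nonneg) (auto simp: w0 w_def[symmetric])
  \<comment> \<open>Fourier transform of the weight, by \<open>gaussian_fourier\<close>. Its
    integral is sqrt(2 pi) for every s, which keeps the final bound uniform in s.\<close>
  define G where "G c = exp (- (c / s)\<^sup>2 / 2) / s" for c
  have [measurable]: "G \<in> borel_measurable borel" unfolding G_def by measurable
  have G0: "0 \<le> G c" for c using s by (simp add: G_def)
  have Gi: "(\<integral>\<^sup>+c. ennreal (G c) \<partial>lborel) = ennreal (sqrt (2 * pi))"
  proof -
    have "G c = sqrt (2 * pi) / s * std_normal_density (1 / s * c)" for c
      by (simp add: G_def std_normal_density_def power_divide)
    then have "(\<integral>\<^sup>+c. ennreal (G c) \<partial>lborel)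
        = (\<integral>\<^sup>+c. ennreal (sqrt (2 * pi) / s) * ennreal (std_normal_density (1 / s * c)) \<partial>lborel)"
      using s by (simp add: ennreal_mult[symmetric] normal_density_nonneg)
    also have "\<dots> = ennreal (sqrt (2 * pi) / s) * ennreal (1 / (1 / s))"
      using s nn_integral_std_normal_density[of "1 / s"] by (subst nn_integral_cmult) simp_all
    finally show ?thesis using s by (simp add: ennreal_mult[symmetric])
  qed
  have fc: "integrable lborel (\<lambda>b. f b * iexp (x * b))" for x
    using f by (subst integrable_mult_iexp_iff) simp_all
  define F where "F x = (\<integral>b. f b * iexp (x * b) \<partial>lborel)" for x
  let ?L2 = "lborel \<Otimes>\<^sub>M lborel :: (real \<times> real) measure"
  have sf: "sigma_finite_measure (lborel :: real measure)" "sigma_finite_measure ?L2"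
    by (rule lborel.sigma_finite_measure_axioms, subst lborel_prod, rule lborel.sigma_finite_measure_axioms)
  interpret P: pair_sigma_finite "lborel :: real measure" ?L2
    using sf by (simp add: pair_sigma_finite_def)
  define K where "K x p = complex_of_real (w x) * (f (fst p) * cnj (f (snd p)) * iexp (x * (fst p - snd p)))"
    for x and p :: "real \<times> real"
  have FK: "complex_of_real (w x * (cmod (F x))\<^sup>2) = (\<integral>p. K x p \<partial>?L2)" for x
  proof -
    have "cnj (F x) = (\<integral>b. cnj (f b * iexp (x * b)) \<partial>lborel)"
      by (simp add: F_def del: complex_cnj_mult)
    then have "complex_of_real ((cmod (F x))\<^sup>2)
        = (\<integral>b. f b * iexp (x * b) \<partial>lborel) * (\<integral>b. cnj (f b * iexp (x * b)) \<partial>lborel)"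
      unfolding complex_norm_square F_def by simp
    also have "\<dots> = (\<integral>p. f (fst p) * iexp (x * fst p) * cnj (f (snd p) * iexp (x * snd p)) \<partial>?L2)"
      by (intro integrable_product_measure(2)[symmetric] sf(1) fc integrable_cnj)
    also have "\<dots> = (\<integral>p. f (fst p) * cnj (f (snd p)) * iexp (x * (fst p - snd p)) \<partial>?L2)"
      by (intro Bochner_Integration.integral_cong refl)
        (simp add: exp_cnj ring_distribs exp_diff exp_minus field_simps)
    finally show ?thesis unfolding K_def by simp
  qed
  have fn: "integrable lborel (\<lambda>b. cmod (f b))" using f by simp
  \<comment> \<open>The weight is integrable in x and |K| is the weight times the two moduli of f,
    so the triple integral converges absolutely and Fubini applies.\<close>
  have Ki: "integrable (lborel \<Otimes>\<^sub>M ?L2) (case_prod K)"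
  proof (rule Bochner_Integration.integrable_bound)
    show "integrable (lborel \<Otimes>\<^sub>M ?L2) (\<lambda>q. w (fst q) * (\<lambda>p. cmod (f (fst p)) * cmod (f (snd p))) (snd q))"
      by (rule integrable_product_measure(1)[OF sf wi integrable_product_measure(1)[OF sf(1) sf(1) fn fn]])
    show "case_prod K \<in> borel_measurable (lborel \<Otimes>\<^sub>M ?L2)"
      unfolding K_def case_prod_beta by measurable
  qed (simp add: K_def norm_mult w0 split: prod.split)
  have inner: "(\<integral>x. K x p \<partial>lborel) = f (fst p) * cnj (f (snd p)) * complex_of_real (G (fst p - snd p))" for p
  proof -
    have "(\<integral>x. K x p \<partial>lborel)
        = (\<integral>x. f (fst p) * cnj (f (snd p)) * (complex_of_real (w x) * iexp ((fst p - snd p) * x)) \<partial>lborel)"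
      by (intro Bochner_Integration.integral_cong refl) (simp add: K_def mult_ac)
    also have "\<dots> = f (fst p) * cnj (f (snd p)) * complex_of_real (G (fst p - snd p))"
      using gaussian_fourier[OF s, of "fst p - snd p"] by (simp add: w_def G_def)
    finally show ?thesis .
  qed
  have sym: "(\<integral>x. w x * (cmod (F x))\<^sup>2 \<partial>lborel) \<ge> 0" by (simp add: w0)
  have Fi: "integrable lborel (\<lambda>x. w x * (cmod (F x))\<^sup>2)"
    using P.integrable_fst'[OF Ki] unfolding FK[symmetric] case_prod_conv
    by (simp only: complex_of_real_integrable_eq)
  have "complex_of_real (\<integral>x. w x * (cmod (F x))\<^sup>2 \<partial>lborel) = (\<integral>x. \<integral>p. K x p \<partial>?L2 \<partial>lborel)"
    unfolding FK[symmetric] by (rule integral_complex_of_real[symmetric])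
  also have "\<dots> = (\<integral>p. \<integral>x. K x p \<partial>lborel \<partial>?L2)"
    by (rule P.Fubini_integral[OF Ki, symmetric])
  finally have eq: "complex_of_real (\<integral>x. w x * (cmod (F x))\<^sup>2 \<partial>lborel)
      = (\<integral>p. f (fst p) * cnj (f (snd p)) * complex_of_real (G (fst p - snd p)) \<partial>?L2)"
    unfolding inner .
  have "ennreal (\<integral>x. w x * (cmod (F x))\<^sup>2 \<partial>lborel)
      = ennreal (cmod (complex_of_real (\<integral>x. w x * (cmod (F x))\<^sup>2 \<partial>lborel)))"
    using sym by simp
  also have "\<dots> \<le> (\<integral>\<^sup>+p. ennreal (cmod (f (fst p) * cnj (f (snd p)) * complex_of_real (G (fst p - snd p)))) \<partial>?L2)"
    unfolding eq by (rule norm_integral_le_nn_integral)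
  also have "\<dots> \<le> (\<integral>\<^sup>+p. ennreal (1 / 2) * (ennreal ((cmod (f (fst p)))\<^sup>2) * ennreal (G (fst p - snd p)))
      + ennreal (1 / 2) * (ennreal ((cmod (f (snd p)))\<^sup>2) * ennreal (G (fst p - snd p))) \<partial>?L2)"
  proof (rule nn_integral_mono)
    fix p :: "real \<times> real"
    have "cmod (f (fst p) * cnj (f (snd p)) * complex_of_real (G (fst p - snd p)))
        = cmod (f (fst p)) * cmod (f (snd p)) * G (fst p - snd p)"
      by (simp add: norm_mult G0)
    also have "\<dots> \<le> ((cmod (f (fst p)))\<^sup>2 + (cmod (f (snd p)))\<^sup>2) / 2 * G (fst p - snd p)"
      using sum_squares_bound[of "cmod (f (fst p))" "cmod (f (snd p))"] G0
      by (intro mult_right_mono) auto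
    also have "\<dots> = 1 / 2 * ((cmod (f (fst p)))\<^sup>2 * G (fst p - snd p))
        + 1 / 2 * ((cmod (f (snd p)))\<^sup>2 * G (fst p - snd p))"
      by (simp add: field_simps)
    finally show "ennreal (cmod (f (fst p) * cnj (f (snd p)) * complex_of_real (G (fst p - snd p))))
        \<le> ennreal (1 / 2) * (ennreal ((cmod (f (fst p)))\<^sup>2) * ennreal (G (fst p - snd p)))
      + ennreal (1 / 2) * (ennreal ((cmod (f (snd p)))\<^sup>2) * ennreal (G (fst p - snd p)))"
      using G0 by (simp only: ennreal_mult[symmetric] ennreal_plus[symmetric] ennreal_leI
          zero_le_power2 mult_nonneg_nonneg zero_le_divide_1_iff zero_le_numeral)
  qed
  also have "\<dots> = ennreal (1 / 2) * (\<integral>\<^sup>+p. ennreal ((cmod (f (fst p)))\<^sup>2) * ennreal (G (fst p - snd p)) \<partial>?L2)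
      + ennreal (1 / 2) * (\<integral>\<^sup>+p. ennreal ((cmod (f (snd p)))\<^sup>2) * ennreal (G (fst p - snd p)) \<partial>?L2)"
    by (simp add: nn_integral_add nn_integral_cmult)
  also have "(\<integral>\<^sup>+p. ennreal ((cmod (f (fst p)))\<^sup>2) * ennreal (G (fst p - snd p)) \<partial>?L2)
      = (\<integral>\<^sup>+b. \<integral>\<^sup>+b'. ennreal ((cmod (f b))\<^sup>2) * ennreal (G (b - b')) \<partial>lborel \<partial>lborel)"
    by (subst lborel.nn_integral_fst[symmetric]) simp_all
  also have "\<dots> = (\<integral>\<^sup>+b. ennreal ((cmod (f b))\<^sup>2) * ennreal (sqrt (2 * pi)) \<partial>lborel)"
  proof (rule nn_integral_cong)
    fix b :: real
    have "(\<integral>\<^sup>+b'. ennreal (G (b - b')) \<partial>lborel) = (\<integral>\<^sup>+c. ennreal (G c) \<partial>lborel)"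
      by (subst nn_integral_real_affine[where f = "\<lambda>c. ennreal (G c)" and t = b and c = "-1"]) simp_all
    then show "(\<integral>\<^sup>+b'. ennreal ((cmod (f b))\<^sup>2) * ennreal (G (b - b')) \<partial>lborel)
        = ennreal ((cmod (f b))\<^sup>2) * ennreal (sqrt (2 * pi))"
      by (subst nn_integral_cmult) (simp_all add: Gi)
  qed
  also have "(\<integral>\<^sup>+p. ennreal ((cmod (f (snd p)))\<^sup>2) * ennreal (G (fst p - snd p)) \<partial>?L2)
      = (\<integral>\<^sup>+b'. \<integral>\<^sup>+b. ennreal ((cmod (f b'))\<^sup>2) * ennreal (G (b - b')) \<partial>lborel \<partial>lborel)"
    by (subst lborel_pair.nn_integral_snd[symmetric]) simp_all
  also have "\<dots> = (\<integral>\<^sup>+b. ennreal ((cmod (f b))\<^sup>2) * ennreal (sqrt (2 * pi)) \<partial>lborel)"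
  proof (rule nn_integral_cong)
    fix b' :: real
    have "(\<integral>\<^sup>+b. ennreal (G (b - b')) \<partial>lborel) = (\<integral>\<^sup>+c. ennreal (G c) \<partial>lborel)"
      by (subst (2) nn_integral_real_affine[where t = "- b'" and c = 1]) simp_all
    then show "(\<integral>\<^sup>+b. ennreal ((cmod (f b'))\<^sup>2) * ennreal (G (b - b')) \<partial>lborel)
        = ennreal ((cmod (f b'))\<^sup>2) * ennreal (sqrt (2 * pi))"
      by (subst nn_integral_cmult) (simp_all add: Gi)
  qed
  also have "ennreal (1 / 2) * (\<integral>\<^sup>+b. ennreal ((cmod (f b))\<^sup>2) * ennreal (sqrt (2 * pi)) \<partial>lborel)
      + ennreal (1 / 2) * (\<integral>\<^sup>+b. ennreal ((cmod (f b))\<^sup>2) * ennreal (sqrt (2 * pi)) \<partial>lborel)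
      = ennreal (sqrt (2 * pi)) * (\<integral>\<^sup>+b. ennreal ((cmod (f b))\<^sup>2) \<partial>lborel)"
  proof -
    have half: "ennreal (1 / 2) + ennreal (1 / 2) = 1"
      by (subst ennreal_plus[symmetric]) simp_all
    show ?thesis
      unfolding distrib_right[symmetric] half
      by (subst nn_integral_multc) (simp_all only: mult_1 mult.commute, measurable)
  qed
  finally show ?thesis
    using nn_integral_eq_integral[OF Fi] by (simp add: w0 w_def F_def)
qed

text \<open>As s tends to 0 the Gaussian weight, multiplied by sqrt(2 pi), tends to 1; Fatou's lemma
  then gives one half of Plancherel's theorem, with constant sqrt(2 pi) squared. A non-integrable f
  has transform 0 by default.\<close>

lemma fourier_contraction:
  fixes f :: "real \<Rightarrow> complex"
  assumes [measurable]: "f \<in> borel_measurable borel"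
  shows "(\<integral>\<^sup>+x. ennreal ((cmod (\<integral>b. f b * iexp (x * b) \<partial>lborel))\<^sup>2) \<partial>lborel)
    \<le> ennreal (2 * pi) * (\<integral>\<^sup>+b. ennreal ((cmod (f b))\<^sup>2) \<partial>lborel)"
proof (cases "integrable lborel f")
  case False
  then have "\<not> integrable lborel (\<lambda>b. f b * iexp (x * b))" for x
    by (subst integrable_mult_iexp_iff) simp_all
  then show ?thesis by (simp add: not_integrable_integral_eq)
next
  case True
  define F where "F x = (\<integral>b. f b * iexp (x * b) \<partial>lborel)" for x
  have [measurable]: "F \<in> borel_measurable borel" unfolding F_def by measurable
  let ?w = "\<lambda>n x. std_normal_density (inverse (real (Suc n)) * x)"
  have "(\<integral>\<^sup>+x. ennreal ((cmod (F x))\<^sup>2) \<partial>lborel)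
      = (\<integral>\<^sup>+x. liminf (\<lambda>n. ennreal (sqrt (2 * pi)) * ennreal (?w n x * (cmod (F x))\<^sup>2)) \<partial>lborel)"
  proof (rule nn_integral_cong)
    fix x
    have "(\<lambda>n. sqrt (2 * pi) * (?w n x * (cmod (F x))\<^sup>2))
        \<longlonglongrightarrow> sqrt (2 * pi) * (std_normal_density (0 * x) * (cmod (F x))\<^sup>2)"
      unfolding std_normal_density_def
      by (intro tendsto_intros LIMSEQ_inverse_real_of_nat) simp
    then have "(\<lambda>n. ennreal (sqrt (2 * pi) * (?w n x * (cmod (F x))\<^sup>2)))
        \<longlonglongrightarrow> ennreal ((cmod (F x))\<^sup>2)"
      by (intro tendsto_ennrealI) (simp add: std_normal_density_def)
    then show "ennreal ((cmod (F x))\<^sup>2)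
        = liminf (\<lambda>n. ennreal (sqrt (2 * pi)) * ennreal (?w n x * (cmod (F x))\<^sup>2))"
      by (subst ennreal_mult[symmetric])
        (auto simp: normal_density_nonneg intro!: lim_imp_Liminf[symmetric])
  qed
  also have "\<dots> \<le> liminf (\<lambda>n. \<integral>\<^sup>+x. ennreal (sqrt (2 * pi)) * ennreal (?w n x * (cmod (F x))\<^sup>2) \<partial>lborel)"
    by (rule nn_integral_liminf) measurable
  also have "\<dots> \<le> liminf (\<lambda>n. ennreal (sqrt (2 * pi)) *
      (ennreal (sqrt (2 * pi)) * (\<integral>\<^sup>+b. ennreal ((cmod (f b))\<^sup>2) \<partial>lborel)))"
    using fourier_gaussian_bound[OF True, of "inverse (real (Suc _))"]
    by (intro Liminf_mono always_eventually allI)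
      (subst nn_integral_cmult, auto simp: F_def intro!: mult_left_mono)
  also have "\<dots> = ennreal (2 * pi) * (\<integral>\<^sup>+b. ennreal ((cmod (f b))\<^sup>2) \<partial>lborel)"
    by (simp add: Liminf_const mult.assoc[symmetric] ennreal_mult[symmetric])
  finally show ?thesis by (simp add: F_def)
qed

text \<open>The one-dimensional estimate is used once per coordinate, giving (2 pi)^2. Slices of f
  that fail to be integrable cause no trouble, since that estimate holds for every measurable
  function.\<close>

lemma fourier_plane_contraction:
  fixes f :: "plane \<Rightarrow> complex"
  assumes [measurable]: "f \<in> borel_measurable borel"
  shows "(\<integral>\<^sup>+x. ennreal ((cmod (\<integral>b. f b * iexp (minkowski x b) \<partial>lborel))\<^sup>2) \<partial>lborel)
    \<le> ennreal ((2 * pi)\<^sup>2) * (\<integral>\<^sup>+b. ennreal ((cmod (f b))\<^sup>2) \<partial>lborel)"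
proof (cases "integrable lborel f")
  case False
  then have "\<not> integrable lborel (\<lambda>b. f b * iexp (minkowski x b))" for x
    by (subst integrable_mult_iexp_iff) simp_all
  then show ?thesis by (simp add: not_integrable_integral_eq)
next
  case True
  have [measurable]: "f \<in> borel_measurable (borel \<Otimes>\<^sub>M borel)" by (simp add: borel_prod)
  define F where "F c y = (\<integral>d. f (c, d) * iexp (y * d) \<partial>lborel)" for c y
  have [measurable]: "case_prod F \<in> borel_measurable (borel \<Otimes>\<^sub>M borel)"
    unfolding F_def by measurable
  have F': "(\<integral>b. f b * iexp (minkowski (x, y) b) \<partial>lborel) = (\<integral>c. F c (- y) * iexp (x * c) \<partial>lborel)" for x y
  proof -
    have "integrable lborel (\<lambda>b. f b * iexp (minkowski (x, y) b))"
      using True by (subst integrable_mult_iexp_iff) simp_all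
    moreover have eta: "(\<lambda>b. f b * iexp (minkowski (x, y) b))
        = (\<lambda>(c, d). f (c, d) * iexp (minkowski (x, y) (c, d)))"
      by (simp add: fun_eq_iff)
    ultimately have i: "integrable (lborel \<Otimes>\<^sub>M lborel)
        (\<lambda>(c, d). f (c, d) * iexp (minkowski (x, y) (c, d)))"
      unfolding lborel_prod by (simp only:)
    have "(\<integral>b. f b * iexp (minkowski (x, y) b) \<partial>lborel)
        = (\<integral>c. \<integral>d. f (c, d) * iexp (minkowski (x, y) (c, d)) \<partial>lborel \<partial>lborel)"
      unfolding eta using lborel_pair.integral_fst[OF i] by (simp add: lborel_prod)
    also have "\<dots> = (\<integral>c. F c (- y) * iexp (x * c) \<partial>lborel)"
    proof (intro Bochner_Integration.integral_cong refl)
      fix c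
      have split: "f (c, d) * iexp (minkowski (x, y) (c, d)) = f (c, d) * iexp (- y * d) * iexp (x * c)" for d
        by (simp add: minkowski_def algebra_simps exp_diff exp_minus field_simps)
      show "(\<integral>d. f (c, d) * iexp (minkowski (x, y) (c, d)) \<partial>lborel) = F c (- y) * iexp (x * c)"
        unfolding split F_def by simp
    qed
    finally show ?thesis .
  qed
  have "(\<integral>\<^sup>+x. ennreal ((cmod (\<integral>b. f b * iexp (minkowski x b) \<partial>lborel))\<^sup>2) \<partial>lborel)
      = (\<integral>\<^sup>+p. ennreal ((cmod (\<integral>c. F c (- snd p) * iexp (fst p * c) \<partial>lborel))\<^sup>2) \<partial>(lborel \<Otimes>\<^sub>M lborel))"
    unfolding lborel_prod F'[symmetric] by simp
  also have "\<dots> = (\<integral>\<^sup>+y. \<integral>\<^sup>+x. ennreal ((cmod (\<integral>c. F c (- y) * iexp (x * c) \<partial>lborel))\<^sup>2) \<partial>lborel \<partial>lborel)"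
    by (subst lborel_pair.nn_integral_snd[symmetric]) simp_all
  also have "\<dots> \<le> (\<integral>\<^sup>+y. ennreal (2 * pi) * (\<integral>\<^sup>+c. ennreal ((cmod (F c (- y)))\<^sup>2) \<partial>lborel) \<partial>lborel)"
    by (intro nn_integral_mono fourier_contraction) measurable
  also have "\<dots> = ennreal (2 * pi) * (\<integral>\<^sup>+y. \<integral>\<^sup>+c. ennreal ((cmod (F c (- y)))\<^sup>2) \<partial>lborel \<partial>lborel)"
    by (rule nn_integral_cmult) measurable
  \<comment> \<open>The minus sign of the Minkowski form is removed by reflecting y.\<close>
  also have "(\<integral>\<^sup>+y. \<integral>\<^sup>+c. ennreal ((cmod (F c (- y)))\<^sup>2) \<partial>lborel \<partial>lborel)
      = (\<integral>\<^sup>+y. \<integral>\<^sup>+c. ennreal ((cmod (F c y))\<^sup>2) \<partial>lborel \<partial>lborel)"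
    by (subst (2) nn_integral_scale[where c = "-1"]) simp_all
  also have "\<dots> = (\<integral>\<^sup>+c. \<integral>\<^sup>+y. ennreal ((cmod (F c y))\<^sup>2) \<partial>lborel \<partial>lborel)"
    by (rule lborel_pair.Fubini') simp
  also have "ennreal (2 * pi) * \<dots>
      \<le> ennreal (2 * pi) * (\<integral>\<^sup>+c. ennreal (2 * pi) * (\<integral>\<^sup>+d. ennreal ((cmod (f (c, d)))\<^sup>2) \<partial>lborel) \<partial>lborel)"
    unfolding F_def by (intro mult_left_mono nn_integral_mono fourier_contraction) simp_all
  also have "\<dots> = ennreal ((2 * pi)\<^sup>2) * (\<integral>\<^sup>+c. \<integral>\<^sup>+d. ennreal ((cmod (f (c, d)))\<^sup>2) \<partial>lborel \<partial>lborel)"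
    by (subst nn_integral_cmult)
      (simp_all add: mult.assoc[symmetric] ennreal_mult[symmetric] power2_eq_square)
  also have "(\<integral>\<^sup>+c. \<integral>\<^sup>+d. ennreal ((cmod (f (c, d)))\<^sup>2) \<partial>lborel \<partial>lborel)
      = (\<integral>\<^sup>+b. ennreal ((cmod (f b))\<^sup>2) \<partial>lborel)"
    by (subst lborel_prod[symmetric], subst lborel.nn_integral_fst[symmetric]) simp_all
  finally show ?thesis .
qed

section \<open>The partial Fourier transform in the translation variable\<close>

interpretation haar: pair_sigma_finite "lborel :: plane measure" fiber_measure
  by (simp add: pair_sigma_finite_def sigma_finite_fiber lborel.sigma_finite_measure_axioms)

lemma sigma_finite_haar: "sigma_finite_measure haar"
  unfolding haar_eq
  by (rule sigma_finite_pair_measure[OF lborel.sigma_finite_measure_axioms sigma_finite_fiber])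

text \<open>The transform acts in b alone; in the result the frequency x takes the place of b and
  (a, t) is carried along. The constant is that of the Duflo-Moore operator.\<close>

definition partial_fourier :: "(pgroup \<Rightarrow> complex) \<Rightarrow> pgroup \<Rightarrow> complex" where
  "partial_fourier f p
    = complex_of_real (1 / (2 * pi)) * (\<integral>b. f (b, snd p) * iexp (minkowski (fst p) b) \<partial>lborel)"

lemma partial_fourier_measurable:
  assumes "f \<in> borel_measurable haar"
  shows "partial_fourier f \<in> borel_measurable haar"
proof -
  have [measurable]: "f \<in> borel_measurable (lborel \<Otimes>\<^sub>M fiber_measure)" using assms by (simp add: haar_eq)
  show ?thesis unfolding partial_fourier_def haar_eq by measurable
qed

lemma haar_slice_measurable:
  assumes "f \<in> measurable haar N"
  shows "h \<in> space fiber_measure \<Longrightarrow> (\<lambda>b. f (b, h)) \<in> measurable lborel N"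
    and "(\<lambda>h. f (b, h)) \<in> measurable fiber_measure N"
  using assms unfolding haar_eq
  by (auto intro: measurable_compose[OF measurable_Pair2'] measurable_compose[OF measurable_Pair1'])

text \<open>At each fixed (a, t) the square of 1/(2 pi) cancels the constant of the planar estimate,
  and integration over the fiber finishes.\<close>

lemma nn_integral_partial_fourier:
  assumes f: "f \<in> borel_measurable haar"
  shows "(\<integral>\<^sup>+p. ennreal ((cmod (partial_fourier f p))\<^sup>2) \<partial>haar) \<le> (\<integral>\<^sup>+p. ennreal ((cmod (f p))\<^sup>2) \<partial>haar)"
proof -
  have m: "(\<lambda>p. ennreal ((cmod (partial_fourier f p))\<^sup>2)) \<in> borel_measurable (lborel \<Otimes>\<^sub>M fiber_measure)"
    "(\<lambda>p. ennreal ((cmod (f p))\<^sup>2)) \<in> borel_measurable (lborel \<Otimes>\<^sub>M fiber_measure)"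
    using partial_fourier_measurable[OF f] f unfolding haar_eq by measurable
  have "(\<integral>\<^sup>+p. ennreal ((cmod (partial_fourier f p))\<^sup>2) \<partial>haar)
      = (\<integral>\<^sup>+h. \<integral>\<^sup>+x. ennreal ((cmod (partial_fourier f (x, h)))\<^sup>2) \<partial>lborel \<partial>fiber_measure)"
    unfolding haar_eq by (rule haar.nn_integral_snd[OF m(1), symmetric])
  also have "\<dots> \<le> (\<integral>\<^sup>+h. \<integral>\<^sup>+b. ennreal ((cmod (f (b, h)))\<^sup>2) \<partial>lborel \<partial>fiber_measure)"
  proof (rule nn_integral_mono)
    fix h assume h: "h \<in> space fiber_measure"
    have fh: "(\<lambda>b. f (b, h)) \<in> borel_measurable borel"
      using haar_slice_measurable(1)[OF f h] by simp
    have "(\<integral>\<^sup>+x. ennreal ((cmod (partial_fourier f (x, h)))\<^sup>2) \<partial>lborel)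
        = (\<integral>\<^sup>+x. ennreal (1 / (2 * pi)\<^sup>2)
            * ennreal ((cmod (\<integral>b. f (b, h) * iexp (minkowski x b) \<partial>lborel))\<^sup>2) \<partial>lborel)"
      by (intro nn_integral_cong)
        (simp add: partial_fourier_def norm_mult norm_divide power_mult_distrib power_divide ennreal_mult[symmetric])
    also have "\<dots> = ennreal (1 / (2 * pi)\<^sup>2)
        * (\<integral>\<^sup>+x. ennreal ((cmod (\<integral>b. f (b, h) * iexp (minkowski x b) \<partial>lborel))\<^sup>2) \<partial>lborel)"
    proof (rule nn_integral_cmult)
      note [measurable] = fh
      show "(\<lambda>x. ennreal ((cmod (\<integral>b. f (b, h) * iexp (minkowski x b) \<partial>lborel))\<^sup>2))
          \<in> borel_measurable lborel"
        by measurable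
    qed
    also have "\<dots> \<le> ennreal (1 / (2 * pi)\<^sup>2) * (ennreal ((2 * pi)\<^sup>2) * (\<integral>\<^sup>+b. ennreal ((cmod (f (b, h)))\<^sup>2) \<partial>lborel))"
      by (intro mult_left_mono fourier_plane_contraction[OF fh]) simp
    also have "\<dots> = (\<integral>\<^sup>+b. ennreal ((cmod (f (b, h)))\<^sup>2) \<partial>lborel)"
      by (subst mult.assoc[symmetric], subst ennreal_mult[symmetric]) simp_all
    finally show "(\<integral>\<^sup>+x. ennreal ((cmod (partial_fourier f (x, h)))\<^sup>2) \<partial>lborel)
        \<le> (\<integral>\<^sup>+b. ennreal ((cmod (f (b, h)))\<^sup>2) \<partial>lborel)" .
  qed
  also have "\<dots> = (\<integral>\<^sup>+p. ennreal ((cmod (f p))\<^sup>2) \<partial>haar)"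
    unfolding haar_eq by (rule haar.nn_integral_snd[OF m(2)])
  finally show ?thesis .
qed

lemma partial_fourier_L2:
  assumes f: "f \<in> L2 haar"
  shows "partial_fourier f \<in> L2 haar" "L2_norm haar (partial_fourier f) \<le> L2_norm haar f"
proof -
  have m: "f \<in> borel_measurable haar" using f by (simp add: L2_iff)
  have "(\<integral>\<^sup>+p. ennreal ((cmod (partial_fourier f p))\<^sup>2) \<partial>haar) \<le> ennreal ((L2_norm haar f)\<^sup>2)"
    using nn_integral_partial_fourier[OF m] unfolding L2_nn_integral[OF f] .
  from L2_nn_integralI[OF partial_fourier_measurable[OF m] this]
  show "partial_fourier f \<in> L2 haar" "L2_norm haar (partial_fourier f) \<le> L2_norm haar f"
    by simp_all
qed

lemma L1_iff: "f \<in> Lp 1 M \<longleftrightarrow> f \<in> borel_measurable M \<and> integrable M f"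
proof -
  have "(\<lambda>x. cmod (f x) powr 1) = (\<lambda>x. cmod (f x))" by auto
  then show ?thesis
    by (auto simp: Lp_def integrable_norm_iff)
qed

text \<open>Linearity can fail where a slice f(., h) is not integrable and the integral defaults to
  0; Fubini confines this to a null set of h.\<close>

lemma partial_fourier_lincomb:
  assumes f: "f \<in> Lp 1 haar" and g: "g \<in> Lp 1 haar"
  shows "AE p in haar. partial_fourier (\<lambda>p. f p + c * g p) p = partial_fourier f p + c * partial_fourier g p"
proof -
  have i: "integrable (lborel \<Otimes>\<^sub>M fiber_measure) (case_prod (\<lambda>b h. f (b, h)))"
    "integrable (lborel \<Otimes>\<^sub>M fiber_measure) (case_prod (\<lambda>b h. g (b, h)))"
    using f g by (simp_all add: L1_iff haar_eq case_prod_eta)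
  have [measurable]: "f \<in> borel_measurable (lborel \<Otimes>\<^sub>M fiber_measure)"
      "g \<in> borel_measurable (lborel \<Otimes>\<^sub>M fiber_measure)"
      "partial_fourier (\<lambda>p. f p + c * g p) \<in> borel_measurable (lborel \<Otimes>\<^sub>M fiber_measure)"
      "partial_fourier f \<in> borel_measurable (lborel \<Otimes>\<^sub>M fiber_measure)"
      "partial_fourier g \<in> borel_measurable (lborel \<Otimes>\<^sub>M fiber_measure)"
    unfolding haar_eq[symmetric] using f g
    by (auto simp: L1_iff intro!: partial_fourier_measurable)
  have "AE h in fiber_measure. AE x in lborel.
      partial_fourier (\<lambda>p. f p + c * g p) (x, h) = partial_fourier f (x, h) + c * partial_fourier g (x, h)"
    using haar.AE_integrable_snd[OF i(1)] haar.AE_integrable_snd[OF i(2)]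
  proof eventually_elim
    fix h assume fh: "integrable lborel (\<lambda>b. f (b, h))" and gh: "integrable lborel (\<lambda>b. g (b, h))"
    have e: "integrable lborel (\<lambda>b. k b * iexp (minkowski x b))" if "integrable lborel k" for k :: "plane \<Rightarrow> complex" and x
      by (rule Bochner_Integration.integrable_bound[OF that]) (use that in \<open>auto simp: norm_mult\<close>)
    show "AE x in lborel. partial_fourier (\<lambda>p. f p + c * g p) (x, h)
        = partial_fourier f (x, h) + c * partial_fourier g (x, h)"
    proof (rule AE_I2)
      fix x :: plane
      have "(\<integral>b. (f (b, h) + c * g (b, h)) * iexp (minkowski x b) \<partial>lborel)
          = (\<integral>b. f (b, h) * iexp (minkowski x b) + c * (g (b, h) * iexp (minkowski x b)) \<partial>lborel)"
        by (simp add: algebra_simps)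
      also have "\<dots> = (\<integral>b. f (b, h) * iexp (minkowski x b) \<partial>lborel)
          + c * (\<integral>b. g (b, h) * iexp (minkowski x b) \<partial>lborel)"
        by (subst Bochner_Integration.integral_add)
          (simp_all only: e[OF fh] e[OF gh] integrable_mult_right integral_mult_right_zero)
      finally show "partial_fourier (\<lambda>p. f p + c * g p) (x, h)
          = partial_fourier f (x, h) + c * partial_fourier g (x, h)"
        by (simp add: partial_fourier_def algebra_simps)
    qed
  qed
  \<comment> \<open>The exceptional set was found with h outermost; the exchange matches the order
    of the factors of the Haar measure.\<close>
  then have "AE x in lborel. AE h in fiber_measure.
      partial_fourier (\<lambda>p. f p + c * g p) (x, h) = partial_fourier f (x, h) + c * partial_fourier g (x, h)"
    by (subst haar.AE_commute) measurable
  then show ?thesis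
    unfolding haar_eq by (rule haar.AE_pair_measure[rotated]) measurable
qed

text \<open>
  \<open>partial_fourier_lim f G\<close> says that $G$ is the value at $f$ of the continuous extension of
  \<open>partial_fourier\<close> from $L^1 \cap L^2$ to $L^2$.
\<close>

definition partial_fourier_lim :: "(pgroup \<Rightarrow> complex) \<Rightarrow> (pgroup \<Rightarrow> complex) \<Rightarrow> bool" where
  "partial_fourier_lim f G \<longleftrightarrow> G \<in> L2 haar \<and>
    (\<exists>F. (\<forall>n. F n \<in> Lp 1 haar \<inter> L2 haar) \<and>
      (\<lambda>n. L2_norm haar (\<lambda>p. F n p - f p)) \<longlonglongrightarrow> 0 \<and>
      (\<lambda>n. L2_norm haar (\<lambda>p. partial_fourier (F n) p - G p)) \<longlonglongrightarrow> 0)"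

lemma L1_lincomb: "f \<in> Lp 1 M \<Longrightarrow> g \<in> Lp 1 M \<Longrightarrow> (\<lambda>x. f x + c * g x) \<in> Lp 1 M"
  by (auto simp: L1_iff)

lemma L2_norm_partial_fourier_diff:
  assumes f: "f \<in> Lp 1 haar \<inter> L2 haar" and g: "g \<in> Lp 1 haar \<inter> L2 haar"
  shows "L2_norm haar (\<lambda>p. partial_fourier f p - partial_fourier g p) \<le> L2_norm haar (\<lambda>p. f p - g p)"
proof -
  have d: "(\<lambda>p. f p + (-1) * g p) \<in> L2 haar" using f g by (intro L2_add L2_scale) auto
  have pf: "partial_fourier f \<in> L2 haar" "partial_fourier g \<in> L2 haar"
    using f g by (auto intro: partial_fourier_L2)
  have "L2_norm haar (\<lambda>p. partial_fourier f p - partial_fourier g p)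
      = L2_norm haar (partial_fourier (\<lambda>p. f p + (-1) * g p))"
  proof (rule L2_norm_cong_AE)
    show "AE p in haar. partial_fourier f p - partial_fourier g p = partial_fourier (\<lambda>p. f p + (-1) * g p) p"
      using partial_fourier_lincomb[of f g "-1"] f g by auto
  qed (intro L2_measurable L2_diff partial_fourier_L2(1)[OF d] pf)+
  also have "\<dots> \<le> L2_norm haar (\<lambda>p. f p + (-1) * g p)" by (rule partial_fourier_L2(2)[OF d])
  finally show ?thesis by simp
qed

text \<open>Contractivity makes the transforms of any approximating sequence Cauchy. The sequence is
  left arbitrary because the one hidden in \<open>is_fourier\<close> cannot be chosen.\<close>

lemma partial_fourier_lim_approx:
  assumes f: "f \<in> L2 haar" and F: "\<And>n. F n \<in> Lp 1 haar \<inter> L2 haar"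
    and lim: "(\<lambda>n. L2_norm haar (\<lambda>p. F n p - f p)) \<longlonglongrightarrow> 0"
  obtains G where "partial_fourier_lim f G"
    "(\<lambda>n. L2_norm haar (\<lambda>p. partial_fourier (F n) p - G p)) \<longlonglongrightarrow> 0"
proof -
  have "\<exists>G\<in>L2 haar. (\<lambda>n. L2_norm haar (\<lambda>p. partial_fourier (F n) p - G p)) \<longlonglongrightarrow> 0"
  proof (rule L2_complete)
    show "partial_fourier (F n) \<in> L2 haar" for n using F by (intro partial_fourier_L2) auto
    fix \<epsilon> :: real assume "0 < \<epsilon>"
    then obtain N where N: "\<And>n. N \<le> n \<Longrightarrow> L2_norm haar (\<lambda>p. F n p - f p) < \<epsilon> / 2"
      using LIMSEQ_D[OF lim, of "\<epsilon> / 2"] by auto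
    have "L2_norm haar (\<lambda>p. partial_fourier (F m) p - partial_fourier (F n) p) < \<epsilon>"
      if "N \<le> m" "N \<le> n" for m n
    proof -
      have "L2_norm haar (\<lambda>p. partial_fourier (F m) p - partial_fourier (F n) p)
          \<le> L2_norm haar (\<lambda>p. F m p - F n p)"
        by (rule L2_norm_partial_fourier_diff[OF F F])
      also have "\<dots> \<le> L2_norm haar (\<lambda>p. F m p - f p) + L2_norm haar (\<lambda>p. f p - F n p)"
        using F f by (intro L2_dist_triangle) auto
      also have "\<dots> < \<epsilon>"
        using N[OF that(1)] N[OF that(2)] L2_norm_minus_commute[of haar f "F n"] by simp
      finally show ?thesis .
    qed
    then show "\<exists>N. \<forall>m\<ge>N. \<forall>n\<ge>N. L2_norm haar (\<lambda>p. partial_fourier (F m) p - partial_fourier (F n) p) < \<epsilon>"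
      by blast
  qed
  then obtain G where G: "G \<in> L2 haar"
    "(\<lambda>n. L2_norm haar (\<lambda>p. partial_fourier (F n) p - G p)) \<longlonglongrightarrow> 0" by blast
  then have "partial_fourier_lim f G" unfolding partial_fourier_lim_def using F lim by blast
  then show thesis using G(2) by (rule that)
qed

text \<open>At each point the error is 0 or -f, so its square is dominated by |f|^2 and dominated
  convergence applies. It serves exhaustions of the group as well as cutoffs adapted to D.\<close>

lemma L2_truncate:
  fixes S :: "nat \<Rightarrow> 'a set"
  assumes f: "f \<in> L2 M" and S: "\<And>n. S n \<in> sets M"
    and ev: "\<And>x. x \<in> space M \<Longrightarrow> eventually (\<lambda>n. x \<in> S n) sequentially"
  shows "(\<lambda>x. indicator (S n) x * f x) \<in> L2 M"
    and "(\<lambda>n. L2_norm M (\<lambda>x. indicator (S n) x * f x - f x)) \<longlonglongrightarrow> 0"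
proof -
  note [measurable] = S
  have [measurable]: "f \<in> borel_measurable M" using f by (simp add: L2_iff)
  have fi: "integrable M (\<lambda>x. (cmod (f x))\<^sup>2)" using f by (simp add: L2_iff)
  show "(\<lambda>x. indicator (S n) x * f x) \<in> L2 M" for n
    unfolding L2_iff
    by (intro conjI Bochner_Integration.integrable_bound[OF fi])
      (measurable, auto simp: indicator_def)
  have "(\<lambda>n. \<integral>x. (cmod (indicator (S n) x * f x - f x))\<^sup>2 \<partial>M) \<longlonglongrightarrow> (\<integral>x. 0 \<partial>M)"
  proof (rule integral_dominated_convergence[where w = "\<lambda>x. (cmod (f x))\<^sup>2"])
    show "AE x in M. (\<lambda>n. (cmod (indicator (S n) x * f x - f x))\<^sup>2) \<longlonglongrightarrow> 0"
    proof (rule AE_I2)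
      fix x assume "x \<in> space M"
      from ev[OF this] show "(\<lambda>n. (cmod (indicator (S n) x * f x - f x))\<^sup>2) \<longlonglongrightarrow> 0"
        by (intro tendsto_eventually) (elim eventually_mono, simp)
    qed
  qed (use fi in \<open>measurable, auto simp: indicator_def\<close>)
  then have "(\<lambda>n. sqrt (\<integral>x. (cmod (indicator (S n) x * f x - f x))\<^sup>2 \<partial>M)) \<longlonglongrightarrow> sqrt 0"
    by (intro tendsto_real_sqrt) simp
  then show "(\<lambda>n. L2_norm M (\<lambda>x. indicator (S n) x * f x - f x)) \<longlonglongrightarrow> 0"
    by (simp add: L2_norm_eq)
qed

text \<open>On a set of finite measure |f| <= 1 + |f|^2 is integrable, so truncating along a
  sigma-finite exhaustion lands in L^1.\<close>

lemma L1_L2_approx: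
  assumes f: "f \<in> L2 haar"
  shows "\<exists>F. (\<forall>n. F n \<in> Lp 1 haar \<inter> L2 haar)
    \<and> (\<lambda>n. L2_norm haar (\<lambda>p. F n p - f p)) \<longlonglongrightarrow> 0"
proof -
  obtain S :: "nat \<Rightarrow> pgroup set" where S: "range S \<subseteq> sets haar" "(\<Union>i. S i) = space haar"
    "\<And>i. emeasure haar (S i) \<noteq> \<infinity>" "incseq S"
    using sigma_finite_measure.sigma_finite_incseq[OF sigma_finite_haar] by metis
  have S': "S n \<in> sets haar" for n using S(1) by blast
  note [measurable] = S'
  have ev: "eventually (\<lambda>n. x \<in> S n) sequentially" if x: "x \<in> space haar" for x
  proof -
    obtain n where "x \<in> S n" using x S(2) by blast
    then show ?thesis using S(4) unfolding incseq_def
      by (intro eventually_sequentiallyI[of n]) blast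
  qed
  have "(\<lambda>x. indicator (S n) x * f x) \<in> Lp 1 haar" for n
  proof -
    have [measurable]: "f \<in> borel_measurable haar" using f by (simp add: L2_iff)
    have "integrable haar (\<lambda>x. indicator (S n) x + (cmod (f x))\<^sup>2 :: real)"
      using f S(3)[of n] by (auto simp: L2_iff less_top)
    then have "integrable haar (\<lambda>x. indicator (S n) x * f x)"
    proof (rule Bochner_Integration.integrable_bound)
      have "t \<le> 1 + t\<^sup>2" for t :: real using mult_le_sum_squares[of 1 t] by simp
      then show "AE x in haar. norm (indicator (S n) x * f x)
          \<le> norm (indicator (S n) x + (cmod (f x))\<^sup>2 :: real)"
        by (auto simp: indicator_def)
    qed measurable
    then show ?thesis by (simp add: L1_iff)
  qed
  then show ?thesis
    using L2_truncate[OF f S' ev] by (intro exI[of _ "\<lambda>n x. indicator (S n) x * f x"]) auto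
qed

lemma partial_fourier_lim_exists:
  assumes f: "f \<in> L2 haar"
  shows "\<exists>G. partial_fourier_lim f G"
proof -
  obtain F where F: "\<And>n. F n \<in> Lp 1 haar \<inter> L2 haar"
    and lim: "(\<lambda>n. L2_norm haar (\<lambda>p. F n p - f p)) \<longlonglongrightarrow> 0"
    using L1_L2_approx[OF f] by blast
  show ?thesis by (rule partial_fourier_lim_approx[OF f F lim]) (rule exI)
qed

lemma partial_fourier_lim_L2: "partial_fourier_lim f G \<Longrightarrow> G \<in> L2 haar"
  by (simp add: partial_fourier_lim_def)

lemma partial_fourier_lim_norm:
  assumes f: "f \<in> L2 haar" and G: "partial_fourier_lim f G"
  shows "L2_norm haar G \<le> L2_norm haar f"
proof -
  obtain F where F: "\<And>n. F n \<in> Lp 1 haar \<inter> L2 haar"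
    and l1: "(\<lambda>n. L2_norm haar (\<lambda>p. F n p - f p)) \<longlonglongrightarrow> 0"
    and l2: "(\<lambda>n. L2_norm haar (\<lambda>p. partial_fourier (F n) p - G p)) \<longlonglongrightarrow> 0"
    using G unfolding partial_fourier_lim_def by blast
  have "(\<lambda>n. L2_norm haar (F n)) \<longlonglongrightarrow> L2_norm haar f"
    using F f by (intro L2_norm_tendsto l1) auto
  moreover have "(\<lambda>n. L2_norm haar (partial_fourier (F n))) \<longlonglongrightarrow> L2_norm haar G"
    using F by (intro L2_norm_tendsto l2 partial_fourier_lim_L2[OF G] partial_fourier_L2) auto
  ultimately show ?thesis
    using F by (intro LIMSEQ_le) (auto intro!: partial_fourier_L2)
qed

lemma L2_norm_lincomb_le:
  assumes "f \<in> L2 M" "g \<in> L2 M"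
  shows "L2_norm M (\<lambda>x. f x + c * g x) \<le> L2_norm M f + cmod c * L2_norm M g"
  using L2_norm_triangle[OF assms(1) L2_scale[OF assms(2), of c]] by (simp add: L2_norm_scale)

lemma partial_fourier_lim_lincomb:
  assumes f: "f \<in> L2 haar" and g: "g \<in> L2 haar"
    and F: "partial_fourier_lim f F" and G: "partial_fourier_lim g G"
  shows "partial_fourier_lim (\<lambda>p. f p + c * g p) (\<lambda>p. F p + c * G p)"
proof -
  obtain f' where f': "\<And>n. f' n \<in> Lp 1 haar \<inter> L2 haar"
    and l1: "(\<lambda>n. L2_norm haar (\<lambda>p. f' n p - f p)) \<longlonglongrightarrow> 0"
    and l2: "(\<lambda>n. L2_norm haar (\<lambda>p. partial_fourier (f' n) p - F p)) \<longlonglongrightarrow> 0"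
    using F unfolding partial_fourier_lim_def by blast
  obtain g' where g': "\<And>n. g' n \<in> Lp 1 haar \<inter> L2 haar"
    and k1: "(\<lambda>n. L2_norm haar (\<lambda>p. g' n p - g p)) \<longlonglongrightarrow> 0"
    and k2: "(\<lambda>n. L2_norm haar (\<lambda>p. partial_fourier (g' n) p - G p)) \<longlonglongrightarrow> 0"
    using G unfolding partial_fourier_lim_def by blast
  note F' = partial_fourier_lim_L2[OF F] and G' = partial_fourier_lim_L2[OF G]
  have lim: "(\<lambda>n. L2_norm haar (\<lambda>p. (u n p + c * v n p) - (u0 p + c * v0 p))) \<longlonglongrightarrow> 0"
    if "\<And>n. u n \<in> L2 haar" "u0 \<in> L2 haar" "\<And>n. v n \<in> L2 haar" "v0 \<in> L2 haar"
      "(\<lambda>n. L2_norm haar (\<lambda>p. u n p - u0 p)) \<longlonglongrightarrow> 0" "(\<lambda>n. L2_norm haar (\<lambda>p. v n p - v0 p)) \<longlonglongrightarrow> 0"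
    for u v u0 v0
  proof (rule Lim_null_comparison)
    show "(\<lambda>n. L2_norm haar (\<lambda>p. u n p - u0 p) + cmod c * L2_norm haar (\<lambda>p. v n p - v0 p)) \<longlonglongrightarrow> 0"
      using tendsto_add[OF that(5) tendsto_mult_left[OF that(6), of "cmod c"]] by simp
    show "\<forall>\<^sub>F n in sequentially. norm (L2_norm haar (\<lambda>p. (u n p + c * v n p) - (u0 p + c * v0 p)))
        \<le> L2_norm haar (\<lambda>p. u n p - u0 p) + cmod c * L2_norm haar (\<lambda>p. v n p - v0 p)"
    proof (rule always_eventually, rule allI)
      fix n
      have "(\<lambda>p. (u n p + c * v n p) - (u0 p + c * v0 p)) = (\<lambda>p. (u n p - u0 p) + c * (v n p - v0 p))"
        by (simp add: algebra_simps)
      then show "norm (L2_norm haar (\<lambda>p. (u n p + c * v n p) - (u0 p + c * v0 p)))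
        \<le> L2_norm haar (\<lambda>p. u n p - u0 p) + cmod c * L2_norm haar (\<lambda>p. v n p - v0 p)"
        using L2_norm_lincomb_le[OF L2_diff[OF that(1)[of n] that(2)] L2_diff[OF that(3)[of n] that(4)]]
        by simp
    qed
  qed
  have m: "(\<lambda>p. f' n p + c * g' n p) \<in> Lp 1 haar \<inter> L2 haar" for n
    using f'[of n] g'[of n] by (auto intro: L1_lincomb)
  have pf: "partial_fourier (f' n) \<in> L2 haar" "partial_fourier (g' n) \<in> L2 haar"
    "partial_fourier (\<lambda>p. f' n p + c * g' n p) \<in> L2 haar" for n
    using f'[of n] g'[of n] m[of n] by (auto intro: partial_fourier_L2)
  have "L2_norm haar (\<lambda>p. partial_fourier (\<lambda>p. f' n p + c * g' n p) p - (F p + c * G p))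
      = L2_norm haar (\<lambda>p. (partial_fourier (f' n) p + c * partial_fourier (g' n) p) - (F p + c * G p))" for n
  proof (rule L2_norm_cong_AE)
    show "AE p in haar. partial_fourier (\<lambda>p. f' n p + c * g' n p) p - (F p + c * G p)
        = (partial_fourier (f' n) p + c * partial_fourier (g' n) p) - (F p + c * G p)"
      using partial_fourier_lincomb[of "f' n" "g' n" c] f'[of n] g'[of n] by auto
  qed (intro L2_measurable L2_diff L2_add L2_scale pf F' G')+
  then have "(\<lambda>n. L2_norm haar (\<lambda>p. partial_fourier (\<lambda>p. f' n p + c * g' n p) p - (F p + c * G p))) \<longlonglongrightarrow> 0"
    using lim[OF pf(1) F' pf(2) G' l2 k2] by simp
  moreover have "(\<lambda>n. L2_norm haar (\<lambda>p. (f' n p + c * g' n p) - (f p + c * g p))) \<longlonglongrightarrow> 0"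
    using f' g' by (intro lim f g l1 k1) auto
  ultimately show ?thesis
    unfolding partial_fourier_lim_def
    by (intro conjI exI[of _ "\<lambda>n p. f' n p + c * g' n p"] allI m L2_add L2_scale F' G')
qed

text \<open>By linearity F - G is a value of the extension at f - f = 0, and contractivity gives it
  norm 0.\<close>

lemma partial_fourier_lim_unique:
  assumes f: "f \<in> L2 haar" and F: "partial_fourier_lim f F" and G: "partial_fourier_lim f G"
  shows "AE p in haar. F p = G p"
proof -
  have d: "(\<lambda>p. F p + (-1) * G p) \<in> L2 haar"
    using partial_fourier_lim_L2[OF F] partial_fourier_lim_L2[OF G] by auto
  have "L2_norm haar (\<lambda>p. F p + (-1) * G p) \<le> L2_norm haar (\<lambda>p. f p + (-1) * f p)"
    using f by (intro partial_fourier_lim_norm partial_fourier_lim_lincomb F G) auto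
  also have "\<dots> = 0" by (simp add: L2_norm_eq)
  finally have "L2_norm haar (\<lambda>p. F p + (-1) * G p) = 0"
    using L2_norm_nonneg by (rule antisym)
  then show ?thesis unfolding L2_norm_eq_0_iff[OF d] by simp
qed

section \<open>The Fourier transform on the group\<close>

text \<open>The explicit model of the Fourier transform, with F the partial transform of f. The
  operator D is hidden in the lift, which is defined for every vector, so no domain restriction
  remains.\<close>

definition fourier_op :: "(pgroup \<Rightarrow> complex) \<Rightarrow> plane operator" where
  "fourier_op F \<phi> x = (\<integral>h. F (x, h) * fiber_lift x \<phi> h \<partial>fiber_measure)"

lemma measurable_cone_fiber:
  assumes "f \<in> measurable haar N"
  shows "f \<in> measurable (cone_measure i j \<Otimes>\<^sub>M fiber_measure) N"
proof -
  have "(\<lambda>x. x) \<in> measurable (cone_measure i j) lborel"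
    unfolding cone_measure_def by (rule measurable_restrict_space1) simp
  then have "(\<lambda>p. (fst p, snd p)) \<in> measurable (cone_measure i j \<Otimes>\<^sub>M fiber_measure) haar"
    unfolding haar_eq by (intro measurable_Pair measurable_compose[OF measurable_fst] measurable_snd)
  from measurable_compose[OF this assms] show ?thesis by simp
qed

lemma measurable_cone_fiber_orbit:
  "(\<lambda>p. fst (snd p) *\<^sub>R Lambda (- snd (snd p)) (fst p))
    \<in> measurable (cone_measure i j \<Otimes>\<^sub>M fiber_measure) (cone_measure i j)"
proof -
  have [measurable]: "fst \<in> borel_measurable (cone_measure i j \<Otimes>\<^sub>M fiber_measure)"
    by (rule measurable_compose[OF measurable_fst measurable_into_cone_measure[of "\<lambda>x. x"]]) simp
  have [measurable]: "(\<lambda>p. fst (snd p)) \<in> borel_measurable (cone_measure i j \<Otimes>\<^sub>M fiber_measure)"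
    "(\<lambda>p. snd (snd p)) \<in> borel_measurable (cone_measure i j \<Otimes>\<^sub>M fiber_measure)"
    by (intro measurable_compose[OF measurable_snd] fst_fiber snd_fiber)+
  have "(\<lambda>p. fst (snd p) *\<^sub>R Lambda (- snd (snd p)) (fst p))
    \<in> measurable (cone_measure i j \<Otimes>\<^sub>M fiber_measure) (restrict_space lborel (cone i j))"
  proof (rule measurable_restrict_space2)
    show "(\<lambda>p. fst (snd p) *\<^sub>R Lambda (- snd (snd p)) (fst p))
        \<in> space (cone_measure i j \<Otimes>\<^sub>M fiber_measure) \<rightarrow> cone i j"
      by (auto simp: space_pair_measure halfplane_def orbit_in_cone)
  qed measurable
  then show ?thesis by (simp add: cone_measure_def)
qed

lemma fiber_lift_measurable2:
  assumes \<phi>: "\<phi> \<in> borel_measurable (cone_measure i j)"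
  shows "(\<lambda>p. fiber_lift (fst p) \<phi> (snd p)) \<in> borel_measurable (cone_measure i j \<Otimes>\<^sub>M fiber_measure)"
proof -
  have [measurable]: "(\<lambda>x. minkowski x x) \<in> borel_measurable (cone_measure i j)"
    by (rule measurable_into_cone_measure) measurable
  have [measurable]: "(\<lambda>p. \<phi> (fst (snd p) *\<^sub>R Lambda (- snd (snd p)) (fst p)))
      \<in> borel_measurable (cone_measure i j \<Otimes>\<^sub>M fiber_measure)"
    by (rule measurable_compose[OF measurable_cone_fiber_orbit \<phi>])
  show ?thesis unfolding fiber_lift_def by measurable
qed

lemma fourier_op_measurable:
  assumes F: "F \<in> borel_measurable haar" and \<phi>: "\<phi> \<in> borel_measurable (cone_measure i j)"
  shows "fourier_op F \<phi> \<in> borel_measurable (cone_measure i j)"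
proof -
  have "(\<lambda>p. F (fst p, snd p) * fiber_lift (fst p) \<phi> (snd p))
      \<in> borel_measurable (cone_measure i j \<Otimes>\<^sub>M fiber_measure)"
    using measurable_cone_fiber[OF F] fiber_lift_measurable2[OF \<phi>] by simp
  then show ?thesis unfolding fourier_op_def
    by (intro fiber.borel_measurable_lebesgue_integral) (simp add: case_prod_beta')
qed

definition slice_sq :: "(pgroup \<Rightarrow> complex) \<Rightarrow> plane \<Rightarrow> ennreal" where
  "slice_sq F x = (\<integral>\<^sup>+h. ennreal ((cmod (F (x, h)))\<^sup>2) \<partial>fiber_measure)"

lemma slice_sq_integral:
  assumes F: "F \<in> L2 haar"
  shows "(\<integral>\<^sup>+x. slice_sq F x \<partial>cone_measure i j) \<le> ennreal ((L2_norm haar F)\<^sup>2)"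
    and "AE x in cone_measure i j. (\<lambda>h. F (x, h)) \<in> L2 fiber_measure"
    and "slice_sq F \<in> borel_measurable (cone_measure i j)"
proof -
  have F': "F \<in> borel_measurable haar" using F by (simp add: L2_iff)
  have m: "(\<lambda>p. ennreal ((cmod (F p))\<^sup>2)) \<in> borel_measurable (lborel \<Otimes>\<^sub>M fiber_measure)"
    using F' unfolding haar_eq by measurable
  have ms: "slice_sq F \<in> borel_measurable borel"
    unfolding slice_sq_def using fiber.borel_measurable_nn_integral_fst[OF m] by simp
  then show "slice_sq F \<in> borel_measurable (cone_measure i j)" by (rule measurable_into_cone_measure)
  have total: "(\<integral>\<^sup>+x. slice_sq F x \<partial>lborel) = ennreal ((L2_norm haar F)\<^sup>2)"
    unfolding slice_sq_def fiber.nn_integral_fst[OF m] L2_nn_integral[OF F, symmetric] by (simp add: haar_eq)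
  show "(\<integral>\<^sup>+x. slice_sq F x \<partial>cone_measure i j) \<le> ennreal ((L2_norm haar F)\<^sup>2)"
    unfolding nn_integral_cone total[symmetric]
    by (intro nn_integral_mono) (auto simp: indicator_def)
  have "AE x in lborel. slice_sq F x \<noteq> \<infinity>"
    using total ms by (intro nn_integral_noteq_infinite) auto
  then have "AE x in lborel. (\<lambda>h. F (x, h)) \<in> L2 fiber_measure"
  proof eventually_elim
    fix x assume fin: "slice_sq F x \<noteq> \<infinity>"
    then have "slice_sq F x = ennreal ((sqrt (enn2real (slice_sq F x)))\<^sup>2)"
      by (simp add: less_top[symmetric])
    then show "(\<lambda>h. F (x, h)) \<in> L2 fiber_measure"
      using haar_slice_measurable(2)[OF F', of x]
      by (intro L2_nn_integralI(1)[where c = "sqrt (enn2real (slice_sq F x))"])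
        (auto simp: slice_sq_def)
  qed
  then show "AE x in cone_measure i j. (\<lambda>h. F (x, h)) \<in> L2 fiber_measure"
    unfolding cone_measure_def by (subst AE_restrict_space_iff) (auto elim: eventually_mono)
qed

text \<open>The conjugates cancel, so the value at x is an inner product in the fiber;
  Cauchy-Schwarz and Bessel become estimates at each point x.\<close>

lemma fourier_op_inner:
  "fourier_op F \<phi> x = L2_inner fiber_measure (fiber_lift x \<phi>) (\<lambda>h. cnj (F (x, h)))"
  by (simp add: fourier_op_def L2_inner_def mult.commute)

lemma L2_norm_cnj: "L2_norm M (\<lambda>x. cnj (f x)) = L2_norm M f"
  by (simp add: L2_norm_eq)

lemma slice_sq_eq: "(\<lambda>h. F (x, h)) \<in> L2 fiber_measure \<Longrightarrow>
    slice_sq F x = ennreal ((L2_norm fiber_measure (\<lambda>h. F (x, h)))\<^sup>2)"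
  unfolding slice_sq_def by (rule L2_nn_integral)

text \<open>Cauchy-Schwarz at almost every x bounds the squared value by the squared norm of phi
  times that of the slice F(x, .), and the slices integrate to at most the squared norm of
  F.\<close>

lemma fourier_op_L2:
  assumes F: "F \<in> L2 haar" and \<phi>: "\<phi> \<in> L2 (cone_measure i j)"
  shows "fourier_op F \<phi> \<in> L2 (cone_measure i j)"
    and "L2_norm (cone_measure i j) (fourier_op F \<phi>) \<le> L2_norm haar F * L2_norm (cone_measure i j) \<phi>"
proof -
  let ?C = "cone_measure i j"
  have le: "AE x in ?C. ennreal ((cmod (fourier_op F \<phi> x))\<^sup>2) \<le> ennreal ((L2_norm ?C \<phi>)\<^sup>2) * slice_sq F x"
    using slice_sq_integral(2)[OF F, of i j] AE_space
  proof eventually_elim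
    fix x assume x: "x \<in> space ?C" and Fx: "(\<lambda>h. F (x, h)) \<in> L2 fiber_measure"
    then have x: "x \<in> cone i j" by simp
    have "cmod (fourier_op F \<phi> x) \<le> L2_norm ?C \<phi> * L2_norm fiber_measure (\<lambda>h. F (x, h))"
      using L2_Cauchy_Schwarz[OF fiber_lift_L2(1)[OF x \<phi>] L2_cnj[OF Fx]]
      unfolding fourier_op_inner by (simp add: fiber_lift_L2(2)[OF x \<phi>] L2_norm_cnj)
    then have "(cmod (fourier_op F \<phi> x))\<^sup>2 \<le> (L2_norm ?C \<phi> * L2_norm fiber_measure (\<lambda>h. F (x, h)))\<^sup>2"
      by (rule power_mono) simp
    then show "ennreal ((cmod (fourier_op F \<phi> x))\<^sup>2) \<le> ennreal ((L2_norm ?C \<phi>)\<^sup>2) * slice_sq F x"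
      unfolding slice_sq_eq[OF Fx] by (simp add: ennreal_mult[symmetric] power_mult_distrib ennreal_leI)
  qed
  have "(\<integral>\<^sup>+x. ennreal ((cmod (fourier_op F \<phi> x))\<^sup>2) \<partial>?C)
      \<le> (\<integral>\<^sup>+x. ennreal ((L2_norm ?C \<phi>)\<^sup>2) * slice_sq F x \<partial>?C)"
    by (rule nn_integral_mono_AE[OF le])
  also have "\<dots> = ennreal ((L2_norm ?C \<phi>)\<^sup>2) * (\<integral>\<^sup>+x. slice_sq F x \<partial>?C)"
    by (rule nn_integral_cmult[OF slice_sq_integral(3)[OF F]])
  also have "\<dots> \<le> ennreal ((L2_norm ?C \<phi>)\<^sup>2) * ennreal ((L2_norm haar F)\<^sup>2)"
    by (intro mult_left_mono slice_sq_integral(1)[OF F]) simp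
  also have "\<dots> = ennreal ((L2_norm haar F * L2_norm ?C \<phi>)\<^sup>2)"
    by (simp add: ennreal_mult[symmetric] power_mult_distrib mult.commute)
  finally have *: "(\<integral>\<^sup>+x. ennreal ((cmod (fourier_op F \<phi> x))\<^sup>2) \<partial>?C)
      \<le> ennreal ((L2_norm haar F * L2_norm ?C \<phi>)\<^sup>2)" .
  have m: "fourier_op F \<phi> \<in> borel_measurable ?C"
    by (rule fourier_op_measurable[OF L2_measurable[OF F] L2_measurable[OF \<phi>]])
  from L2_nn_integralI[OF m *]
  show "fourier_op F \<phi> \<in> L2 ?C" "L2_norm ?C (fourier_op F \<phi>) \<le> L2_norm haar F * L2_norm ?C \<phi>"
    by simp_all
qed

lemma fourier_op_hs_sum:
  assumes F: "F \<in> L2 haar" and e: "orthonormal_basis (cone_measure i j) e"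
  shows "hs_sum (cone_measure i j) (fourier_op F) e \<le> ennreal ((L2_norm haar F)\<^sup>2)"
  unfolding hs_sum_def
proof (rule suminf_le_const)
  let ?C = "cone_measure i j"
  note eL = onb_L2[OF e]
  fix n
  have [measurable]: "fourier_op F (e k) \<in> borel_measurable ?C" for k
    by (rule fourier_op_measurable[OF L2_measurable[OF F] L2_measurable[OF eL]])
  have le: "AE x in ?C. (\<Sum>k<n. ennreal ((cmod (fourier_op F (e k) x))\<^sup>2)) \<le> slice_sq F x"
    using slice_sq_integral(2)[OF F, of i j] AE_space
  proof eventually_elim
    fix x assume x: "x \<in> space ?C" and Fx: "(\<lambda>h. F (x, h)) \<in> L2 fiber_measure"
    then have x: "x \<in> cone i j" by simp
    \<comment> \<open>The lifts of the basis vectors are orthonormal in the fiber, so the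
      coefficients of the conjugated slice obey Bessel's inequality.\<close>
    have "(\<Sum>k<n. (cmod (fourier_op F (e k) x))\<^sup>2)
        = (\<Sum>k<n. (cmod (L2_inner fiber_measure (\<lambda>h. cnj (F (x, h))) (fiber_lift x (e k))))\<^sup>2)"
      unfolding fourier_op_inner by (subst L2_inner_commute) simp
    also have "\<dots> \<le> (L2_norm fiber_measure (\<lambda>h. cnj (F (x, h))))\<^sup>2"
      by (rule Bessel_ineq)
        (simp_all add: fiber_lift_L2(1)[OF x eL] fiber_lift_L2(3)[OF x eL eL] onb_inner[OF e] L2_cnj[OF Fx])
    finally show "(\<Sum>k<n. ennreal ((cmod (fourier_op F (e k) x))\<^sup>2)) \<le> slice_sq F x"
      unfolding slice_sq_eq[OF Fx] L2_norm_cnj by (simp add: sum_ennreal ennreal_leI)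
  qed
  have "(\<Sum>k<n. ennreal ((L2_norm ?C (fourier_op F (e k)))\<^sup>2))
      = (\<integral>\<^sup>+x. (\<Sum>k<n. ennreal ((cmod (fourier_op F (e k) x))\<^sup>2)) \<partial>?C)"
    by (subst nn_integral_sum) (simp_all add: L2_nn_integral[OF fourier_op_L2(1)[OF F eL]])
  also have "\<dots> \<le> (\<integral>\<^sup>+x. slice_sq F x \<partial>?C)" by (rule nn_integral_mono_AE[OF le])
  also have "\<dots> \<le> ennreal ((L2_norm haar F)\<^sup>2)" by (rule slice_sq_integral(1)[OF F])
  finally show "(\<Sum>k<n. ennreal ((L2_norm ?C (fourier_op F (e k)))\<^sup>2)) \<le> ennreal ((L2_norm haar F)\<^sup>2)" .
qed simp

lemma fourier_op_lincomb:
  assumes F: "F \<in> L2 haar" and G: "G \<in> L2 haar" and \<phi>: "\<phi> \<in> L2 (cone_measure i j)"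
  shows "AE x in cone_measure i j.
    fourier_op (\<lambda>p. F p + c * G p) \<phi> x = fourier_op F \<phi> x + c * fourier_op G \<phi> x"
  using slice_sq_integral(2)[OF F, of i j] slice_sq_integral(2)[OF G, of i j] AE_space
proof eventually_elim
  fix x assume x: "x \<in> space (cone_measure i j)"
    and Fx: "(\<lambda>h. F (x, h)) \<in> L2 fiber_measure" and Gx: "(\<lambda>h. G (x, h)) \<in> L2 fiber_measure"
  then have x: "x \<in> cone i j" by simp
  note l = fiber_lift_L2(1)[OF x \<phi>]
  have "fourier_op (\<lambda>p. F p + c * G p) \<phi> x
      = (\<integral>h. F (x, h) * fiber_lift x \<phi> h + c * (G (x, h) * fiber_lift x \<phi> h) \<partial>fiber_measure)"
    unfolding fourier_op_def by (simp add: algebra_simps)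
  also have "\<dots> = fourier_op F \<phi> x + c * fourier_op G \<phi> x"
    unfolding fourier_op_def
    by (subst Bochner_Integration.integral_add)
      (simp_all only: L2_mult_integrable[OF Fx l] L2_mult_integrable[OF Gx l]
        integrable_mult_right integral_mult_right_zero)
  finally show "fourier_op (\<lambda>p. F p + c * G p) \<phi> x = fourier_op F \<phi> x + c * fourier_op G \<phi> x" .
qed

lemma fourier_op_L2_op:
  assumes F: "F \<in> L2 haar"
  shows "L2_op (cone_measure i j) (fourier_op F)"
proof (rule L2_opI)
  let ?C = "cone_measure i j"
  fix \<phi> assume \<phi>: "\<phi> \<in> L2 ?C"
  show "fourier_op F \<phi> \<in> L2 ?C" "L2_norm ?C (fourier_op F \<phi>) \<le> L2_norm haar F * L2_norm ?C \<phi>"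
    by (rule fourier_op_L2[OF F \<phi>])+
  have "fourier_op F (\<lambda>y. c * \<phi> y) x = c * fourier_op F \<phi> x" for c x
  proof -
    have "F (x, h) * fiber_lift x (\<lambda>y. c * \<phi> y) h = c * (F (x, h) * fiber_lift x \<phi> h)" for h
      by (simp add: fiber_lift_def mult_ac)
    then show ?thesis by (simp only: fourier_op_def integral_mult_right_zero)
  qed
  then show "AE x in ?C. fourier_op F (\<lambda>y. c * \<phi> y) x = c * fourier_op F \<phi> x" for c by simp
  fix \<psi> assume \<psi>: "\<psi> \<in> L2 ?C"
  show "AE x in ?C. fourier_op F (\<lambda>y. \<phi> y + \<psi> y) x = fourier_op F \<phi> x + fourier_op F \<psi> x"
    using slice_sq_integral(2)[OF F, of i j] AE_space
  proof eventually_elim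
    fix x assume x: "x \<in> space ?C" and Fx: "(\<lambda>h. F (x, h)) \<in> L2 fiber_measure"
    then have x: "x \<in> cone i j" by simp
    have "fourier_op F (\<lambda>y. \<phi> y + \<psi> y) x
        = (\<integral>h. F (x, h) * fiber_lift x \<phi> h + F (x, h) * fiber_lift x \<psi> h \<partial>fiber_measure)"
      unfolding fourier_op_def by (simp add: fiber_lift_def algebra_simps)
    also have "\<dots> = fourier_op F \<phi> x + fourier_op F \<psi> x"
      unfolding fourier_op_def
      by (intro Bochner_Integration.integral_add L2_mult_integrable[OF Fx] fiber_lift_L2(1)[OF x] \<phi> \<psi>)
    finally show "fourier_op F (\<lambda>y. \<phi> y + \<psi> y) x = fourier_op F \<phi> x + fourier_op F \<psi> x" .
  qed
qed

text \<open>By linearity in the kernel the difference comes from a kernel of norm 0, which the norm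
  bound turns into a vector of norm 0.\<close>

lemma fourier_op_cong:
  assumes F: "F \<in> L2 haar" and G: "G \<in> L2 haar" and eq: "AE p in haar. F p = G p"
    and \<phi>: "\<phi> \<in> L2 (cone_measure i j)"
  shows "AE x in cone_measure i j. fourier_op F \<phi> x = fourier_op G \<phi> x"
proof -
  have d: "(\<lambda>p. F p + (-1) * G p) \<in> L2 haar" by (intro L2_add L2_scale F G)
  have "L2_norm haar (\<lambda>p. F p + (-1) * G p) = 0"
    unfolding L2_norm_eq_0_iff[OF d] using eq by eventually_elim simp
  then have "L2_norm (cone_measure i j) (fourier_op (\<lambda>p. F p + (-1) * G p) \<phi>) \<le> 0"
    using fourier_op_L2(2)[OF d \<phi>] by simp
  then have "L2_norm (cone_measure i j) (fourier_op (\<lambda>p. F p + (-1) * G p) \<phi>) = 0"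
    using L2_norm_nonneg by (rule antisym)
  then have "AE x in cone_measure i j. fourier_op (\<lambda>p. F p + (-1) * G p) \<phi> x = 0"
    unfolding L2_norm_eq_0_iff[OF fourier_op_L2(1)[OF d \<phi>]] .
  with fourier_op_lincomb[OF F G \<phi>, of "-1"] show ?thesis
    by eventually_elim simp
qed

subsection \<open>The integral formula on $L^1 \cap L^2$\<close>

lemma rep_eq: "rep g \<phi> x = complex_of_real (fst (snd g)) * iexp (minkowski x (fst g))
    * \<phi> (fst (snd g) *\<^sub>R Lambda (- snd (snd g)) x)"
  by (cases g) simp

lemma rep_measurable2:
  assumes \<phi>: "\<phi> \<in> borel_measurable (cone_measure i j)"
  shows "(\<lambda>p. rep (snd p) \<phi> (fst p)) \<in> borel_measurable (cone_measure i j \<Otimes>\<^sub>M haar)"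
proof -
  have mx [measurable]: "(\<lambda>p. fst p) \<in> borel_measurable (cone_measure i j \<Otimes>\<^sub>M haar)"
    by (rule measurable_compose[OF measurable_fst measurable_into_cone_measure[of "\<lambda>x. x"]]) simp
  have id: "(\<lambda>x. x) \<in> borel_measurable haar"
    using measurable_restrict_space1[of "\<lambda>x. x" borel borel poincare]
    by (simp cong: measurable_cong_sets[OF sets_haar refl])
  have b [measurable]: "(\<lambda>p. fst (snd p)) \<in> borel_measurable (cone_measure i j \<Otimes>\<^sub>M haar)"
    by (rule measurable_compose[OF measurable_compose[OF measurable_snd id] fst_borel])
  have h: "snd \<in> measurable haar fiber_measure" unfolding haar_eq by (rule measurable_snd)
  have ha [measurable]: "(\<lambda>p. fst (snd (snd p))) \<in> borel_measurable (cone_measure i j \<Otimes>\<^sub>M haar)"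
    by (rule measurable_compose[OF measurable_compose[OF measurable_snd h] fst_fiber])
  have "(\<lambda>p. (fst p, snd (snd p))) \<in> measurable (cone_measure i j \<Otimes>\<^sub>M haar) (cone_measure i j \<Otimes>\<^sub>M fiber_measure)"
    by (intro measurable_Pair measurable_fst measurable_compose[OF measurable_snd h])
  from measurable_compose[OF measurable_compose[OF this measurable_cone_fiber_orbit] \<phi>]
  have [measurable]: "(\<lambda>p. \<phi> (fst (snd (snd p)) *\<^sub>R Lambda (- snd (snd (snd p))) (fst p)))
      \<in> borel_measurable (cone_measure i j \<Otimes>\<^sub>M haar)" by simp
  show ?thesis unfolding rep_eq by measurable
qed

text \<open>Fubini is applied to |f| |rep g psi|^2, where unitarity makes the norm of rep g psi
  independent of g; the inequality s t <= s + s t^2 then returns to the first power, using that f is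
  integrable.\<close>

lemma rep_integrable_AE:
  assumes f: "f \<in> Lp 1 haar" and \<psi>: "\<psi> \<in> L2 (cone_measure i j)"
  shows "AE x in cone_measure i j. integrable haar (\<lambda>g. f g * rep g \<psi> x)"
proof -
  let ?C = "cone_measure i j"
  interpret CH: pair_sigma_finite ?C haar
    by (simp add: pair_sigma_finite_def sigma_finite_cone sigma_finite_haar)
  have fm [measurable]: "f \<in> borel_measurable haar" and fi: "integrable haar f"
    using f by (simp_all add: L1_iff)
  have r [measurable]: "(\<lambda>p. rep (snd p) \<psi> (fst p)) \<in> borel_measurable (?C \<Otimes>\<^sub>M haar)"
    by (rule rep_measurable2[OF L2_measurable[OF \<psi>]])
  have k: "(\<lambda>(x, g). ennreal (cmod (f g)) * ennreal ((cmod (rep g \<psi> x))\<^sup>2)) \<in> borel_measurable (?C \<Otimes>\<^sub>M haar)"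
    unfolding case_prod_beta' by measurable
  have "(\<integral>\<^sup>+x. \<integral>\<^sup>+g. ennreal (cmod (f g)) * ennreal ((cmod (rep g \<psi> x))\<^sup>2) \<partial>haar \<partial>?C)
      = (\<integral>\<^sup>+g. \<integral>\<^sup>+x. ennreal (cmod (f g)) * ennreal ((cmod (rep g \<psi> x))\<^sup>2) \<partial>?C \<partial>haar)"
    by (rule CH.Fubini'[OF k, symmetric])
  also have "\<dots> = (\<integral>\<^sup>+g. ennreal (cmod (f g)) * ennreal ((L2_norm ?C \<psi>)\<^sup>2) \<partial>haar)"
  proof (rule nn_integral_cong)
    fix g assume "g \<in> space haar"
    then have g: "g \<in> poincare" by simp
    note rg = rep_L2[OF g \<psi>]
    have "(\<lambda>x. ennreal ((cmod (rep g \<psi> x))\<^sup>2)) \<in> borel_measurable ?C"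
      using L2_measurable[OF rg(1)] by measurable
    then show "(\<integral>\<^sup>+x. ennreal (cmod (f g)) * ennreal ((cmod (rep g \<psi> x))\<^sup>2) \<partial>?C)
        = ennreal (cmod (f g)) * ennreal ((L2_norm ?C \<psi>)\<^sup>2)"
      by (subst nn_integral_cmult) (simp_all add: L2_nn_integral[OF rg(1)] rg(2))
  qed
  also have "\<dots> = (\<integral>\<^sup>+g. ennreal (cmod (f g)) \<partial>haar) * ennreal ((L2_norm ?C \<psi>)\<^sup>2)"
    by (rule nn_integral_multc) measurable
  also have "\<dots> < \<infinity>"
    using fi by (simp add: ennreal_mult_less_top integrable_iff_bounded)
  finally have "(\<integral>\<^sup>+x. \<integral>\<^sup>+g. ennreal (cmod (f g)) * ennreal ((cmod (rep g \<psi> x))\<^sup>2) \<partial>haar \<partial>?C) \<noteq> \<infinity>"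
    by simp
  then have "AE x in ?C. (\<integral>\<^sup>+g. ennreal (cmod (f g)) * ennreal ((cmod (rep g \<psi> x))\<^sup>2) \<partial>haar) \<noteq> \<infinity>"
    by (intro nn_integral_noteq_infinite CH.M2.borel_measurable_nn_integral k)
  then show ?thesis
    using AE_space
  proof eventually_elim
    fix x assume x: "x \<in> space ?C"
      and fin: "(\<integral>\<^sup>+g. ennreal (cmod (f g)) * ennreal ((cmod (rep g \<psi> x))\<^sup>2) \<partial>haar) \<noteq> \<infinity>"
    have [measurable]: "(\<lambda>g. rep g \<psi> x) \<in> borel_measurable haar"
      using measurable_compose[OF measurable_Pair1'[OF x] r] by simp
    have "integrable haar (\<lambda>g. cmod (f g) * (cmod (rep g \<psi> x))\<^sup>2)"
      using fin by (intro integrableI_nonneg) (auto simp: ennreal_mult less_top)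
    then have "integrable haar (\<lambda>g. cmod (f g) + cmod (f g) * (cmod (rep g \<psi> x))\<^sup>2)"
      using fi by (intro Bochner_Integration.integrable_add) auto
    then show "integrable haar (\<lambda>g. f g * rep g \<psi> x)"
    proof (rule Bochner_Integration.integrable_bound)
      have "s * t \<le> s + s * t\<^sup>2" if "0 \<le> s" for s t :: real
        using mult_left_mono[OF mult_le_sum_squares[of 1 t] that] by (simp add: distrib_left)
      then show "AE g in haar. norm (f g * rep g \<psi> x)
          \<le> norm (cmod (f g) + cmod (f g) * (cmod (rep g \<psi> x))\<^sup>2)"
        by (simp add: norm_mult)
    qed measurable
  qed
qed

text \<open>Absolute convergence permits integrating b first, and since b occurs only in f and the
  character this produces the partial Fourier transform as kernel.\<close>

lemma fourier_formula:
  assumes f: "f \<in> Lp 1 haar" and \<phi>: "\<phi> \<in> duflo_moore_dom i j"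
  shows "AE x in cone_measure i j.
    fourier_op (partial_fourier f) \<phi> x = (\<integral>g. f g * rep g (duflo_moore \<phi>) x \<partial>haar)"
proof -
  have "duflo_moore \<phi> \<in> L2 (cone_measure i j)" using \<phi> by (simp add: duflo_moore_dom_def)
  from rep_integrable_AE[OF f this] show ?thesis
  proof eventually_elim
    fix x assume i: "integrable haar (\<lambda>g. f g * rep g (duflo_moore \<phi>) x)"
    then have "integrable (lborel \<Otimes>\<^sub>M fiber_measure) (case_prod (\<lambda>b h. f (b, h) * rep (b, h) (duflo_moore \<phi>) x))"
      by (simp add: haar_eq case_prod_unfold)
    from haar.integral_snd[OF this]
    have "(\<integral>g. f g * rep g (duflo_moore \<phi>) x \<partial>haar)
        = (\<integral>h. \<integral>b. f (b, h) * rep (b, h) (duflo_moore \<phi>) x \<partial>lborel \<partial>fiber_measure)"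
      by (simp add: haar_eq case_prod_unfold)
    also have "\<dots> = fourier_op (partial_fourier f) \<phi> x"
      unfolding fourier_op_def
    proof (rule Bochner_Integration.integral_cong[OF refl])
      fix h assume "h \<in> space fiber_measure"
      then have h: "0 < fst h" by (auto simp: halfplane_def)
      have "(\<integral>b. f (b, h) * rep (b, h) (duflo_moore \<phi>) x \<partial>lborel)
          = (\<integral>b. complex_of_real (1 / (2 * pi)) * (f (b, h) * iexp (minkowski x b)) * fiber_lift x \<phi> h \<partial>lborel)"
        unfolding rep_duflo_moore[OF h] by (simp only: mult_ac)
      also have "\<dots> = partial_fourier f (x, h) * fiber_lift x \<phi> h"
        unfolding partial_fourier_def by simp
      finally show "(\<integral>b. f (b, h) * rep (b, h) (duflo_moore \<phi>) x \<partial>lborel)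
          = partial_fourier f (x, h) * fiber_lift x \<phi> h" .
    qed
    finally show "fourier_op (partial_fourier f) \<phi> x = (\<integral>g. f g * rep g (duflo_moore \<phi>) x \<partial>haar)" ..
  qed
qed

text \<open>D multiplies by a function bounded on the cutoff set, so cutoffs lie in its domain; they
  converge to the original vector, which gives density of the domain.\<close>

definition cutoff :: "nat \<Rightarrow> (plane \<Rightarrow> complex) \<Rightarrow> plane \<Rightarrow> complex" where
  "cutoff n \<phi> x = indicator {x. \<bar>minkowski x x\<bar> \<le> real n} x * \<phi> x"

lemma cutoff_L2:
  assumes \<phi>: "\<phi> \<in> L2 (cone_measure i j)"
  shows "cutoff n \<phi> \<in> L2 (cone_measure i j)"
    and "duflo_moore (cutoff n \<phi>) \<in> L2 (cone_measure i j)"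
    and "(\<lambda>n. L2_norm (cone_measure i j) (\<lambda>x. cutoff n \<phi> x - \<phi> x)) \<longlonglongrightarrow> 0"
proof -
  let ?C = "cone_measure i j" and ?S = "\<lambda>n. {x \<in> cone i j. \<bar>minkowski x x\<bar> \<le> real n}"
  have mm [measurable]: "(\<lambda>x. minkowski x x) \<in> borel_measurable ?C"
    by (rule measurable_into_cone_measure) measurable
  have S: "?S n \<in> sets ?C" for n
  proof -
    have "{x \<in> space ?C. \<bar>minkowski x x\<bar> \<le> real n} \<in> sets ?C" by measurable
    then show ?thesis by simp
  qed
  have ev: "eventually (\<lambda>n. x \<in> ?S n) sequentially" if "x \<in> space ?C" for x
  proof -
    obtain n where "\<bar>minkowski x x\<bar> \<le> real n" using real_arch_simple by blast
    then show ?thesis using that by (intro eventually_sequentiallyI[of n]) auto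
  qed
  \<comment> \<open>On the cone the cutoff set may be replaced by its intersection with the cone,
    which is measurable for the cone measure.\<close>
  have eq: "cutoff n \<phi> x = indicator (?S n) x * \<phi> x" if "x \<in> space ?C" for x n
    using that by (simp add: cutoff_def indicator_def)
  have tr: "(\<lambda>x. indicator (?S n) x * \<phi> x) \<in> L2 ?C"
    "(\<lambda>n. L2_norm ?C (\<lambda>x. indicator (?S n) x * \<phi> x - \<phi> x)) \<longlonglongrightarrow> 0" for n
    by (rule L2_truncate[OF \<phi> S], erule ev)+
  have m: "cutoff n \<phi> \<in> borel_measurable ?C" for n
  proof -
    have "cutoff n \<phi> \<in> borel_measurable ?C
        \<longleftrightarrow> (\<lambda>x. indicator (?S n) x * \<phi> x) \<in> borel_measurable ?C"
      by (rule measurable_cong) (rule eq)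
    then show ?thesis using L2_measurable[OF tr(1)] by blast
  qed
  show L: "cutoff n \<phi> \<in> L2 ?C" for n
    by (rule L2_cong_AE[OF tr(1) m]) (auto intro!: AE_I2 simp: eq)
  have "L2_norm ?C (\<lambda>x. cutoff n \<phi> x - \<phi> x) = L2_norm ?C (\<lambda>x. indicator (?S n) x * \<phi> x - \<phi> x)" for n
    by (rule L2_norm_cong_AE[OF L2_measurable[OF L2_diff[OF L \<phi>]] L2_measurable[OF L2_diff[OF tr(1) \<phi>]]])
      (auto intro!: AE_I2 simp: eq)
  then show "(\<lambda>n. L2_norm ?C (\<lambda>x. cutoff n \<phi> x - \<phi> x)) \<longlonglongrightarrow> 0" using tr(2) by simp
  have "integrable ?C (\<lambda>x. real n * (cmod (\<phi> x))\<^sup>2)" using \<phi> by (simp add: L2_iff)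
  then have "integrable ?C (\<lambda>x. (cmod (duflo_moore (cutoff n \<phi>) x))\<^sup>2)"
  proof (rule Bochner_Integration.integrable_bound)
    show "(\<lambda>x. (cmod (duflo_moore (cutoff n \<phi>) x))\<^sup>2) \<in> borel_measurable ?C"
      unfolding duflo_moore_def using m[of n] by measurable
    have "(cmod (duflo_moore (cutoff n \<phi>) x))\<^sup>2 \<le> real n * (cmod (\<phi> x))\<^sup>2" for x
    proof (cases "\<bar>minkowski x x\<bar> \<le> real n")
      case True
      have "1 \<le> (2 * pi)\<^sup>2" using pi_gt3 by (intro one_le_power) simp
      then have "\<bar>minkowski x x\<bar> / (2 * pi)\<^sup>2 \<le> \<bar>minkowski x x\<bar> / 1"
        by (intro divide_left_mono) auto
      with True have "\<bar>minkowski x x\<bar> / (2 * pi)\<^sup>2 \<le> real n" by simp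
      then have "\<bar>minkowski x x\<bar> / (2 * pi)\<^sup>2 * (cmod (\<phi> x))\<^sup>2 \<le> real n * (cmod (\<phi> x))\<^sup>2"
        by (rule mult_right_mono) simp
      with True show ?thesis
        by (simp add: duflo_moore_def cutoff_def norm_mult norm_divide power_mult_distrib power_divide)
    qed (simp add: duflo_moore_def cutoff_def)
    then show "AE x in ?C. norm ((cmod (duflo_moore (cutoff n \<phi>) x))\<^sup>2) \<le> norm (real n * (cmod (\<phi> x))\<^sup>2)"
      by simp
  qed
  then show "duflo_moore (cutoff n \<phi>) \<in> L2 ?C"
    unfolding L2_iff duflo_moore_def using m[of n] by (intro conjI) (measurable, simp)
qed

lemma cutoff_dom: "\<phi> \<in> L2 (cone_measure i j) \<Longrightarrow> cutoff n \<phi> \<in> duflo_moore_dom i j"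
  by (simp add: duflo_moore_dom_def cutoff_L2)

text \<open>The integral formula fixes \<open>A\<close> on the domain of D. Cutoffs make that domain
  dense and both operators are bounded, so agreement extends to all of L^2.\<close>

lemma is_fourier_L1_unique:
  assumes f: "f \<in> Lp 1 haar \<inter> L2 haar" and A: "is_fourier_L1 i j f A"
    and \<phi>: "\<phi> \<in> L2 (cone_measure i j)"
  shows "AE x in cone_measure i j. A \<phi> x = fourier_op (partial_fourier f) \<phi> x"
proof -
  let ?C = "cone_measure i j" and ?B = "fourier_op (partial_fourier f)"
  have Aop: "L2_op ?C A" using A by (simp add: is_fourier_L1_def hilbert_schmidt_def)
  have Bop: "L2_op ?C ?B" using f by (intro fourier_op_L2_op partial_fourier_L2) auto
  note c = cutoff_L2[OF \<phi>]
  show ?thesis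
  proof (rule L2_eqI[OF L2_op_L2[OF Aop \<phi>] L2_op_L2[OF Bop \<phi>]])
    fix h assume h: "h \<in> L2 ?C"
    have "L2_inner ?C (A (cutoff n \<phi>)) h = L2_inner ?C (?B (cutoff n \<phi>)) h" for n
    proof (rule L2_inner_cong_AE)
      have "AE x in ?C. A (cutoff n \<phi>) x = (\<integral>g. f g * rep g (duflo_moore (cutoff n \<phi>)) x \<partial>haar)"
        using A cutoff_dom[OF \<phi>] by (simp add: is_fourier_L1_def)
      with fourier_formula[OF _ cutoff_dom[OF \<phi>, of n], of f]
      show "AE x in ?C. A (cutoff n \<phi>) x = ?B (cutoff n \<phi>) x"
        using f by (auto elim: eventually_elim2)
    qed (simp_all add: L2_measurable[OF h] L2_measurable[OF L2_op_L2[OF Aop c(1)]]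
        L2_measurable[OF L2_op_L2[OF Bop c(1)]])
    moreover have "(\<lambda>n. L2_inner ?C (A (cutoff n \<phi>)) h) \<longlonglongrightarrow> L2_inner ?C (A \<phi>) h"
      by (intro L2_inner_tendsto_left L2_op_L2[OF Aop] L2_op_tendsto[OF Aop] c \<phi> h)
    moreover have "(\<lambda>n. L2_inner ?C (?B (cutoff n \<phi>)) h) \<longlonglongrightarrow> L2_inner ?C (?B \<phi>) h"
      by (intro L2_inner_tendsto_left L2_op_L2[OF Bop] L2_op_tendsto[OF Bop] c \<phi> h)
    ultimately show "L2_inner ?C (A \<phi>) h = L2_inner ?C (?B \<phi>) h"
      by (auto intro: LIMSEQ_unique)
  qed
qed

section \<open>Identification of the abstract Fourier transform with the explicit operator\<close>

lemma hilbert_schmidtI: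
  assumes "L2_op M A" "hs_sum M A (some_basis M) \<le> ennreal (c\<^sup>2)" "0 \<le> c"
  shows "hilbert_schmidt M A" "hs_norm M A \<le> c"
proof -
  have "(\<Sum>k. ennreal ((L2_norm M (A (some_basis M k)))\<^sup>2)) \<le> ennreal (c\<^sup>2)"
    using assms(2) by (simp add: hs_sum_def)
  note s = suminf_ennreal_bound[OF _ this]
  show "hilbert_schmidt M A" using s assms(1) by (simp add: hilbert_schmidt_def)
  have "hs_norm M A \<le> sqrt (c\<^sup>2)" unfolding hs_norm_def using s(2) by (intro real_sqrt_le_mono) simp
  then show "hs_norm M A \<le> c" using assms(3) by simp
qed

text \<open>Existence for the choice in \<open>fourier\<close>: the Hilbert-Schmidt distance between
  explicit operators is at most the L^2 distance of their kernels, so convergence of the partial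
  transforms is enough.\<close>

lemma is_fourier_partial_fourier_lim:
  assumes b: "orthonormal_basis (cone_measure i j) e" and f: "f \<in> L2 haar"
    and G: "partial_fourier_lim f G"
  shows "is_fourier i j f (fourier_op G)"
proof -
  let ?C = "cone_measure i j"
  note sb = some_basis_onb[OF b]
  have hs: "hilbert_schmidt ?C (fourier_op F)" if "F \<in> L2 haar" for F
    using that by (intro hilbert_schmidtI[OF fourier_op_L2_op fourier_op_hs_sum[OF _ sb]]) auto
  obtain F where F: "\<And>n. F n \<in> Lp 1 haar \<inter> L2 haar"
    and l1: "(\<lambda>n. L2_norm haar (\<lambda>p. F n p - f p)) \<longlonglongrightarrow> 0"
    and l2: "(\<lambda>n. L2_norm haar (\<lambda>p. partial_fourier (F n) p - G p)) \<longlonglongrightarrow> 0"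
    using G unfolding partial_fourier_lim_def by blast
  note GL = partial_fourier_lim_L2[OF G]
  have FL: "partial_fourier (F n) \<in> L2 haar" for n using F by (intro partial_fourier_L2) auto
  let ?B = "\<lambda>n. fourier_op (partial_fourier (F n))"
  have B: "is_fourier_L1 i j (F n) (?B n)" for n
    unfolding is_fourier_L1_def using F[of n] hs[OF FL] fourier_formula by auto
  have hs_lim: "(\<lambda>n. hs_norm ?C (\<lambda>\<phi> x. ?B n \<phi> x - fourier_op G \<phi> x)) \<longlonglongrightarrow> 0"
  proof (rule Lim_null_comparison[OF _ l2], rule always_eventually, rule allI)
    fix n
    have d: "(\<lambda>p. partial_fourier (F n) p + (-1) * G p) \<in> L2 haar" by (intro L2_add L2_scale FL GL)
    have op: "L2_op ?C (\<lambda>\<phi> x. ?B n \<phi> x - fourier_op G \<phi> x)"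
      using L2_op_lincomb[OF fourier_op_L2_op[OF FL[of n]] fourier_op_L2_op[OF GL], of i j "-1"] by simp
    have "hs_sum ?C (\<lambda>\<phi> x. ?B n \<phi> x - fourier_op G \<phi> x) (some_basis ?C)
        = hs_sum ?C (fourier_op (\<lambda>p. partial_fourier (F n) p + (-1) * G p)) (some_basis ?C)"
      unfolding hs_sum_def
    proof (intro suminf_cong arg_cong[of _ _ "\<lambda>t. ennreal (t\<^sup>2)"] L2_norm_cong_AE)
      fix k
      note eL = onb_L2[OF sb, of k]
      show "(\<lambda>x. ?B n (some_basis ?C k) x - fourier_op G (some_basis ?C k) x) \<in> borel_measurable ?C"
        by (rule L2_measurable[OF L2_op_L2[OF op eL]])
      show "fourier_op (\<lambda>p. partial_fourier (F n) p + (-1) * G p) (some_basis ?C k) \<in> borel_measurable ?C"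
        by (rule L2_measurable[OF fourier_op_L2(1)[OF d eL]])
      show "AE x in ?C. ?B n (some_basis ?C k) x - fourier_op G (some_basis ?C k) x
          = fourier_op (\<lambda>p. partial_fourier (F n) p + (-1) * G p) (some_basis ?C k) x"
        using fourier_op_lincomb[OF FL[of n] GL eL, of "-1"] by eventually_elim simp
    qed
    also have "\<dots> \<le> ennreal ((L2_norm haar (\<lambda>p. partial_fourier (F n) p + (-1) * G p))\<^sup>2)"
      by (rule fourier_op_hs_sum[OF d sb])
    finally have hs_le: "hs_sum ?C (\<lambda>\<phi> x. ?B n \<phi> x - fourier_op G \<phi> x) (some_basis ?C)
        \<le> ennreal ((L2_norm haar (\<lambda>p. partial_fourier (F n) p + (-1) * G p))\<^sup>2)" .
    note HS = hilbert_schmidtI[OF op hs_le L2_norm_nonneg]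
    have "0 \<le> hs_norm ?C (\<lambda>\<phi> x. ?B n \<phi> x - fourier_op G \<phi> x)"
      using HS(1) by (simp add: hs_norm_def hilbert_schmidt_def suminf_nonneg)
    with HS(2) show "norm (hs_norm ?C (\<lambda>\<phi> x. ?B n \<phi> x - fourier_op G \<phi> x))
        \<le> L2_norm haar (\<lambda>p. partial_fourier (F n) p - G p)" by simp
  qed
  show ?thesis
    unfolding is_fourier_def
    by (intro conjI hs[OF GL] exI[of _ F] exI[of _ ?B] allI F B l1 hs_lim)
qed

text \<open>Uniqueness: \<open>A\<close> arrives with its own approximating sequence. On a basis
  vector it differs from the explicit operator by at most a Hilbert-Schmidt distance plus an L^2
  distance of kernels, and both tend to 0; boundedness extends the agreement from the basis.\<close>

lemma is_fourier_eq_fourier_op: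
  assumes b: "orthonormal_basis (cone_measure i j) e" and f: "f \<in> L2 haar"
    and A: "is_fourier i j f A"
    and G: "partial_fourier_lim f G" and \<phi>: "\<phi> \<in> L2 (cone_measure i j)"
  shows "AE x in cone_measure i j. A \<phi> x = fourier_op G \<phi> x"
proof -
  let ?C = "cone_measure i j" and ?e = "some_basis (cone_measure i j)"
  note sb = some_basis_onb[OF b]
  obtain F B where F: "\<And>n. F n \<in> Lp 1 haar \<inter> L2 haar"
    and B: "\<And>n. is_fourier_L1 i j (F n) (B n)"
    and l1: "(\<lambda>n. L2_norm haar (\<lambda>p. F n p - f p)) \<longlonglongrightarrow> 0"
    and l2: "(\<lambda>n. hs_norm ?C (\<lambda>\<phi> x. B n \<phi> x - A \<phi> x)) \<longlonglongrightarrow> 0"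
    using A unfolding is_fourier_def by blast
  have hA: "hilbert_schmidt ?C A" using A by (simp add: is_fourier_def)
  then have Aop: "L2_op ?C A" by (simp add: hilbert_schmidt_def)
  have hB: "hilbert_schmidt ?C (B n)" for n using B by (simp add: is_fourier_L1_def)
  then have Bop: "L2_op ?C (B n)" for n by (simp add: hilbert_schmidt_def)
  \<comment> \<open>The partial transforms of this particular sequence have a limit of their own,
    compared with \<open>G\<close> at the end by uniqueness.\<close>
  obtain G' where G': "partial_fourier_lim f G'"
    and l3: "(\<lambda>n. L2_norm haar (\<lambda>p. partial_fourier (F n) p - G' p)) \<longlonglongrightarrow> 0"
    by (rule partial_fourier_lim_approx[OF f F l1])
  note GL = partial_fourier_lim_L2[OF G] and GL' = partial_fourier_lim_L2[OF G']
  have FL: "partial_fourier (F n) \<in> L2 haar" for n using F by (intro partial_fourier_L2) auto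
  have basis: "AE x in ?C. A (?e k) x = fourier_op G' (?e k) x" for k
  proof -
    note eL = onb_L2[OF sb, of k]
    let ?P = "\<lambda>n. fourier_op (partial_fourier (F n)) (?e k)"
    note AL = L2_op_L2[OF Aop eL] and BL = L2_op_L2[OF Bop eL]
      and PL = fourier_op_L2(1)[OF FL eL] and QL = fourier_op_L2(1)[OF GL' eL]
    have bound: "L2_norm ?C (\<lambda>x. A (?e k) x - fourier_op G' (?e k) x)
      \<le> hs_norm ?C (\<lambda>\<phi> x. B n \<phi> x - A \<phi> x) + L2_norm haar (\<lambda>p. partial_fourier (F n) p - G' p)" for n
    proof -
      have "L2_norm ?C (\<lambda>x. A (?e k) x - fourier_op G' (?e k) x)
          \<le> L2_norm ?C (\<lambda>x. A (?e k) x - B n (?e k) x) + L2_norm ?C (\<lambda>x. B n (?e k) x - fourier_op G' (?e k) x)"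
        by (rule L2_dist_triangle[OF AL BL QL])
      moreover have "L2_norm ?C (\<lambda>x. A (?e k) x - B n (?e k) x) \<le> hs_norm ?C (\<lambda>\<phi> x. B n \<phi> x - A \<phi> x)"
      proof -
        \<comment> \<open>This prepares summability, which must be known before a single term is
          compared with the series inside \<open>hs_norm\<close>.\<close>
        have le: "(L2_norm ?C (\<lambda>x. B n (?e l) x - A (?e l) x))\<^sup>2
            \<le> 2 * ((L2_norm ?C (B n (?e l)))\<^sup>2 + (L2_norm ?C (A (?e l)))\<^sup>2)" for l
        proof -
          have "(L2_norm ?C (\<lambda>x. B n (?e l) x - A (?e l) x))\<^sup>2
              \<le> (L2_norm ?C (B n (?e l)) + L2_norm ?C (A (?e l)))\<^sup>2"
            by (intro power_mono L2_norm_triangle_diff L2_op_L2[OF Aop] L2_op_L2[OF Bop] onb_L2[OF sb]) simp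
          then show ?thesis
            using sum_squares_bound[of "L2_norm ?C (B n (?e l))" "L2_norm ?C (A (?e l))"]
            by (simp add: power2_sum)
        qed
        have "summable (\<lambda>l. 2 * ((L2_norm ?C (B n (?e l)))\<^sup>2 + (L2_norm ?C (A (?e l)))\<^sup>2))"
          using hA hB[of n] by (intro summable_mult summable_add) (simp_all add: hilbert_schmidt_def)
        then have sm: "summable (\<lambda>l. (L2_norm ?C (\<lambda>x. B n (?e l) x - A (?e l) x))\<^sup>2)"
        proof (rule summable_comparison_test'[where N = 0])
          fix l
          show "norm ((L2_norm ?C (\<lambda>x. B n (?e l) x - A (?e l) x))\<^sup>2)
            \<le> 2 * ((L2_norm ?C (B n (?e l)))\<^sup>2 + (L2_norm ?C (A (?e l)))\<^sup>2)"
            using le[of l] by (simp only: real_norm_def abs_power2)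
        qed
        have "(\<Sum>l\<in>{k}. (L2_norm ?C (\<lambda>x. B n (?e l) x - A (?e l) x))\<^sup>2)
            \<le> (\<Sum>l. (L2_norm ?C (\<lambda>x. B n (?e l) x - A (?e l) x))\<^sup>2)"
          by (rule sum_le_suminf[OF sm]) auto
        then have "sqrt ((L2_norm ?C (\<lambda>x. B n (?e k) x - A (?e k) x))\<^sup>2)
            \<le> hs_norm ?C (\<lambda>\<phi> x. B n \<phi> x - A \<phi> x)"
          unfolding hs_norm_def by (intro real_sqrt_le_mono) simp
        then show ?thesis
          by (subst L2_norm_minus_commute) simp
      qed
      moreover have "L2_norm ?C (\<lambda>x. B n (?e k) x - fourier_op G' (?e k) x)
          \<le> L2_norm haar (\<lambda>p. partial_fourier (F n) p - G' p)"
      proof -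
        have d: "(\<lambda>p. partial_fourier (F n) p + (-1) * G' p) \<in> L2 haar" by (intro L2_add L2_scale FL GL')
        have "L2_norm ?C (\<lambda>x. B n (?e k) x - fourier_op G' (?e k) x)
            = L2_norm ?C (fourier_op (\<lambda>p. partial_fourier (F n) p + (-1) * G' p) (?e k))"
        proof (rule L2_norm_cong_AE)
          show "AE x in ?C. B n (?e k) x - fourier_op G' (?e k) x
              = fourier_op (\<lambda>p. partial_fourier (F n) p + (-1) * G' p) (?e k) x"
            using is_fourier_L1_unique[OF F B eL] fourier_op_lincomb[OF FL[of n] GL' eL, of "-1"]
            by eventually_elim simp
          show "(\<lambda>x. B n (?e k) x - fourier_op G' (?e k) x) \<in> borel_measurable ?C"
            by (rule L2_measurable[OF L2_diff[OF BL QL]])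
        qed (rule L2_measurable[OF fourier_op_L2(1)[OF d eL]])
        also have "\<dots> \<le> L2_norm haar (\<lambda>p. partial_fourier (F n) p + (-1) * G' p) * L2_norm ?C (?e k)"
          by (rule fourier_op_L2(2)[OF d eL])
        finally show ?thesis by (simp add: onb_norm[OF sb])
      qed
      ultimately show ?thesis by linarith
    qed
    have "(\<lambda>n. hs_norm ?C (\<lambda>\<phi> x. B n \<phi> x - A \<phi> x) + L2_norm haar (\<lambda>p. partial_fourier (F n) p - G' p))
        \<longlonglongrightarrow> 0"
      using tendsto_add[OF l2 l3] by simp
    then have "L2_norm ?C (\<lambda>x. A (?e k) x - fourier_op G' (?e k) x) \<le> 0"
      by (rule LIMSEQ_le_const) (use bound in auto)
    then have "L2_norm ?C (\<lambda>x. A (?e k) x - fourier_op G' (?e k) x) = 0"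
      using L2_norm_nonneg by (rule antisym)
    then show ?thesis unfolding L2_norm_eq_0_iff[OF L2_diff[OF AL QL]] by simp
  qed
  have "AE x in ?C. A \<phi> x = fourier_op G' \<phi> x"
    by (rule L2_op_eq_on_basis[OF Aop fourier_op_L2_op[OF GL'] sb basis \<phi>])
  moreover have "AE x in ?C. fourier_op G' \<phi> x = fourier_op G \<phi> x"
    by (rule fourier_op_cong[OF GL' GL partial_fourier_lim_unique[OF f G' G] \<phi>])
  ultimately show ?thesis by eventually_elim simp
qed

context
  fixes i j :: nat and e
  assumes b: "orthonormal_basis (cone_measure i j) e"
begin

lemma fourier_is_fourier:
  assumes f: "f \<in> L2 haar"
  shows "is_fourier i j f (fourier i j f)"
proof -
  obtain G where "partial_fourier_lim f G" using partial_fourier_lim_exists[OF f] by blast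
  from is_fourier_partial_fourier_lim[OF b f this] show ?thesis
    unfolding fourier_def by (rule someI[of "is_fourier i j f"])
qed

lemma fourier_L2_op: "f \<in> L2 haar \<Longrightarrow> L2_op (cone_measure i j) (fourier i j f)"
  using fourier_is_fourier by (auto simp: is_fourier_def hilbert_schmidt_def)

lemma fourier_hs_sum:
  assumes f: "f \<in> L2 haar" and e': "orthonormal_basis (cone_measure i j) e'"
  shows "hs_sum (cone_measure i j) (fourier i j f) e' \<le> ennreal ((L2_norm haar f)\<^sup>2)"
proof -
  obtain G where G: "partial_fourier_lim f G" using partial_fourier_lim_exists[OF f] by blast
  note GL = partial_fourier_lim_L2[OF G] and op = fourier_L2_op[OF f]
  have "hs_sum (cone_measure i j) (fourier i j f) e' = hs_sum (cone_measure i j) (fourier_op G) e'"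
    unfolding hs_sum_def
    by (intro suminf_cong arg_cong[of _ _ "\<lambda>t. ennreal (t\<^sup>2)"] L2_norm_cong_AE
        is_fourier_eq_fourier_op[OF b f fourier_is_fourier[OF f] G] L2_measurable
        L2_op_L2[OF op] fourier_op_L2(1)[OF GL] onb_L2[OF e'])
  also have "\<dots> \<le> ennreal ((L2_norm haar G)\<^sup>2)" by (rule fourier_op_hs_sum[OF GL e'])
  also have "\<dots> \<le> ennreal ((L2_norm haar f)\<^sup>2)"
    by (intro ennreal_leI power_mono partial_fourier_lim_norm[OF f G]) simp
  finally show ?thesis .
qed

lemma fourier_lincomb:
  assumes f: "f \<in> L2 haar" and g: "g \<in> L2 haar" and \<phi>: "\<phi> \<in> L2 (cone_measure i j)"
  shows "AE x in cone_measure i j.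
    fourier i j (\<lambda>p. f p + c * g p) \<phi> x = fourier i j f \<phi> x + c * fourier i j g \<phi> x"
proof -
  obtain F G where F: "partial_fourier_lim f F" and G: "partial_fourier_lim g G"
    using partial_fourier_lim_exists[OF f] partial_fourier_lim_exists[OF g] by blast
  have fg: "(\<lambda>p. f p + c * g p) \<in> L2 haar" by (intro L2_add L2_scale f g)
  note * = is_fourier_eq_fourier_op[OF b _ fourier_is_fourier _ \<phi>]
  from *[OF f f F] *[OF g g G] *[OF fg fg partial_fourier_lim_lincomb[OF f g F G]]
    fourier_op_lincomb[OF partial_fourier_lim_L2[OF F] partial_fourier_lim_L2[OF G] \<phi>, of c]
  show ?thesis by eventually_elim simp
qed

end

section \<open>Minkowski's inequality\<close>

text \<open>Convexity on the open half-line is completed at the boundary, where the claim reduces to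
  c^r <= c for c in [0, 1].\<close>

lemma powr_convex_nonneg:
  fixes r s t x y :: real
  assumes r: "1 \<le> r" and xy: "0 \<le> x" "0 \<le> y" and st: "0 \<le> s" "0 \<le> t" "s + t = 1"
  shows "(s * x + t * y) powr r \<le> s * x powr r + t * y powr r"
proof -
  have one: "(c * z) powr r \<le> c * z powr r" if "0 \<le> c" "c \<le> 1" "0 \<le> z" for c z
  proof -
    have "c powr r \<le> c powr 1" using that r by (intro powr_mono') auto
    then show ?thesis using that by (simp add: powr_mult mult_right_mono)
  qed
  consider "x = 0" | "y = 0" | "0 < x" "0 < y" using xy by linarith
  then show ?thesis
  proof cases
    case 1 then show ?thesis using one[of t y] st xy by simp
  next
    case 2 then show ?thesis using one[of s x] st xy by simp
  next
    case 3
    have s: "s = 1 - t" using st by simp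
    show ?thesis
      using convex_onD[OF powr_convex[OF r], of t x y] st 3 unfolding s by simp
  qed
qed

lemma Lp_norm_nonneg: "0 \<le> Lp_norm p M f"
  by (simp add: Lp_norm_def)

context
  fixes p :: ennreal and r :: real
  assumes p: "p \<noteq> \<infinity>" and r: "1 \<le> r" "enn2real p = r"
begin

lemma Lp_finite_iff: "f \<in> Lp p M \<longleftrightarrow> f \<in> borel_measurable M \<and> integrable M (\<lambda>x. cmod (f x) powr r)"
  using p r by (simp add: Lp_def)

lemma Lp_norm_finite: "Lp_norm p M f = (\<integral>x. cmod (f x) powr r \<partial>M) powr (1 / r)"
  using p r by (simp add: Lp_norm_def)

lemma Lp_norm_finite_powr: "Lp_norm p M f powr r = (\<integral>x. cmod (f x) powr r \<partial>M)"
  using r(1) by (simp add: Lp_norm_finite powr_powr)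

lemma Lp_norm_finite_le:
  assumes "(\<integral>x. cmod (f x) powr r \<partial>M) \<le> c powr r" "0 \<le> c"
  shows "Lp_norm p M f \<le> c"
proof -
  have "Lp_norm p M f \<le> (c powr r) powr (1 / r)"
    unfolding Lp_norm_finite using assms r by (intro powr_mono2) auto
  then show ?thesis using assms r by (simp add: powr_powr)
qed

lemma Lp_finite_dominated:
  assumes g: "g \<in> Lp p M" and f: "f \<in> borel_measurable M"
    and le: "AE x in M. cmod (f x) \<le> cmod (g x)"
  shows "f \<in> Lp p M" "Lp_norm p M f \<le> Lp_norm p M g"
proof -
  have gi: "integrable M (\<lambda>x. cmod (g x) powr r)" using g by (simp add: Lp_finite_iff)
  have le': "AE x in M. cmod (f x) powr r \<le> cmod (g x) powr r"
    using le by eventually_elim (use r in \<open>auto intro!: powr_mono2\<close>)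
  have fi: "integrable M (\<lambda>x. cmod (f x) powr r)"
    using gi
  proof (rule Bochner_Integration.integrable_bound)
    show "(\<lambda>x. cmod (f x) powr r) \<in> borel_measurable M" using f by measurable
    show "AE x in M. norm (cmod (f x) powr r) \<le> norm (cmod (g x) powr r)" using le' by simp
  qed
  then show "f \<in> Lp p M" using f by (simp add: Lp_finite_iff)
  have "(\<integral>x. cmod (f x) powr r \<partial>M) \<le> Lp_norm p M g powr r"
    unfolding Lp_norm_finite_powr by (rule integral_mono_AE[OF fi gi le'])
  then show "Lp_norm p M f \<le> Lp_norm p M g"
    by (rule Lp_norm_finite_le) (simp add: Lp_norm_finite)
qed

lemma Lp_finite_scale:
  assumes f: "f \<in> Lp p M"
  shows "(\<lambda>x. c * f x) \<in> Lp p M" "Lp_norm p M (\<lambda>x. c * f x) = cmod c * Lp_norm p M f"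
  using f r(1) by (auto simp: Lp_finite_iff Lp_norm_finite norm_mult powr_mult powr_powr)

text \<open>Minkowski's inequality by convexity of the r-th power: |f| + |g| is a + b times a convex
  combination of |f| / a and |g| / b. Taking a and b positive and above the norms, then letting them
  decrease, avoids division by a norm that may be 0.\<close>

lemma Lp_finite_triangle:
  assumes f: "f \<in> Lp p M" and g: "g \<in> Lp p M"
  shows "(\<lambda>x. f x + g x) \<in> Lp p M" "Lp_norm p M (\<lambda>x. f x + g x) \<le> Lp_norm p M f + Lp_norm p M g"
proof -
  have fi: "integrable M (\<lambda>x. cmod (f x) powr r)" and gi: "integrable M (\<lambda>x. cmod (g x) powr r)"
    and [measurable]: "f \<in> borel_measurable M" "g \<in> borel_measurable M"
    using f g by (simp_all add: Lp_finite_iff)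
  have pt: "cmod (f x + g x) powr r \<le> (a + b) powr r *
      (a / (a + b) * (cmod (f x) powr r / a powr r) + b / (a + b) * (cmod (g x) powr r / b powr r))"
    if "0 < a" "0 < b" for a b x
  proof -
    have "cmod (f x + g x) powr r \<le> (cmod (f x) + cmod (g x)) powr r"
      using r by (intro powr_mono2 norm_triangle_ineq) auto
    also have "cmod (f x) + cmod (g x)
        = (a + b) * (a / (a + b) * (cmod (f x) / a) + b / (a + b) * (cmod (g x) / b))"
    proof -
      have "a / (a + b) * (cmod (f x) / a) = cmod (f x) / (a + b)"
        "b / (a + b) * (cmod (g x) / b) = cmod (g x) / (a + b)"
        using that by simp_all
      then show ?thesis using that by (simp add: add_divide_distrib[symmetric])
    qed
    also have "\<dots> powr r = (a + b) powr r * (a / (a + b) * (cmod (f x) / a) + b / (a + b) * (cmod (g x) / b)) powr r"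
      by (rule powr_mult)
    also have "\<dots> \<le> (a + b) powr r *
        (a / (a + b) * (cmod (f x) / a) powr r + b / (a + b) * (cmod (g x) / b) powr r)"
      using that r by (intro mult_left_mono powr_convex_nonneg) (auto simp: add_divide_distrib[symmetric])
    finally show ?thesis using that by (simp add: powr_divide)
  qed
  have int: "integrable M (\<lambda>x. (a + b) powr r *
      (a / (a + b) * (cmod (f x) powr r / a powr r) + b / (a + b) * (cmod (g x) powr r / b powr r)))" for a b
    using fi gi by (intro integrable_mult_right Bochner_Integration.integrable_add integrable_divide) 
  \<comment> \<open>The pointwise bound at a = b = 1 settles integrability before norms are
    compared.\<close>
  have si: "integrable M (\<lambda>x. cmod (f x + g x) powr r)"
    using int[of 1 1]
  proof (rule Bochner_Integration.integrable_bound)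
    show "AE x in M. norm (cmod (f x + g x) powr r) \<le> norm ((1 + 1) powr r *
      (1 / (1 + 1) * (cmod (f x) powr r / 1 powr r) + 1 / (1 + 1) * (cmod (g x) powr r / 1 powr r)))"
      by (rule AE_I2) (use pt[of 1 1] in \<open>smt (verit) powr_ge_zero real_norm_def zero_less_one\<close>)
  qed measurable
  then show "(\<lambda>x. f x + g x) \<in> Lp p M" by (simp add: Lp_finite_iff)
  have bound: "Lp_norm p M (\<lambda>x. f x + g x) \<le> a + b"
    if a: "Lp_norm p M f \<le> a" "0 < a" and b: "Lp_norm p M g \<le> b" "0 < b" for a b
  proof (rule Lp_norm_finite_le)
    have "Lp_norm p M f powr r \<le> a powr r" "Lp_norm p M g powr r \<le> b powr r"
      using a b r(1) by (auto intro!: powr_mono2 Lp_norm_nonneg)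
    then have fa: "(\<integral>x. cmod (f x) powr r \<partial>M) / a powr r \<le> 1"
      and gb: "(\<integral>x. cmod (g x) powr r \<partial>M) / b powr r \<le> 1"
      using a b by (simp_all add: Lp_norm_finite_powr)
    have "(\<integral>x. cmod (f x + g x) powr r \<partial>M) \<le> (\<integral>x. (a + b) powr r *
      (a / (a + b) * (cmod (f x) powr r / a powr r) + b / (a + b) * (cmod (g x) powr r / b powr r)) \<partial>M)"
      by (intro integral_mono si int pt a b)
    also have "\<dots> = (a + b) powr r * (a / (a + b) * ((\<integral>x. cmod (f x) powr r \<partial>M) / a powr r)
        + b / (a + b) * ((\<integral>x. cmod (g x) powr r \<partial>M) / b powr r))"
      using fi gi by simp
    also have "\<dots> \<le> (a + b) powr r * (a / (a + b) * 1 + b / (a + b) * 1)"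
      using a b by (intro mult_left_mono add_mono fa gb) auto
    also have "\<dots> = (a + b) powr r" using a b by (simp flip: add_divide_distrib)
    finally show "(\<integral>x. cmod (f x + g x) powr r \<partial>M) \<le> (a + b) powr r" .
  qed (use a b in simp)
  show "Lp_norm p M (\<lambda>x. f x + g x) \<le> Lp_norm p M f + Lp_norm p M g"
  proof (rule field_le_epsilon)
    fix \<epsilon> :: real assume "0 < \<epsilon>"
    moreover have "0 \<le> Lp_norm p M f" "0 \<le> Lp_norm p M g" by (simp_all add: Lp_norm_finite)
    ultimately show "Lp_norm p M (\<lambda>x. f x + g x) \<le> Lp_norm p M f + Lp_norm p M g + \<epsilon>"
      using bound[of "Lp_norm p M f + \<epsilon> / 2" "Lp_norm p M g + \<epsilon> / 2"] by simp
  qed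
qed

end

section \<open>The endpoint p = \<infinity>\<close>

lemma Lp_infinity_iff:
  "f \<in> Lp \<infinity> M \<longleftrightarrow> f \<in> borel_measurable M \<and> esssup M (\<lambda>x. ennreal (cmod (f x))) < \<infinity>"
  by (simp add: Lp_def)

lemma Lp_infinity_norm:
  "f \<in> Lp \<infinity> M \<Longrightarrow> ennreal (Lp_norm \<infinity> M f) = esssup M (\<lambda>x. ennreal (cmod (f x)))"
  unfolding Lp_infinity_iff Lp_norm_def by simp

lemma Lp_infinity_AE:
  assumes f: "f \<in> Lp \<infinity> M"
  shows "AE x in M. cmod (f x) \<le> Lp_norm \<infinity> M f"
proof -
  have "AE x in M. ennreal (cmod (f x)) \<le> ennreal (Lp_norm \<infinity> M f)"
    unfolding Lp_infinity_norm[OF f] by (rule esssup_AE)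
  then show ?thesis by eventually_elim (simp add: Lp_norm_def)
qed

lemma Lp_infinityI:
  assumes [measurable]: "f \<in> borel_measurable M" and le: "AE x in M. cmod (f x) \<le> c" and c: "0 \<le> c"
  shows "f \<in> Lp \<infinity> M" "Lp_norm \<infinity> M f \<le> c"
proof -
  have *: "esssup M (\<lambda>x. ennreal (cmod (f x))) \<le> ennreal c"
    using le by (intro esssup_I) (measurable, auto elim: eventually_mono intro: ennreal_leI)
  then have "esssup M (\<lambda>x. ennreal (cmod (f x))) < \<infinity>" by (rule order_le_less_trans) simp
  then show "f \<in> Lp \<infinity> M" unfolding Lp_infinity_iff by simp
  show "Lp_norm \<infinity> M f \<le> c" using * c by (simp add: Lp_norm_def enn2real_leI)
qed


context
  fixes p :: ennreal
  assumes p: "1 \<le> p"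
begin

lemma Lp_exponent: "p \<noteq> \<infinity> \<Longrightarrow> 1 \<le> enn2real p"
  using enn2real_mono[OF p] by (simp add: less_top)

lemma Lp_dominated:
  assumes g: "g \<in> Lp p M" and f: "f \<in> borel_measurable M"
    and le: "AE x in M. cmod (f x) \<le> cmod (g x)"
  shows "f \<in> Lp p M \<and> Lp_norm p M f \<le> Lp_norm p M g"
proof (cases "p = \<infinity>")
  case True
  have "AE x in M. cmod (f x) \<le> Lp_norm \<infinity> M g"
    using le Lp_infinity_AE[OF g[unfolded True]] by eventually_elim simp
  then show ?thesis unfolding True using Lp_infinityI[OF f _ Lp_norm_nonneg] by blast
next
  case False
  then show ?thesis using Lp_finite_dominated[OF False Lp_exponent[OF False] refl g f le] by blast
qed

lemma Lp_scale:
  assumes f: "f \<in> Lp p M"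
  shows "(\<lambda>x. c * f x) \<in> Lp p M \<and> Lp_norm p M (\<lambda>x. c * f x) \<le> cmod c * Lp_norm p M f"
proof (cases "p = \<infinity>")
  case True
  have m: "(\<lambda>x. c * f x) \<in> borel_measurable M" using f by (auto simp: Lp_def)
  have "AE x in M. cmod (c * f x) \<le> cmod c * Lp_norm \<infinity> M f"
    using Lp_infinity_AE[OF f[unfolded True]]
    by eventually_elim (simp add: norm_mult mult_left_mono)
  from Lp_infinityI[OF m this] show ?thesis unfolding True by (simp add: Lp_norm_nonneg)
next
  case False
  then show ?thesis using Lp_finite_scale[OF False Lp_exponent[OF False] refl f] by simp
qed

lemma Lp_triangle:
  assumes f: "f \<in> Lp p M" and g: "g \<in> Lp p M"
  shows "(\<lambda>x. f x + g x) \<in> Lp p M \<and> Lp_norm p M (\<lambda>x. f x + g x) \<le> Lp_norm p M f + Lp_norm p M g"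
proof (cases "p = \<infinity>")
  case True
  have m: "(\<lambda>x. f x + g x) \<in> borel_measurable M" using f g by (auto simp: Lp_def)
  have "AE x in M. cmod (f x + g x) \<le> Lp_norm \<infinity> M f + Lp_norm \<infinity> M g"
    using Lp_infinity_AE[OF f[unfolded True]] Lp_infinity_AE[OF g[unfolded True]]
    by eventually_elim (use norm_triangle_ineq order_trans in \<open>blast intro: add_mono\<close>)
  from Lp_infinityI[OF m this] show ?thesis unfolding True by (simp add: Lp_norm_nonneg)
next
  case False
  then show ?thesis using Lp_finite_triangle[OF False Lp_exponent[OF False] refl f g] by blast
qed

end

section \<open>Pseudo-differential operators\<close>

lemma borel_measurable_sums:
  fixes f :: "nat \<Rightarrow> 'a \<Rightarrow> complex"
  assumes [measurable]: "\<And>k. f k \<in> borel_measurable M"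
    and "\<And>x. x \<in> space M \<Longrightarrow> (\<lambda>k. f k x) sums g x"
  shows "g \<in> borel_measurable M"
proof (rule borel_measurable_LIMSEQ_metric)
  show "(\<lambda>x. \<Sum>k<n. f k x) \<in> borel_measurable M" for n by measurable
  show "(\<lambda>n. \<Sum>k<n. f k x) \<longlonglongrightarrow> g x" if "x \<in> space M" for x
    using assms(2)[OF that] by (simp add: sums_def)
qed

text \<open>D is multiplication by a real function, hence symmetric, but psi need not lie in its
  domain; cutoffs of psi do. Weak measurability is assumed for the symbol itself, and this limit
  transfers it to D composed with the symbol.\<close>

lemma duflo_moore_inner_tendsto:
  assumes \<phi>: "\<phi> \<in> L2 (cone_measure i j)" and D\<phi>: "duflo_moore \<phi> \<in> L2 (cone_measure i j)"
    and \<psi>: "\<psi> \<in> L2 (cone_measure i j)"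
  shows "(\<lambda>n. L2_inner (cone_measure i j) \<phi> (duflo_moore (cutoff n \<psi>)))
    \<longlonglongrightarrow> L2_inner (cone_measure i j) (duflo_moore \<phi>) \<psi>"
proof -
  have "L2_inner (cone_measure i j) \<phi> (duflo_moore (cutoff n \<psi>))
      = L2_inner (cone_measure i j) (duflo_moore \<phi>) (cutoff n \<psi>)" for n
    unfolding L2_inner_def duflo_moore_def by (simp add: mult_ac)
  then show ?thesis
    using L2_inner_tendsto_right[OF cutoff_L2(1)[OF \<psi>] \<psi> D\<phi> cutoff_L2(3)[OF \<psi>]] by simp
qed

lemma rep_inner_measurable:
  assumes \<phi>: "\<phi> \<in> L2 (cone_measure i j)" and \<psi>: "\<psi> \<in> L2 (cone_measure i j)"
  shows "(\<lambda>g. L2_inner (cone_measure i j) (rep g \<phi>) \<psi>) \<in> borel_measurable haar"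
proof -
  let ?C = "cone_measure i j"
  have [measurable]: "(\<lambda>p. rep (fst p) \<phi> (snd p)) \<in> borel_measurable (haar \<Otimes>\<^sub>M ?C)"
    using measurable_compose[OF measurable_pair_swap' rep_measurable2[OF L2_measurable[OF \<phi>]]]
    by (simp add: case_prod_beta')
  have [measurable]: "\<psi> \<in> borel_measurable ?C" by (rule L2_measurable[OF \<psi>])
  have "(\<lambda>p. rep (fst p) \<phi> (snd p) * cnj (\<psi> (snd p))) \<in> borel_measurable (haar \<Otimes>\<^sub>M ?C)"
    by measurable
  then show ?thesis unfolding L2_inner_def
    by (intro cone.borel_measurable_lebesgue_integral) (simp add: case_prod_beta')
qed

abbreviation (input) symbol_trace :: "symbol \<Rightarrow> nat \<Rightarrow> nat \<Rightarrow> (pgroup \<Rightarrow> complex) \<Rightarrow> pgroup \<Rightarrow> complex" where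
  "symbol_trace \<sigma> i j f g \<equiv> trace_op (cone_measure i j)
    (\<lambda>\<phi>. duflo_symbol \<sigma> g i j (fourier i j f (adjoint_op (cone_measure i j) (rep g) \<phi>)))"

context
  fixes i j :: nat and q :: ennreal and \<sigma> :: symbol
  assumes q: "1 \<le> q" "q \<le> 2" and ij: "i \<in> {1, 2}" "j \<in> {1, 2}"
    and \<sigma>: "operator_symbol \<sigma>"
    and schatten: "\<And>g. g \<in> poincare \<Longrightarrow> duflo_symbol \<sigma> g i j \<in> schatten_class q (cone_measure i j)"
begin

private abbreviation (input) "C \<equiv> cone_measure i j"
private abbreviation (input) "e \<equiv> some_basis C"
private abbreviation (input) "S g \<equiv> duflo_symbol \<sigma> g i j"
private abbreviation (input) "R g \<equiv> adjoint_op C (rep g)"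

private lemma q_finite: "q \<noteq> \<infinity>"
  using q(2) by (auto simp: top_unique)

private lemma S_op: "g \<in> poincare \<Longrightarrow> L2_op C (S g)"
  using schatten_classD(1)[OF schatten q_finite] .

text \<open>The Schatten hypothesis at one group element, here the identity, provides a
  basis.\<close>

private lemma onb: "orthonormal_basis C e"
proof -
  have "((0, 0), 1, 0) \<in> poincare" by (simp add: poincare_def)
  from schatten_classD(2)[OF schatten[OF this] q_finite]
  show ?thesis using some_basis_onb by blast
qed

private lemma R_op: "g \<in> poincare \<Longrightarrow> L2_op C (R g)"
  by (rule is_adjointD(1)[OF adjoint_op_rep])

private lemma R_L2: "g \<in> poincare \<Longrightarrow> R g (e k) \<in> L2 C"
  by (rule L2_op_L2[OF R_op onb_L2[OF onb]])

text \<open>With the adjoint moved across, these are the coefficients of \<open>rep g v\<close> in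
  the basis, and \<open>rep g v\<close> has the norm of \<open>v\<close>.\<close>

private lemma R_Bessel:
  assumes g: "g \<in> poincare" and v: "v \<in> L2 C"
  shows "(\<Sum>k<n. (cmod (L2_inner C v (R g (e k))))\<^sup>2) \<le> (L2_norm C v)\<^sup>2"
proof -
  have "L2_inner C v (R g (e k)) = L2_inner C (rep g v) (e k)" for k
    by (rule is_adjointD(2)[OF adjoint_op_rep[OF g] v onb_L2[OF onb], symmetric])
  then show ?thesis
    using onb_Bessel[OF onb rep_L2(1)[OF g v], of "{..<n}"] by (simp add: rep_L2(2)[OF g v])
qed

text \<open>In \<open>trace_bound\<close> the vectors \<open>R g (e k)\<close> play the part of
  \<open>u\<close>: Bessel's inequality bounds the Fourier transform along them by the L^2 norm of
  f, and the Schatten norm bounds D composed with the symbol.\<close>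

private lemma trace_terms:
  assumes g: "g \<in> poincare" and f: "f \<in> L2 haar"
  shows "summable (\<lambda>k. L2_inner C (S g (fourier i j f (R g (e k)))) (e k))"
    and "cmod (symbol_trace \<sigma> i j f g) \<le> L2_norm haar f * schatten_norm q C (S g)"
proof -
  have A: "L2_op C (fourier i j f)" by (rule fourier_L2_op[OF onb f])
  have "hs_sum C (fourier i j f) (\<lambda>k. R g (e k)) \<le> hs_sum C (fourier i j f) e"
    by (rule hs_sum_Bessel[OF A onb R_L2[OF g] R_Bessel[OF g]])
  also have "\<dots> \<le> ennreal ((L2_norm haar f)\<^sup>2)" by (rule fourier_hs_sum[OF onb f onb])
  finally have a: "hs_sum C (fourier i j f) (\<lambda>k. R g (e k)) \<le> ennreal ((L2_norm haar f)\<^sup>2)" .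
  note tb = trace_bound[OF S_op[OF g] A onb R_L2[OF g] a L2_norm_nonneg
      hs_sum_le_schatten_norm[OF schatten[OF g] onb q] schatten_norm_nonneg[OF q_finite]]
  show "summable (\<lambda>k. L2_inner C (S g (fourier i j f (R g (e k)))) (e k))" by (rule tb(1))
  show "cmod (symbol_trace \<sigma> i j f g) \<le> L2_norm haar f * schatten_norm q C (S g)"
    unfolding trace_op_def by (rule tb(2))
qed

private lemma S_inner_measurable:
  assumes \<phi>: "\<phi> \<in> L2 C" and \<psi>: "\<psi> \<in> L2 C"
  shows "(\<lambda>g. L2_inner C (S g \<phi>) \<psi>) \<in> borel_measurable haar"
proof (rule borel_measurable_LIMSEQ_metric)
  show "(\<lambda>g. L2_inner C (\<sigma> g i j \<phi>) (duflo_moore (cutoff n \<psi>))) \<in> borel_measurable haar" for n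
    using \<sigma> ij \<phi> cutoff_L2(2)[OF \<psi>, of n] unfolding operator_symbol_def by blast
  fix g assume "g \<in> space haar"
  then have g: "g \<in> poincare" by simp
  have op: "L2_op C (\<sigma> g i j)" using \<sigma> ij g unfolding operator_symbol_def by blast
  have D: "duflo_moore (\<sigma> g i j \<phi>) \<in> L2 C"
    using L2_op_L2[OF S_op[OF g] \<phi>] by (simp add: duflo_symbol_def)
  show "(\<lambda>n. L2_inner C (\<sigma> g i j \<phi>) (duflo_moore (cutoff n \<psi>))) \<longlonglongrightarrow> L2_inner C (S g \<phi>) \<psi>"
    unfolding duflo_symbol_def by (rule duflo_moore_inner_tendsto[OF L2_op_L2[OF op \<phi>] D \<psi>])
qed

lemma symbol_trace_bound:
  "g \<in> poincare \<Longrightarrow> f \<in> L2 haar \<Longrightarrow>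
    cmod (symbol_trace \<sigma> i j f g) \<le> L2_norm haar f * schatten_norm q (cone_measure i j) (duflo_symbol \<sigma> g i j)"
  by (rule trace_terms(2))

text \<open>Composition hides measurability in g, so each diagonal entry is expanded twice over the
  basis, until only matrix entries of single factors remain.\<close>

lemma symbol_trace_measurable:
  assumes f: "f \<in> L2 haar"
  shows "symbol_trace \<sigma> i j f \<in> borel_measurable haar"
proof -
  note A = fourier_L2_op[OF onb f] and eL = onb_L2[OF onb]
  \<comment> \<open>The adjoint is chosen separately at each g; its matrix entries are nevertheless
    conjugates of entries of \<open>rep g\<close>, and those are measurable.\<close>
  have 1: "(\<lambda>g. L2_inner C (R g (e k)) (e m)) \<in> borel_measurable haar" for k m
  proof -
    have "(\<lambda>g. cnj (L2_inner C (rep g (e m)) (e k))) \<in> borel_measurable haar"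
      by (intro borel_measurable_cnj rep_inner_measurable eL)
    moreover have "L2_inner C (R g (e k)) (e m) = cnj (L2_inner C (rep g (e m)) (e k))"
      if "g \<in> space haar" for g
      using is_adjointD(3)[OF adjoint_op_rep eL eL, of g k m] that
        L2_inner_commute[of C "e k" "rep g (e m)"] by simp
    ultimately show ?thesis by (subst measurable_cong)
  qed
  have 2: "(\<lambda>g. L2_inner C (fourier i j f (R g (e k))) (e l)) \<in> borel_measurable haar" for k l
  proof (rule borel_measurable_sums)
    show "(\<lambda>g. L2_inner C (R g (e k)) (e m) * L2_inner C (fourier i j f (e m)) (e l))
        \<in> borel_measurable haar" for m
      using 1 by measurable
    show "(\<lambda>m. L2_inner C (R g (e k)) (e m) * L2_inner C (fourier i j f (e m)) (e l))
        sums L2_inner C (fourier i j f (R g (e k))) (e l)" if "g \<in> space haar" for g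
      using that by (intro L2_op_onb_sums[OF A onb _ eL] R_L2) simp
  qed
  have 3: "(\<lambda>g. L2_inner C (S g (fourier i j f (R g (e k)))) (e k)) \<in> borel_measurable haar" for k
  proof (rule borel_measurable_sums)
    show "(\<lambda>g. L2_inner C (fourier i j f (R g (e k))) (e l) * L2_inner C (S g (e l)) (e k))
        \<in> borel_measurable haar" for l
      using 2 S_inner_measurable[OF eL eL] by measurable
    show "(\<lambda>l. L2_inner C (fourier i j f (R g (e k))) (e l) * L2_inner C (S g (e l)) (e k))
        sums L2_inner C (S g (fourier i j f (R g (e k)))) (e k)" if "g \<in> space haar" for g
      using that by (intro L2_op_onb_sums[OF S_op onb L2_op_L2[OF A R_L2] eL]) simp_all
  qed
  show ?thesis
  proof (rule borel_measurable_sums[OF 3])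
    show "(\<lambda>k. L2_inner C (S g (fourier i j f (R g (e k)))) (e k)) sums symbol_trace \<sigma> i j f g"
      if "g \<in> space haar" for g
      unfolding trace_op_def using that by (intro summable_sums trace_terms(1) f) simp
  qed
qed

text \<open>\<open>fourier\<close> is linear only up to null sets, but these disappear in the inner
  products of the trace, so equality holds at every g.\<close>

lemma symbol_trace_lincomb:
  assumes g: "g \<in> poincare" and f: "f \<in> L2 haar" and f': "f' \<in> L2 haar"
  shows "symbol_trace \<sigma> i j (\<lambda>p. f p + c * f' p) g = symbol_trace \<sigma> i j f g + c * symbol_trace \<sigma> i j f' g"
proof -
  have ff: "(\<lambda>p. f p + c * f' p) \<in> L2 haar" by (intro L2_add L2_scale f f')
  note A = fourier_L2_op[OF onb f] and A' = fourier_L2_op[OF onb f'] and B = fourier_L2_op[OF onb ff]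
    and Sg = S_op[OF g] and eL = onb_L2[OF onb]
  have "L2_inner C (S g (fourier i j (\<lambda>p. f p + c * f' p) (R g (e k)))) (e k)
      = L2_inner C (S g (fourier i j f (R g (e k)))) (e k)
        + c * L2_inner C (S g (fourier i j f' (R g (e k)))) (e k)" for k
  proof -
    note u = R_L2[OF g, of k]
    note Au = L2_op_L2[OF A u] and Au' = L2_op_L2[OF A' u] and Bu = L2_op_L2[OF B u]
    have sum: "(\<lambda>x. fourier i j f (R g (e k)) x + c * fourier i j f' (R g (e k)) x) \<in> L2 C"
      by (intro L2_add L2_scale Au Au')
    have "AE x in C. S g (fourier i j (\<lambda>p. f p + c * f' p) (R g (e k))) x
        = S g (\<lambda>x. fourier i j f (R g (e k)) x + c * fourier i j f' (R g (e k)) x) x"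
      by (rule L2_op_cong_AE[OF Sg Bu sum fourier_lincomb[OF onb f f' u]])
    with L2_op_add[OF Sg Au L2_scale[OF Au', of c]] L2_op_scale[OF Sg Au', of c]
    have ae: "AE x in C. S g (fourier i j (\<lambda>p. f p + c * f' p) (R g (e k))) x
        = S g (fourier i j f (R g (e k))) x + c * S g (fourier i j f' (R g (e k))) x"
      by eventually_elim simp
    note SA = L2_op_L2[OF Sg Au] and SA' = L2_op_L2[OF Sg Au'] and SB = L2_op_L2[OF Sg Bu]
    have "L2_inner C (S g (fourier i j (\<lambda>p. f p + c * f' p) (R g (e k)))) (e k)
        = L2_inner C (\<lambda>x. S g (fourier i j f (R g (e k))) x + c * S g (fourier i j f' (R g (e k))) x) (e k)"
      by (rule L2_inner_cong_AE[OF L2_measurable[OF SB] L2_measurable[OF L2_add[OF SA L2_scale[OF SA']]] ae])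
        (simp_all add: L2_measurable[OF eL])
    then show ?thesis
      by (simp add: L2_inner_add_left[OF SA L2_scale[OF SA'] eL] L2_inner_scale_left)
  qed
  then show ?thesis
    unfolding trace_op_def
    by (simp add: suminf_add[symmetric] suminf_mult summable_mult trace_terms(1)[OF g f] trace_terms(1)[OF g f'])
qed

end

section \<open>Assembly over the four cones\<close>

lemma modular_measurable: "(\<lambda>g. modular g powr (- 1 / 2)) \<in> borel_measurable haar"
proof -
  have eq: "modular g = 1 / (fst (snd g))\<^sup>2" for g by (cases g) simp
  have h: "snd \<in> measurable haar fiber_measure" unfolding haar_eq by (rule measurable_snd)
  have [measurable]: "(\<lambda>g. fst (snd g)) \<in> borel_measurable haar"
    by (rule measurable_compose[OF h fst_fiber])
  show ?thesis unfolding eq by measurable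
qed

lemma conjugate_exponent:
  fixes p q :: ennreal
  assumes p: "2 \<le> p" and pq: "1 / p + 1 / q = 1"
  shows "1 \<le> q" "q \<le> 2"
proof -
  have "1 \<le> q \<and> q \<le> 2"
  proof (cases q)
    \<comment> \<open>The value q = \<infinity> would force p = 1.\<close>
    case top
    then have "1 / p = 1" using pq by simp
    moreover have "1 / p \<noteq> 1"
    proof (cases p)
      case (real r)
      have "2 \<le> r" using p real by simp
      then show ?thesis using real divide_ennreal[of 1 r] by simp
    qed simp
    ultimately show ?thesis by simp
  next
    case (real s)
    \<comment> \<open>In \<open>ennreal\<close> the quotient 1 / 0 is infinite, which rules out q =
      0.\<close>
    have "s \<noteq> 0" using pq real by (auto simp: ennreal_divide_zero)
    then have s: "0 < s" "1 / q = ennreal (1 / s)"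
      using real divide_ennreal[of 1 s] by simp_all
    show ?thesis
    proof (cases p)
      case top
      then show ?thesis using pq s real by simp
    next
      case (real r)
      have r: "2 \<le> r" using p real by simp
      then have "1 / p = ennreal (1 / r)" using real divide_ennreal[of 1 r] by simp
      then have "ennreal (1 / r + 1 / s) = ennreal 1"
        using pq s r by (simp add: ennreal_plus[symmetric] del: ennreal_plus)
      then have eq: "1 / r + 1 / s = 1" using r s by (subst (asm) ennreal_inj) auto
      have "0 < 1 / r" "1 / r \<le> 1 / 2" using r by (auto simp: field_simps)
      then have "1 / s \<le> 1" "1 / 2 \<le> 1 / s" using eq by linarith+
      then have "1 \<le> s" "s \<le> 2" using s by (auto simp: field_simps)
      have "ennreal 1 \<le> ennreal s" "ennreal s \<le> ennreal 2"
        by (rule ennreal_leI, fact)+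
      then show ?thesis using \<open>q = ennreal s\<close> by simp
    qed
  qed
  then show "1 \<le> q" "q \<le> 2" by simp_all
qed

text \<open>The pointwise estimate has a constant independent of g, so one argument serves every p,
  including \<infinity>; p >= 2 enters by forcing q <= 2.\<close>

theorem theorem4p3:
  fixes p q :: ennreal and \<sigma> :: symbol
  assumes "2 \<le> p" and "1 / p + 1 / q = 1"
    and "operator_symbol \<sigma>"
    and "\<And>g i j. g \<in> poincare \<Longrightarrow> i \<in> {1, 2} \<Longrightarrow> j \<in> {1, 2} \<Longrightarrow>
           duflo_symbol \<sigma> g i j \<in> schatten_class q (cone_measure i j)"
    and "\<And>i j. i \<in> {1, 2} \<Longrightarrow> j \<in> {1, 2} \<Longrightarrow> symbol_norm q \<sigma> i j \<in> Lp p haar"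
  shows "bounded_op 2 haar p haar (pseudo_diff \<sigma>) \<and>
         op_norm 2 haar p haar (pseudo_diff \<sigma>)
           \<le> Lp_norm p haar (symbol_norm q \<sigma> 1 1) + Lp_norm p haar (symbol_norm q \<sigma> 2 1)
             + Lp_norm p haar (symbol_norm q \<sigma> 1 2) + Lp_norm p haar (symbol_norm q \<sigma> 2 2)"
proof -
  note q = conjugate_exponent[OF assms(1,2)]
  have p1: "1 \<le> p" using assms(1) by (rule order_trans[rotated]) simp
  let ?T = "pseudo_diff \<sigma>"
  define K where "K = Lp_norm p haar (symbol_norm q \<sigma> 1 1) + Lp_norm p haar (symbol_norm q \<sigma> 2 1)
             + Lp_norm p haar (symbol_norm q \<sigma> 1 2) + Lp_norm p haar (symbol_norm q \<sigma> 2 2)"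
  have K0: "0 \<le> K" unfolding K_def by (intro add_nonneg_nonneg Lp_norm_nonneg)
  note tb = symbol_trace_bound[OF q _ _ assms(3) assms(4)]
    and tm = symbol_trace_measurable[OF q _ _ assms(3) assms(4)]
  have qf: "q \<noteq> \<infinity>" using q(2) by (auto simp: top_unique)
  \<comment> \<open>The summands are nonnegative reals embedded in the complex numbers, so |H| is
    the plain sum of the four and not merely bounded by it.\<close>
  define H where "H g = symbol_norm q \<sigma> 1 1 g + symbol_norm q \<sigma> 2 1 g
      + symbol_norm q \<sigma> 1 2 g + symbol_norm q \<sigma> 2 2 g" for g
  have H: "H \<in> Lp p haar \<and> Lp_norm p haar H \<le> K"
  proof -
    note G = assms(5)
    have 1: "(\<lambda>g. symbol_norm q \<sigma> 1 1 g + symbol_norm q \<sigma> 2 1 g) \<in> Lp p haar \<and>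
        Lp_norm p haar (\<lambda>g. symbol_norm q \<sigma> 1 1 g + symbol_norm q \<sigma> 2 1 g)
        \<le> Lp_norm p haar (symbol_norm q \<sigma> 1 1) + Lp_norm p haar (symbol_norm q \<sigma> 2 1)"
      by (intro Lp_triangle[OF p1] G) auto
    have 2: "(\<lambda>g. symbol_norm q \<sigma> 1 1 g + symbol_norm q \<sigma> 2 1 g + symbol_norm q \<sigma> 1 2 g) \<in> Lp p haar \<and>
        Lp_norm p haar (\<lambda>g. symbol_norm q \<sigma> 1 1 g + symbol_norm q \<sigma> 2 1 g + symbol_norm q \<sigma> 1 2 g)
        \<le> Lp_norm p haar (\<lambda>g. symbol_norm q \<sigma> 1 1 g + symbol_norm q \<sigma> 2 1 g)
          + Lp_norm p haar (symbol_norm q \<sigma> 1 2)"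
      using 1 by (intro Lp_triangle[OF p1] G) auto
    have 3: "H \<in> Lp p haar \<and> Lp_norm p haar H
        \<le> Lp_norm p haar (\<lambda>g. symbol_norm q \<sigma> 1 1 g + symbol_norm q \<sigma> 2 1 g + symbol_norm q \<sigma> 1 2 g)
          + Lp_norm p haar (symbol_norm q \<sigma> 2 2)"
      unfolding H_def using 2 by (intro Lp_triangle[OF p1] G) auto
    show ?thesis using 1 2 3 unfolding K_def by linarith
  qed
  have meas: "?T f \<in> borel_measurable haar" if f: "f \<in> L2 haar" for f
  proof -
    have "(\<lambda>g. \<Sum>i\<in>{1, 2}. \<Sum>j\<in>{1, 2}. symbol_trace \<sigma> i j f g) \<in> borel_measurable haar"
      by (intro borel_measurable_sum tm f) auto
    moreover have "(\<lambda>g. complex_of_real (modular g powr (- 1 / 2))) \<in> borel_measurable haar"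
      using modular_measurable by measurable
    ultimately have "(\<lambda>g. complex_of_real (modular g powr (- 1 / 2)) *
        (\<Sum>i\<in>{1, 2}. \<Sum>j\<in>{1, 2}. symbol_trace \<sigma> i j f g)) \<in> borel_measurable haar"
      by (rule borel_measurable_times[rotated])
    then show ?thesis by (simp only: pseudo_diff_def[abs_def])
  qed
  have bound: "cmod (?T f g) \<le> cmod (complex_of_real (L2_norm haar f) * H g)"
    if f: "f \<in> L2 haar" and g: "g \<in> poincare" for f g
  proof -
    define m N where "m = modular g powr (- 1 / 2)"
      and "N i j = schatten_norm q (cone_measure i j) (duflo_symbol \<sigma> g i j)" for i j
    have N0: "0 \<le> N i j" for i j unfolding N_def by (rule schatten_norm_nonneg[OF qf])
    have m0: "0 \<le> m" by (simp add: m_def)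
    have "cmod (\<Sum>i\<in>{1, 2}. \<Sum>j\<in>{1, 2}. symbol_trace \<sigma> i j f g)
        \<le> (\<Sum>i\<in>{1, 2}. \<Sum>j\<in>{1, 2}. L2_norm haar f * N i j)"
      unfolding N_def by (intro sum_norm_le tb g f)
    then have "m * cmod (\<Sum>i\<in>{1, 2}. \<Sum>j\<in>{1, 2}. symbol_trace \<sigma> i j f g)
        \<le> m * (\<Sum>i\<in>{1, 2}. \<Sum>j\<in>{1, 2}. L2_norm haar f * N i j)"
      using m0 by (rule mult_left_mono)
    moreover have "cmod (?T f g) = m * cmod (\<Sum>i\<in>{1, 2}. \<Sum>j\<in>{1, 2}. symbol_trace \<sigma> i j f g)"
      unfolding pseudo_diff_def norm_mult m_def[symmetric] using m0 by simp
    moreover have "H g = complex_of_real (m * N 1 1 + m * N 2 1 + m * N 1 2 + m * N 2 2)"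
      unfolding H_def symbol_norm_def m_def[symmetric] N_def[symmetric] by simp
    then have "cmod (complex_of_real (L2_norm haar f) * H g)
        = L2_norm haar f * (m * N 1 1 + m * N 2 1 + m * N 1 2 + m * N 2 2)"
      using m0 N0 by (simp add: norm_mult del: of_real_add of_real_mult)
    ultimately show ?thesis by (simp add: algebra_simps)
  qed
  have main: "?T f \<in> Lp p haar \<and> Lp_norm p haar (?T f) \<le> K * L2_norm haar f" if f: "f \<in> L2 haar" for f
  proof -
    have s: "(\<lambda>g. complex_of_real (L2_norm haar f) * H g) \<in> Lp p haar \<and>
        Lp_norm p haar (\<lambda>g. complex_of_real (L2_norm haar f) * H g)
        \<le> cmod (complex_of_real (L2_norm haar f)) * Lp_norm p haar H"
      using H by (intro Lp_scale[OF p1]) auto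
    have "?T f \<in> Lp p haar \<and> Lp_norm p haar (?T f)
        \<le> Lp_norm p haar (\<lambda>g. complex_of_real (L2_norm haar f) * H g)"
      using s by (intro Lp_dominated[OF p1] meas f AE_I2 bound) auto
    moreover have "L2_norm haar f * Lp_norm p haar H \<le> L2_norm haar f * K"
      using H by (intro mult_left_mono) auto
    ultimately show ?thesis using s by (simp add: mult.commute)
  qed
  have lin: "?T (\<lambda>p. f p + c * f' p) g = ?T f g + c * ?T f' g"
    if f: "f \<in> L2 haar" and f': "f' \<in> L2 haar" and g: "g \<in> poincare" for f f' g c
  proof -
    have "symbol_trace \<sigma> i j (\<lambda>p. f p + c * f' p) g = symbol_trace \<sigma> i j f g + c * symbol_trace \<sigma> i j f' g"
      if "i \<in> {1, 2}" "j \<in> {1, 2}" for i j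
      by (rule symbol_trace_lincomb[OF q that assms(3) assms(4)[OF _ that] g f f'])
    then show ?thesis
      unfolding pseudo_diff_def by (simp add: algebra_simps)
  qed
  have "bounded_op 2 haar p haar ?T"
    unfolding bounded_op_def
  proof (intro conjI ballI allI)
    show "?T f \<in> Lp p haar" if "f \<in> L2 haar" for f using main[OF that] by blast
    show "AE g in haar. ?T (\<lambda>y. f y + f' y) g = ?T f g + ?T f' g"
      if "f \<in> L2 haar" "f' \<in> L2 haar" for f f'
      using lin[OF that, of _ 1] by (intro AE_I2) simp
    show "AE g in haar. ?T (\<lambda>y. c * f y) g = c * ?T f g" if f: "f \<in> L2 haar" for c f
    proof (rule AE_I2)
      fix g assume "g \<in> space haar"
      then have g: "g \<in> poincare" by simp
      \<comment> \<open>Homogeneity is read off from \<open>lin\<close> with first argument 0, which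
        requires that the zero function be sent to 0; the pointwise bound supplies this.\<close>
      have "cmod (?T (\<lambda>p. 0) g) \<le> 0"
        using bound[OF L2_zero g] by (simp add: L2_norm_eq)
      then show "?T (\<lambda>y. c * f y) g = c * ?T f g"
        using lin[OF L2_zero f g, of c] by simp
    qed
    show "\<exists>C. \<forall>f\<in>L2 haar. Lp_norm p haar (?T f) \<le> C * L2_norm haar f"
      using main by blast
  qed
  moreover have "op_norm 2 haar p haar ?T \<le> K"
    unfolding op_norm_def
  proof (rule cInf_lower)
    show "K \<in> {C. 0 \<le> C \<and> (\<forall>f\<in>L2 haar. Lp_norm p haar (?T f) \<le> C * L2_norm haar f)}"
      using K0 main by blast
    show "bdd_below {C. 0 \<le> C \<and> (\<forall>f\<in>L2 haar. Lp_norm p haar (?T f) \<le> C * L2_norm haar f)}"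
      by (rule bdd_belowI[of _ 0]) simp
  qed
  ultimately show ?thesis unfolding K_def by blast
qed

end
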